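(* Let $d\ge 2$ and let $S\subset\mathbb{R}^d$ be a smooth embedded hypersurface (a $(d-1)$-dimensional submanifold, possibly with boundary $\partial S$) whose interior $\operatorname{Int}S$ has non-vanishing Gaussian curvature at every point. Let $$C:=\{h(x,1)\,:\,x\in S,\ h\in\mathbb{R}\}\subset\mathbb{R}^{d+1}$$ be the cone generated by $S$. Then $\dim_F(C)=d-1$.
   Context: For a Borel set $A\subset\mathbb{R}^n$, $\mathcal{M}(A)$ denotes the set of nonzero finite (positive) Borel measures $\mu$ on $\mathbb{R}^n$ supported on $A$. The Fourier transform of $\mu$ is $\widehat{\mu}(\xi)=\int e^{-2\pi i x\cdot\xi}\,d\mu(x)$. The Fourier dimension of $A$ is $$\dim_F(A):=\sup\Big\{s\in[0,n]\,:\,\exists\,\mu\in\mathcal{M}(A)\text{ with }\sup_{\xi\in\mathbb{R}^n}|\xi|^{s/2}|\widehat{\mu}(\xi)|<\infty\Big\}.$$ *)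

theory Defs
  imports "HOL-Analysis.Analysis"
begin

definition msupport :: "'a::topological_space measure \<Rightarrow> 'a set" where
  "msupport \<mu> = {x. \<forall>U. open U \<longrightarrow> x \<in> U \<longrightarrow> emeasure \<mu> U > 0}"

definition measures_on :: "'a::euclidean_space set \<Rightarrow> 'a measure set" where
  "measures_on A = {\<mu>. sets \<mu> = sets borel \<and> finite_measure \<mu>
      \<and> emeasure \<mu> (space \<mu>) \<noteq> 0 \<and> msupport \<mu> \<subseteq> A}"

definition fourier_transform :: "'a::euclidean_space measure \<Rightarrow> 'a \<Rightarrow> complex" where
  "fourier_transform \<mu> \<xi> = integral\<^sup>L \<mu> (\<lambda>x. cis (- 2 * pi * (x \<bullet> \<xi>)))"

definition fourier_dim :: "'a::euclidean_space set \<Rightarrow> real" where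
  "fourier_dim A = Sup {s. 0 \<le> s \<and> s \<le> real DIM('a) \<and>
      (\<exists>\<mu>\<in>measures_on A. \<exists>B. \<forall>\<xi>. norm \<xi> powr (s / 2) * cmod (fourier_transform \<mu> \<xi>) \<le> B)}"

definition partial :: "'m::finite \<Rightarrow> (real^'m \<Rightarrow> 'b::real_normed_vector) \<Rightarrow> real^'m \<Rightarrow> 'b" where
  "partial i f = (\<lambda>u. frechet_derivative f (at u) (axis i 1))"

definition smooth_on :: "(real^'m::finite) set \<Rightarrow> (real^'m \<Rightarrow> 'b::real_normed_vector) \<Rightarrow> bool" where
  "smooth_on V f \<longleftrightarrow> (\<forall>is. foldr partial is f differentiable_on V)"

definition half_space :: "'m::finite \<Rightarrow> (real^'m) set" where
  "half_space k = {u. 0 \<le> u $ k}"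

definition hs_chart :: "(real^'n::finite) set \<Rightarrow> (real^'n) set \<Rightarrow> (real^'m::finite) set
    \<Rightarrow> (real^'m \<Rightarrow> real^'n) \<Rightarrow> 'm \<Rightarrow> bool" where
  "hs_chart S U V \<phi> k \<longleftrightarrow> open U \<and> open V \<and> smooth_on V \<phi>
     \<and> (\<forall>u\<in>V. inj (frechet_derivative \<phi> (at u)))
     \<and> (\<exists>\<psi>. homeomorphism (V \<inter> half_space k) (S \<inter> U) \<phi> \<psi>)"

definition smooth_submanifold_bdry :: "'m::finite itself \<Rightarrow> (real^'n::finite) set \<Rightarrow> bool" where
  "smooth_submanifold_bdry _ S \<longleftrightarrow>
     (\<forall>p\<in>S. \<exists>U V (\<phi>::real^'m \<Rightarrow> real^'n) k. p \<in> U \<and> hs_chart S U V \<phi> k)"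

definition manifold_interior :: "'m::finite itself \<Rightarrow> (real^'n::finite) set \<Rightarrow> (real^'n) set" where
  "manifold_interior _ S = {p\<in>S. \<exists>U V (\<phi>::real^'m \<Rightarrow> real^'n) k u.
      hs_chart S U V \<phi> k \<and> u \<in> V \<and> 0 < u $ k \<and> \<phi> u = p}"

text \<open>Gaussian curvature of a parametrized hypersurface at parameter u:
  det(second fundamental form) / det(first fundamental form), w.r.t. a unit normal N.\<close>
definition unit_normal :: "(real^'m::finite \<Rightarrow> real^'n::finite) \<Rightarrow> real^'m \<Rightarrow> real^'n" where
  "unit_normal \<phi> u = (SOME N. norm N = 1 \<and> (\<forall>i. N \<bullet> partial i \<phi> u = 0))"

definition gauss_curvature :: "(real^'m::finite \<Rightarrow> real^'n::finite) \<Rightarrow> real^'m \<Rightarrow> real" where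
  "gauss_curvature \<phi> u =
     det (\<chi> i j. partial i (partial j \<phi>) u \<bullet> unit_normal \<phi> u)
     / det (\<chi> i j. partial i \<phi> u \<bullet> partial j \<phi> u)"

definition cone_over :: "(real^'n::finite) set \<Rightarrow> ((real^'n) \<times> real) set" where
  "cone_over S = {(h *\<^sub>R x, h) | x h. x \<in> S}"

end

theory Submission
  imports Defs "HOL-Probability.Sinc_Integral"
begin

text \<open>
  Write \<open>m = d - 1\<close> for the dimension of the hypersurface; both bounds give the exponent \<open>m\<close>.

  Upper bound, which needs no curvature. A measure with Fourier decay \<open>|\<xi>|\<^bsup>-s/2\<^esup>\<close> is first localised to a
  chart by multiplying with windows whose Fourier transforms have many moments. A cap of radius
  \<open>1/X\<close> in the parameter domain generates a piece of the cone on which the normal direction \<open>N\<close> of the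
  cone at the cap oscillates by \<open>O(X\<^sup>-\<^sup>2)\<close> only. Hence, for small \<open>\<epsilon>\<close>, the wave of frequency \<open>\<epsilon>X\<^sup>2N\<close> does not
  oscillate there, and the Fourier decay bounds the mass of the piece by \<open>O(X\<^bsup>-s\<^esup>)\<close>. As \<open>O(X\<^bsup>m\<^esup>)\<close> caps
  suffice, \<open>s \<le> m\<close>.

  Lower bound. The image of a bump density \<open>a(u)\<eta>(h)\<close> under \<open>(u,h) \<mapsto> h(\<phi>(u),1)\<close> decays like
  \<open>|\<xi>|\<^bsup>-m/2\<^esup>\<close>. At frequencies whose first component is almost normal to the surface, squaring the oscillatory
  integral turns the phase into \<open>\<phi>(u+v) - \<phi>(u)\<close>, whose gradient is comparable to \<open>|v|\<close> because the
  second fundamental form is nondegenerate; at all other frequencies the phase is nonstationary in \<open>u\<close>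
  or in \<open>h\<close>. In each case repeated integration by parts in a single direction suffices.
\<close>

text \<open>The obstacle in the upper bound is that cutting out a cap of radius 1/X must cost no
  decay, uniformly in X. A window that is the characteristic function of a probability measure
  achieves this: multiplying by it averages the Fourier transform over translates with total weight
  1, at whatever scale the window is used. Being compactly supported it leaves no tails outside the
  cap, and being nonnegative it allows the cosine to be compared pointwise. In the lower bound
  squaring loses nothing: the correlation at shift v is dominated by an integrable profile in L|v|,
  whose integral over v is O(L^-m), so the square root has exactly the exponent m/2. Only finitely
  many derivatives enter, which is why truncated polynomials can serve as bumps. Boundary points of
  S are harmless above, since a chart is smooth on an open set around their parameters; below, a
  chart is entered at an interior parameter. The apex of the cone is excluded above because a
  measure carried by the origin has no decay, and below by letting h range over [1,2].\<close>

lemma borel_measurable_cis [measurable]: "cis \<in> borel_measurable borel"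
  by (intro borel_measurable_continuous_onI continuous_intros)

section \<open>Fubini for integrands dominated by a product\<close>

lemma (in pair_sigma_finite) integrable_pair_dominated:
  fixes f :: "'a \<Rightarrow> 'b \<Rightarrow> 'c::{banach,second_countable_topology}" and g :: "'a \<Rightarrow> real" and h :: "'b \<Rightarrow> real"
  assumes [measurable]: "case_prod f \<in> borel_measurable (M1 \<Otimes>\<^sub>M M2)"
    and g: "integrable M1 g" and h: "integrable M2 h"
    and le: "\<And>x y. norm (f x y) \<le> g x * h y"
  shows "integrable (M1 \<Otimes>\<^sub>M M2) (case_prod f)"
proof (rule Bochner_Integration.integrable_bound)
  have [measurable]: "g \<in> borel_measurable M1" "h \<in> borel_measurable M2" using g h by auto
  have "integrable (M1 \<Otimes>\<^sub>M M2) (\<lambda>(x,y). g x * h y)"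
  proof (rule Fubini_integrable)
    show "integrable M1 (\<lambda>x. \<integral>y. norm ((\<lambda>(x,y). g x * h y) (x, y)) \<partial>M2)"
      using g by (simp add: abs_mult)
    show "AE x in M1. integrable M2 (\<lambda>y. (\<lambda>(x,y). g x * h y) (x, y))"
      using h by simp
  qed auto
  then show "integrable (M1 \<Otimes>\<^sub>M M2) (\<lambda>p. g (fst p) * h (snd p))" by (simp add: case_prod_beta')
  show "AE p in M1 \<Otimes>\<^sub>M M2. norm (case_prod f p) \<le> norm (g (fst p) * h (snd p))"
    using le by (auto intro!: AE_I2 order_trans[OF le])
qed simp

lemma (in pair_sigma_finite) Fubini_dominated:
  fixes f :: "'a \<Rightarrow> 'b \<Rightarrow> 'c::{banach,second_countable_topology}" and g :: "'a \<Rightarrow> real" and h :: "'b \<Rightarrow> real"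
  assumes "case_prod f \<in> borel_measurable (M1 \<Otimes>\<^sub>M M2)" "integrable M1 g" "integrable M2 h"
    and "\<And>x y. norm (f x y) \<le> g x * h y"
  shows "(\<integral>y. (\<integral>x. f x y \<partial>M1) \<partial>M2) = (\<integral>x. (\<integral>y. f x y \<partial>M2) \<partial>M1)"
  by (rule Fubini_integral[OF integrable_pair_dominated[OF assms]])

lemma integrable_inverse_1_plus_square_lborel: "integrable lborel (\<lambda>x::real. 1 / (1 + x\<^sup>2))"
  using integrable_inverse_1_plus_square
  by (simp add: set_integrable_def inverse_eq_divide)

section \<open>Compactly supported characteristic functions\<close>

text \<open>\<open>sinc\<close> abbreviates a case distinction; a constant of its own keeps that
  distinction folded during simplification.\<close>

definition sincf :: "real \<Rightarrow> real" where "sincf x = sinc x"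

lemma sincf_borel [measurable]: "sincf \<in> borel_measurable borel"
  unfolding sincf_def[abs_def] by measurable

lemma sincf_0 [simp]: "sincf 0 = 1" by (simp add: sincf_def)

lemma sincf_nz: "x \<noteq> 0 \<Longrightarrow> sincf x = sin x / x" by (simp add: sincf_def)

lemma sincf_minus [simp]: "sincf (- x) = sincf x" by (simp add: sincf_def)

lemma abs_sinc_le_1: "\<bar>sincf x\<bar> \<le> 1"
  using abs_sin_x_le_abs_x[of x] by (simp add: sincf_def divide_le_eq)

lemma abs_mult_sinc_le_1: "\<bar>x\<bar> * \<bar>sincf x\<bar> \<le> 1"
  by (simp add: sincf_def)

lemma sinc_square_le: "(sincf x)\<^sup>2 \<le> 2 * (1 / (1 + x\<^sup>2))"
proof -
  have a: "(sincf x)\<^sup>2 \<le> 1" using abs_sinc_le_1[of x] by (metis abs_square_le_1)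
  have "\<bar>x * sincf x\<bar> \<le> 1" using abs_mult_sinc_le_1[of x] by (simp only: abs_mult)
  then have b: "x\<^sup>2 * (sincf x)\<^sup>2 \<le> 1" by (metis abs_square_le_1 power_mult_distrib)
  have "(1 + x\<^sup>2) * (sincf x)\<^sup>2 \<le> 2" using a b by (simp only: ring_distribs)
  moreover have "0 < 1 + x\<^sup>2" by (simp add: add_pos_nonneg)
  ultimately show ?thesis by (metis mult.commute pos_le_divide_eq times_divide_eq_right mult_1_right)
qed

text \<open>Each of \<open>p\<close> of the factors \<open>sincf x\<close> absorbs one factor of x;
  the remaining \<open>j\<close>, at least two, leave the integrable majorant 2 / (1 + x^2).\<close>

lemma integrable_sinc_power:
  assumes "2 \<le> j"
  shows "integrable lborel (\<lambda>x. \<bar>x\<bar> ^ p * \<bar>sincf x\<bar> ^ (p + j))"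
proof (rule Bochner_Integration.integrable_bound)
  show "integrable lborel (\<lambda>x. 2 * (1 / (1 + x\<^sup>2)) :: real)"
    using integrable_inverse_1_plus_square_lborel by (rule integrable_mult_right)
  show "(\<lambda>x. \<bar>x\<bar> ^ p * \<bar>sincf x\<bar> ^ (p + j)) \<in> borel_measurable lborel" by measurable
  show "AE x in lborel. norm (\<bar>x\<bar> ^ p * \<bar>sincf x\<bar> ^ (p + j)) \<le> norm (2 * (1 / (1 + x\<^sup>2)))"
  proof (rule AE_I2)
    fix x :: real
    have "\<bar>x\<bar> ^ p * \<bar>sincf x\<bar> ^ (p + j) = (\<bar>x\<bar> * \<bar>sincf x\<bar>) ^ p * \<bar>sincf x\<bar> ^ j"
      by (simp only: power_add power_mult_distrib mult.assoc)
    also have "\<dots> \<le> 1 * \<bar>sincf x\<bar> ^ 2"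
      using abs_mult_sinc_le_1[of x] abs_sinc_le_1[of x] assms
      by (intro mult_mono power_le_one power_decreasing) (simp_all only: zero_le_mult_iff abs_ge_zero simp_thms zero_le_power zero_le_one)
    also have "\<dots> \<le> 2 * (1 / (1 + x\<^sup>2))"
      using sinc_square_le[of x] by (simp only: power2_abs mult_1)
    finally have *: "\<bar>x\<bar> ^ p * \<bar>sincf x\<bar> ^ (p + j) \<le> 2 * (1 / (1 + x\<^sup>2))" .
    have "0 \<le> \<bar>x\<bar> ^ p * \<bar>sincf x\<bar> ^ (p + j)" by (intro mult_nonneg_nonneg zero_le_power abs_ge_zero)
    with * show "norm (\<bar>x\<bar> ^ p * \<bar>sincf x\<bar> ^ (p + j)) \<le> norm (2 * (1 / (1 + x\<^sup>2)))"
      by (metis abs_of_nonneg order_trans real_norm_def)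
  qed
qed

text \<open>Up to a constant factor this is the B-spline obtained by convolving the indicator of
  [-1,1] with itself \<open>j\<close> times, which explains its sign and its support.\<close>

definition sinc_ft :: "nat \<Rightarrow> real \<Rightarrow> real" where
  "sinc_ft j t = (\<integral>x. sincf x ^ j * cos (t * x) \<partial>lborel)"

lemma integrable_sinc_power_abs: "2 \<le> j \<Longrightarrow> integrable lborel (\<lambda>x. \<bar>sincf x\<bar> ^ j)"
  using integrable_sinc_power[of j 0] by simp

lemma integrable_sinc_power_mult:
  assumes "2 \<le> j" and [measurable]: "f \<in> borel_measurable borel" and "\<And>x. \<bar>f x\<bar> \<le> 1"
  shows "integrable lborel (\<lambda>x. sincf x ^ j * f x)"
proof (rule Bochner_Integration.integrable_bound[OF integrable_sinc_power_abs[OF assms(1)]])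
  show "AE x in lborel. norm (sincf x ^ j * f x) \<le> norm (\<bar>sincf x\<bar> ^ j)"
    using assms(3) by (intro AE_I2) (simp add: abs_mult power_abs mult_left_le)
qed measurable

lemma sinc_integral_cos: "(\<integral>s. indicator {-1..1} s * cos (s * x) \<partial>lborel) = 2 * sincf x"
proof (cases "x = 0")
  case True then show ?thesis by simp
next
  case False
  have "has_bochner_integral lborel (\<lambda>s. cos (s * x) * indicator {-1..1} s) (sin (1 * x) / x - sin ((-1) * x) / x)"
    using False by (intro has_bochner_integral_FTC_Icc_real)
      (auto intro!: derivative_eq_intros continuous_intros simp: has_real_derivative_iff_has_vector_derivative[symmetric])
  then show ?thesis using False
    by (simp add: sincf_nz has_bochner_integral_iff mult.commute)
qed

text \<open>Substitution leaves one factor |a| of a^2; this is the source of the absolute values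
  that make up the tent function \<open>sinc_ft 2\<close>.\<close>

lemma sinc_square_scale:
  assumes "a \<noteq> 0"
  shows "(\<integral>x. a\<^sup>2 * (sincf (a * x))\<^sup>2 \<partial>lborel) = \<bar>a\<bar> * sinc_ft 2 0"
proof -
  have "sinc_ft 2 0 = \<bar>a\<bar> *\<^sub>R (\<integral>x. (sincf (0 + a * x))\<^sup>2 * cos (0 * (0 + a * x)) \<partial>lborel)"
    unfolding sinc_ft_def by (rule lborel_integral_real_affine[OF assms])
  then have *: "sinc_ft 2 0 = \<bar>a\<bar> * (\<integral>x. (sincf (a * x))\<^sup>2 \<partial>lborel)" by simp
  have "(\<integral>x. a\<^sup>2 * (sincf (a * x))\<^sup>2 \<partial>lborel) = \<bar>a\<bar> * (\<bar>a\<bar> * (\<integral>x. (sincf (a * x))\<^sup>2 \<partial>lborel))"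
    by (simp add: power2_eq_square del: mult_eq_0_iff)
  then show ?thesis using * by simp
qed

lemma integrable_sinc_square_scale: "integrable lborel (\<lambda>x. a\<^sup>2 * (sincf (a * x))\<^sup>2)"
proof (cases "a = 0")
  case False
  have "integrable lborel (\<lambda>x. (sincf x)\<^sup>2)" using integrable_sinc_power_abs[of 2] by (simp only: power2_abs)
  from lborel_integrable_real_affine[OF this False, of 0] show ?thesis
    by (intro integrable_mult_right) simp
qed simp

text \<open>For \<open>x \<noteq> 0\<close> one has \<open>a\<^sup>2 sinc\<^sup>2(ax) = (1 - cos 2ax) / (2x\<^sup>2)\<close>, so the product-to-sum formula
  exhibits \<open>sinc\<^sup>2 x cos tx\<close> as a combination of rescaled copies of \<open>sinc\<^sup>2\<close>;
  the value of the integral of \<open>sinc\<^sup>2\<close> is never needed.\<close>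

lemma sinc_ft_2: "sinc_ft 2 t = sinc_ft 2 0 * (\<bar>t / 2 + 1\<bar> / 2 + \<bar>t / 2 - 1\<bar> / 2 - \<bar>t / 2\<bar>)"
proof -
  let ?q = "\<lambda>a x. a\<^sup>2 * (sincf (a * x))\<^sup>2"
  have *: "(sincf x)\<^sup>2 * cos (t * x) = ?q (t/2 + 1) x / 2 + ?q (t/2 - 1) x / 2 - ?q (t/2) x" if "x \<noteq> 0" for x
  proof -
    have q: "?q a x = (1 - cos (2 * a * x)) / (2 * x\<^sup>2)" for a
      using that cos_double_sin[of "a * x"] by (cases "a = 0") (simp_all add: sincf_nz field_simps)
    have s: "(sincf x)\<^sup>2 = (1 - cos (2 * x)) / (2 * x\<^sup>2)"
      using q[of 1] by simp
    have c: "cos (2 * x) * cos (t * x) = (cos (2 * (t/2 + 1) * x) + cos (2 * (t/2 - 1) * x)) / 2"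
      by (simp add: cos_times_cos algebra_simps flip: cos_minus[of "x * 2 - t * x"])
    have "(sincf x)\<^sup>2 * cos (t * x) = (cos (t * x) - cos (2 * x) * cos (t * x)) / (2 * x\<^sup>2)"
      unfolding s by (simp add: algebra_simps diff_divide_distrib)
    also have "\<dots> = ((1 - cos (2 * (t/2 + 1) * x)) / 2 + (1 - cos (2 * (t/2 - 1) * x)) / 2 - (1 - cos (2 * (t/2) * x))) / (2 * x\<^sup>2)"
      unfolding c by (intro arg_cong2[where f="(/)"]) (simp_all add: field_simps)
    also have "\<dots> = ?q (t/2 + 1) x / 2 + ?q (t/2 - 1) x / 2 - ?q (t/2) x"
      unfolding q using that by (simp only: add_divide_distrib diff_divide_distrib divide_divide_eq_left mult.commute)
    finally show ?thesis .
  qed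
  have "sinc_ft 2 t = (\<integral>x. ?q (t/2 + 1) x / 2 + ?q (t/2 - 1) x / 2 - ?q (t/2) x \<partial>lborel)"
    unfolding sinc_ft_def
  proof (rule integral_cong_AE)
    show "AE x in lborel. (sincf x)\<^sup>2 * cos (t * x) = ?q (t/2 + 1) x / 2 + ?q (t/2 - 1) x / 2 - ?q (t/2) x"
      using AE_lborel_singleton[of 0] by eventually_elim (rule *)
  qed measurable
  also have "\<dots> = (\<integral>x. ?q (t/2 + 1) x \<partial>lborel) / 2 + (\<integral>x. ?q (t/2 - 1) x \<partial>lborel) / 2 - (\<integral>x. ?q (t/2) x \<partial>lborel)"
    by (subst Bochner_Integration.integral_diff Bochner_Integration.integral_add
        | intro Bochner_Integration.integrable_add integrable_divide integrable_sinc_square_scale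
        | simp only: integral_divide_zero)+
  also have "\<dots> = sinc_ft 2 0 * (\<bar>t / 2 + 1\<bar> / 2 + \<bar>t / 2 - 1\<bar> / 2 - \<bar>t / 2\<bar>)"
  proof -
    have s: "(\<integral>x. ?q a x \<partial>lborel) = \<bar>a\<bar> * sinc_ft 2 0" for a
      using sinc_square_scale[of a] by (cases "a = 0") (simp_all del: mult_eq_0_iff)
    show ?thesis unfolding s by (simp add: algebra_simps)
  qed
  finally show ?thesis .
qed

text \<open>One more factor \<open>sincf\<close> is one more convolution with an interval: the new
  factor is written as the cosine transform of the indicator of [-1,1], the integrals are exchanged,
  and the product of cosines becomes a sum.\<close>

lemma sinc_ft_Suc:
  assumes j: "2 \<le> j"
  shows "sinc_ft (Suc j) t = (\<integral>s. indicator {-1..1} s * (sinc_ft j (t + s) + sinc_ft j (t - s)) / 4 \<partial>lborel)"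
proof -
  let ?f = "\<lambda>x s. sincf x ^ j * cos (t * x) * (indicator {-1..1} s * cos (s * x) / 2)"
  have "sinc_ft (Suc j) t = (\<integral>x. (\<integral>s. ?f x s \<partial>lborel) \<partial>lborel)"
    unfolding sinc_ft_def
  proof (rule Bochner_Integration.integral_cong[OF refl])
    fix x :: real
    show "sincf x ^ Suc j * cos (t * x) = (\<integral>s. ?f x s \<partial>lborel)"
      using sinc_integral_cos[of x] by (simp add: mult.assoc)
  qed
  also have "\<dots> = (\<integral>s. (\<integral>x. ?f x s \<partial>lborel) \<partial>lborel)"
  proof (rule sym, rule lborel_pair.Fubini_dominated)
    show "integrable lborel (\<lambda>x. \<bar>sincf x\<bar> ^ j)" by (rule integrable_sinc_power_abs[OF j])
    show "integrable lborel (indicat_real {-1..1::real})" by simp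
    show "norm (?f x s) \<le> \<bar>sincf x\<bar> ^ j * indicator {-1..1} s" for x s
    proof -
      have "\<bar>cos (t * x)\<bar> * \<bar>indicator {-1..1} s * cos (s * x) / 2\<bar> \<le> 1 * indicator {-1..1} s"
        by (intro mult_mono) (auto simp: indicator_def abs_cos_le_one intro: order_trans[OF abs_cos_le_one])
      then have "\<bar>sincf x\<bar> ^ j * (\<bar>cos (t * x)\<bar> * \<bar>indicator {-1..1} s * cos (s * x) / 2\<bar>) \<le> \<bar>sincf x\<bar> ^ j * indicator {-1..1} s"
        by (intro mult_left_mono) (simp_all only: mult_1 zero_le_power abs_ge_zero)
      then show ?thesis by (simp only: real_norm_def abs_mult power_abs mult.assoc)
    qed
  qed measurable
  also have "\<dots> = (\<integral>s. indicator {-1..1} s * (sinc_ft j (t + s) + sinc_ft j (t - s)) / 4 \<partial>lborel)"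
  proof (rule Bochner_Integration.integral_cong[OF refl])
    fix s :: real
    have i: "integrable lborel (\<lambda>x. sincf x ^ j * cos (a * x))" for a
      by (intro integrable_sinc_power_mult j) (auto intro: abs_cos_le_one)
    have "(\<integral>x. ?f x s \<partial>lborel) = (\<integral>x. indicator {-1..1} s / 4 * (sincf x ^ j * cos ((t + s) * x) + sincf x ^ j * cos ((t - s) * x)) \<partial>lborel)"
    proof (rule Bochner_Integration.integral_cong[OF refl])
      fix x :: real
      have c: "cos (t * x) * cos (s * x) = (cos ((t - s) * x) + cos ((t + s) * x)) / 2"
        using cos_minus[of "s * x - t * x"] by (simp add: cos_times_cos algebra_simps)
      show "?f x s = indicator {-1..1} s / 4 * (sincf x ^ j * cos ((t + s) * x) + sincf x ^ j * cos ((t - s) * x))"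
        using arg_cong[OF c, of "\<lambda>z. sincf x ^ j * indicator {-1..1} s / 2 * z"]
        by (cases "s \<in> {-1..1}") (simp_all add: distrib_left mult.assoc add.commute)
    qed
    also have "\<dots> = indicator {-1..1} s * (sinc_ft j (t + s) + sinc_ft j (t - s)) / 4"
      unfolding integral_mult_right_zero sinc_ft_def
      by (subst Bochner_Integration.integral_add[OF i i]) simp
    finally show "(\<integral>x. ?f x s \<partial>lborel) = indicator {-1..1} s * (sinc_ft j (t + s) + sinc_ft j (t - s)) / 4" .
  qed
  finally show ?thesis .
qed

text \<open>The tent function at \<open>j = 2\<close> is nonnegative and supported in [-2,2];
  averaging over translates by at most 1 preserves the sign and widens the support by 1. The
  induction starts at 2 because \<open>sincf\<close> itself is not absolutely integrable.\<close>

lemma sinc_ft_nonneg_support: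
  assumes "2 \<le> j"
  shows "0 \<le> sinc_ft j t \<and> (real j \<le> \<bar>t\<bar> \<longrightarrow> sinc_ft j t = 0)"
  using assms
proof (induction j arbitrary: t rule: dec_induct)
  case base
  have "0 \<le> sinc_ft 2 0" unfolding sinc_ft_def by (intro Bochner_Integration.integral_nonneg) simp
  moreover have "0 \<le> \<bar>t / 2 + 1\<bar> / 2 + \<bar>t / 2 - 1\<bar> / 2 - \<bar>t / 2\<bar>" by (auto simp: abs_if field_simps)
  moreover have "\<bar>t / 2 + 1\<bar> / 2 + \<bar>t / 2 - 1\<bar> / 2 - \<bar>t / 2\<bar> = 0" if "real 2 \<le> \<bar>t\<bar>"
    using that by (auto simp: abs_if field_simps split: if_splits)
  ultimately show ?case by (metis sinc_ft_2 mult_nonneg_nonneg mult_zero_right)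
next
  case (step j)
  have 1: "0 \<le> sinc_ft (Suc j) t" unfolding sinc_ft_Suc[OF step(1)]
    using step.IH by (intro Bochner_Integration.integral_nonneg) simp
  have "sinc_ft (Suc j) t = 0" if t: "real (Suc j) \<le> \<bar>t\<bar>"
  proof -
    have "indicator {-1..1} s * (sinc_ft j (t + s) + sinc_ft j (t - s)) / 4 = 0" for s
    proof (cases "s \<in> {-1..1}")
      case True
      then have "real j \<le> \<bar>t + s\<bar>" "real j \<le> \<bar>t - s\<bar>" using t by auto
      then show ?thesis using step.IH by simp
    qed simp
    then show ?thesis unfolding sinc_ft_Suc[OF step(1)] by (simp only: integral_zero)
  qed
  with 1 show ?case by blast
qed

text \<open>An even power has a nonnegative integrand, so the integral can vanish only if
  \<open>sincf\<close> is zero almost everywhere, which fails on (0,1).\<close>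

lemma sinc_ft_0_pos:
  assumes "2 \<le> j" "even j"
  shows "0 < sinc_ft j 0"
proof -
  have nn: "0 \<le> sincf x ^ j" for x using assms(2) by (simp add: zero_le_even_power)
  have i: "integrable lborel (\<lambda>x. sincf x ^ j)"
    using integrable_sinc_power_mult[OF assms(1), of "\<lambda>_. 1"] by simp
  have "sinc_ft j 0 \<noteq> 0"
  proof
    assume "sinc_ft j 0 = 0"
    then have "(\<integral>x. sincf x ^ j \<partial>lborel) = 0" by (simp add: sinc_ft_def)
    then have "AE x in lborel. sincf x ^ j = 0"
      using integral_nonneg_eq_0_iff_AE[OF i] nn by simp
    then have "AE x in lborel. x \<notin> {0<..<1::real}"
    proof eventually_elim
      case (elim x)
      show ?case
      proof
        assume x: "x \<in> {0<..<1::real}"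
        then have "0 < sin x" using pi_gt3 by (intro sin_gt_zero) auto
        then show False using x elim by (simp add: sincf_nz)
      qed
    qed
    then have "emeasure lborel {0<..<1::real} = 0"
      using AE_iff_measurable[of "{0<..<1::real}" lborel "\<lambda>x. x \<notin> {0<..<1}"]
      by (simp add: greaterThanLessThan_eq greaterThan_def lessThan_def Collect_conj_eq[symmetric])
    then show False by simp
  qed
  moreover have "0 \<le> sinc_ft j 0" using sinc_ft_nonneg_support[OF assms(1)] by blast
  ultimately show ?thesis by simp
qed

lemma sinc_power_sin_integral_0: "even j \<Longrightarrow> (\<integral>x. sincf x ^ j * sin (t * x) \<partial>lborel) = 0"
  using lborel_integral_real_affine[of "-1" "\<lambda>x. sincf x ^ j * sin (t * x)" 0] by simp

text \<open>\<open>G\<close> is the window and \<open>M\<close> its spectral side. Total mass 1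
  makes averaging over \<open>M\<close> free of constants; the moment of order \<open>p\<close> lets
  polynomial weights survive the averaging. The window is supported within \<open>r\<close> and at
  least 1/2 within \<open>\<delta>\<close>, so it is comparable to the indicator of an
  interval.\<close>

locale window = finite_measure M for M :: "real measure" +
  fixes G :: "real \<Rightarrow> real" and r \<delta> :: real and p :: nat
  assumes sets_M [simp, measurable_cong]: "sets M = sets borel"
    and M_total: "measure M UNIV = 1"
    and M_moment: "integrable M (\<lambda>x. \<bar>x\<bar> ^ p)"
    and G_char: "(\<integral>x. cis (t * x) \<partial>M) = of_real (G t)"
    and G_nonneg: "0 \<le> G t" and G_le_1: "G t \<le> 1"
    and G_cont: "continuous_on UNIV G"
    and r_pos: "0 < r" and G_support: "r \<le> \<bar>t\<bar> \<Longrightarrow> G t = 0"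
    and \<delta>_pos: "0 < \<delta>" and G_ge: "\<bar>t\<bar> \<le> \<delta> \<Longrightarrow> 1 / 2 \<le> G t"

lemma window_exists: "\<exists>M G r \<delta>. window M G r \<delta> p"
proof -
  \<comment> \<open>Even, so that the density is nonnegative; large enough for the moment of order
    \<open>p\<close> and, even when \<open>p = 0\<close>, for the first moment that yields the
    Lipschitz constant of \<open>G\<close>.\<close>
  define j where "j = 2 * (p + 2)"
  have j: "2 \<le> j" "even j" by (auto simp: j_def)
  define c where "c = sinc_ft j 0"
  have c: "0 < c" unfolding c_def by (rule sinc_ft_0_pos[OF j])
  define d where "d x = sincf x ^ j / c" for x
  have d0: "0 \<le> d x" for x using c j by (simp add: d_def zero_le_even_power)
  have [measurable]: "d \<in> borel_measurable borel" unfolding d_def by measurable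
  have d_abs: "d x = \<bar>sincf x\<bar> ^ j / c" for x using j by (simp add: d_def power_even_abs)
  define M where "M = density lborel d"
  define G where "G t = sinc_ft j t / c" for t
  have [simp, measurable_cong]: "sets M = sets borel" by (simp add: M_def)
  have [simp]: "space M = UNIV" by (simp add: M_def)
  have mom: "integrable lborel (\<lambda>x. d x * \<bar>x\<bar> ^ q)" if "q \<le> p + 2" for q
  proof -
    have "integrable lborel (\<lambda>x. (\<bar>x\<bar> ^ q * \<bar>sincf x\<bar> ^ (q + (j - q))) / c)"
      using that by (intro integrable_divide integrable_sinc_power) (simp add: j_def)
    moreover have "q + (j - q) = j" using that by (simp add: j_def)
    ultimately show ?thesis by (simp add: d_abs mult.commute)
  qed
  have momM: "integrable M (\<lambda>x. \<bar>x\<bar> ^ q)" if "q \<le> p + 2" for q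
    unfolding M_def using d0 mom[OF that] by (subst integrable_real_density) auto
  have cosd: "(\<integral>x. cos (t * x) \<partial>M) = G t" for t
    unfolding M_def G_def sinc_ft_def using d0 by (subst integral_real_density) (auto simp: d_def)
  have sind: "(\<integral>x. sin (t * x) \<partial>M) = 0" for t
    unfolding M_def using d0 sinc_power_sin_integral_0[OF j(2), of t] by (subst integral_real_density) (auto simp: d_def)
  have fin: "finite_measure M"
  proof
    have "integrable lborel d" using mom[of 0] by simp
    then show "emeasure M (space M) \<noteq> \<infinity>"
      by (simp add: M_def emeasure_density nn_integral_eq_integral d0)
  qed
  interpret finite_measure M by (rule fin)
  have "measure M UNIV = (\<integral>x. cos (0 * x) \<partial>M)" by simp
  also have "\<dots> = 1" unfolding cosd using c by (simp add: G_def c_def)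
  finally have one: "measure M UNIV = 1" .
  have bi: "integrable M f" if "f \<in> borel_measurable borel" "\<And>x. \<bar>f x\<bar> \<le> 1" for f :: "real \<Rightarrow> real"
    using that by (intro integrable_const_bound[where B=1]) auto
  \<comment> \<open>The first absolute moment of \<open>M\<close> is a Lipschitz constant of its
    characteristic function.\<close>
  define L where "L = (\<integral>x. \<bar>x\<bar> \<partial>M)"
  have L0: "0 \<le> L" unfolding L_def by simp
  have lip: "\<bar>G s - G t\<bar> \<le> L * \<bar>s - t\<bar>" for s t
  proof -
    have "G s - G t = (\<integral>x. cos (s * x) - cos (t * x) \<partial>M)"
      unfolding cosd[symmetric] by (rule Bochner_Integration.integral_diff[symmetric]) (auto intro!: bi)
    also have "\<bar>\<dots>\<bar> \<le> (\<integral>x. \<bar>s - t\<bar> * \<bar>x\<bar> \<partial>M)"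
    proof -
      have "norm (\<integral>x. cos (s * x) - cos (t * x) \<partial>M) \<le> (\<integral>x. \<bar>s - t\<bar> * \<bar>x\<bar> \<partial>M)"
      proof (rule order_trans[OF integral_norm_bound], rule integral_mono)
        show "integrable M (\<lambda>x. norm (cos (s * x) - cos (t * x)))"
          by (intro integrable_norm Bochner_Integration.integrable_diff) (auto intro!: bi)
        show "integrable M (\<lambda>x. \<bar>s - t\<bar> * \<bar>x\<bar>)" using momM[of 1] by simp
        fix x
        have "\<bar>cos (s * x) - cos (t * x)\<bar> = 2 * (\<bar>sin ((s * x + t * x) / 2)\<bar> * \<bar>sin ((t * x - s * x) / 2)\<bar>)"
          by (simp add: cos_diff_cos abs_mult)
        also have "\<dots> \<le> 2 * (1 * \<bar>(t * x - s * x) / 2\<bar>)"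
          by (intro mult_mono abs_sin_x_le_abs_x) auto
        also have "\<dots> = \<bar>s - t\<bar> * \<bar>x\<bar>" by (simp add: abs_mult[symmetric] algebra_simps abs_minus_commute)
        finally show "norm (cos (s * x) - cos (t * x)) \<le> \<bar>s - t\<bar> * \<bar>x\<bar>" by simp
      qed
      then show ?thesis by simp
    qed
    also have "\<dots> = L * \<bar>s - t\<bar>" unfolding L_def by simp
    finally show ?thesis .
  qed
  have G01: "G 0 = 1" using c by (simp add: G_def c_def)
  \<comment> \<open>Since \<open>G 0 = 1\<close> and \<open>G\<close> is \<open>L\<close>-Lipschitz,
    it stays above 1/2 within 1 / (2 (L + 1)); the added 1 guards against
    \<open>L = 0\<close>.\<close>
  have "window M G (real j) (1 / (2 * (L + 1))) p"
  proof
    show "(\<integral>x. cis (t * x) \<partial>M) = of_real (G t)" for t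
    proof -
      have i: "integrable M (\<lambda>x. cis (t * x))"
        by (intro integrable_const_bound[where B=1]) auto
      show ?thesis
        using integral_Re[OF i] integral_Im[OF i] cosd[of t] sind[of t] by (intro complex_eqI) auto
    qed
    show "0 \<le> G t" for t using sinc_ft_nonneg_support[OF j(1)] c by (simp add: G_def)
    show "G t \<le> 1" for t
    proof -
      have "G t \<le> (\<integral>x. 1 \<partial>M)" unfolding cosd[symmetric] by (intro integral_mono bi) auto
      then show ?thesis using one by simp
    qed
    show "continuous_on UNIV G"
      using lip L0 by (intro lipschitz_on_continuous_on[where L=L] lipschitz_onI) (auto simp: dist_real_def)
    show "G t = 0" if "real j \<le> \<bar>t\<bar>" for t
      using sinc_ft_nonneg_support[OF j(1)] that by (simp add: G_def)
    show "1 / 2 \<le> G t" if "\<bar>t\<bar> \<le> 1 / (2 * (L + 1))" for t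
    proof -
      have "L * \<bar>t - 0\<bar> \<le> (L + 1) * (1 / (2 * (L + 1)))" using L0 that by (intro mult_mono) auto
      also have "\<dots> = 1 / 2" using L0 by simp
      finally show ?thesis using lip[of t 0] G01 by simp
    qed
    show "0 < 1 / (2 * (L + 1))" using L0 by simp
  qed (use fin one momM[of p] j in auto)
  then show ?thesis by blast
qed

text \<open>If \<open>f\<close> is not integrable its Bochner integral is 0 by convention, so
  domination by an integrable function is all that has to be checked.\<close>

lemma norm_integral_le:
  fixes f :: "'a \<Rightarrow> 'b::{banach,second_countable_topology}" and g :: "'a \<Rightarrow> real"
  assumes g: "integrable M g" and le: "\<And>x. norm (f x) \<le> g x"
  shows "norm (\<integral>x. f x \<partial>M) \<le> (\<integral>x. g x \<partial>M)"
proof (cases "integrable M f")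
  case True
  have "norm (\<integral>x. f x \<partial>M) \<le> (\<integral>x. norm (f x) \<partial>M)" by (rule integral_norm_bound)
  also have "\<dots> \<le> (\<integral>x. g x \<partial>M)" using True g le by (intro integral_mono) auto
  finally show ?thesis .
next
  case False
  have "0 \<le> (\<integral>x. g x \<partial>M)" by (intro Bochner_Integration.integral_nonneg order_trans[OF norm_ge_zero le])
  then show ?thesis using False by (simp add: not_integrable_integral_eq)
qed

section \<open>Fourier transforms of weighted measures\<close>

text \<open>The Fourier transform of the measure with density \<open>w\<close> against
  \<open>\<mu>\<close>. Keeping the weight apart from the measure lets windows be multiplied in one
  at a time.\<close>

definition wft :: "'a::euclidean_space measure \<Rightarrow> ('a \<Rightarrow> real) \<Rightarrow> 'a \<Rightarrow> complex" where
  "wft \<mu> w \<xi> = (\<integral>y. of_real (w y) * cis (- 2 * pi * (y \<bullet> \<xi>)) \<partial>\<mu>)"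

lemma norm_wft_le:
  assumes "finite_measure \<mu>" "\<And>y. \<bar>w y\<bar> \<le> 1"
  shows "cmod (wft \<mu> w \<xi>) \<le> measure \<mu> (space \<mu>)"
proof -
  interpret finite_measure \<mu> by fact
  have "cmod (wft \<mu> w \<xi>) \<le> (\<integral>y. 1 \<partial>\<mu>)" unfolding wft_def
    using assms(2) by (intro norm_integral_le) (auto simp: norm_mult)
  then show ?thesis by simp
qed

lemma powr_add_le:
  fixes x y q :: real
  assumes "0 \<le> x" "0 \<le> y" "0 \<le> q"
  shows "(x + y) powr q \<le> 2 powr q * (x powr q + y powr q)"
proof -
  have "(x + y) powr q \<le> (2 * max x y) powr q" using assms by (intro powr_mono2) auto
  also have "\<dots> = 2 powr q * max x y powr q" using assms by (simp add: powr_mult)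
  also have "\<dots> \<le> 2 powr q * (x powr q + y powr q)" by (intro mult_left_mono) (auto simp: max_def)
  finally show ?thesis .
qed

context window
begin

lemma G_borel [measurable]: "G \<in> borel_measurable borel"
  using G_cont by (rule borel_measurable_continuous_onI)

lemma space_M [simp]: "space M = UNIV"
  using sets_eq_imp_space_eq[OF sets_M] by simp

lemma abs_G_le_1: "\<bar>G t\<bar> \<le> 1" using G_nonneg[of t] G_le_1[of t] by simp

text \<open>A window is an \<open>M\<close>-average of characters, and multiplying by a character
  shifts the frequency along \<open>e\<close>. The 2 pi converts between the two normalisations of
  the exponential.\<close>

lemma wft_mult_window:
  fixes \<mu> :: "'a::euclidean_space measure"
  assumes fin: "finite_measure \<mu>" and s [simp, measurable_cong]: "sets \<mu> = sets borel"
    and w [measurable]: "w \<in> borel_measurable borel" and w1: "\<And>y. \<bar>w y\<bar> \<le> 1"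
  shows "wft \<mu> (\<lambda>y. w y * G (y \<bullet> e - c)) \<xi> = (\<integral>\<tau>. cis (- (\<tau> * c)) * wft \<mu> w (\<xi> - (\<tau> / (2 * pi)) *\<^sub>R e) \<partial>M)"
proof -
  interpret \<mu>: finite_measure \<mu> by fact
  interpret P: pair_sigma_finite M \<mu> ..
  let ?f = "\<lambda>\<tau> y. of_real (w y) * cis (- 2 * pi * (y \<bullet> \<xi>)) * cis ((y \<bullet> e - c) * \<tau>)"
  have "wft \<mu> (\<lambda>y. w y * G (y \<bullet> e - c)) \<xi> = (\<integral>y. (\<integral>\<tau>. ?f \<tau> y \<partial>M) \<partial>\<mu>)"
    unfolding wft_def by (simp add: G_char) (simp add: mult_ac)
  also have "\<dots> = (\<integral>\<tau>. (\<integral>y. ?f \<tau> y \<partial>\<mu>) \<partial>M)"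
    using w1 by (intro P.Fubini_dominated[where g="\<lambda>_. 1" and h="\<lambda>_. 1"]) (auto simp: norm_mult)
  also have "\<dots> = (\<integral>\<tau>. cis (- (\<tau> * c)) * wft \<mu> w (\<xi> - (\<tau> / (2 * pi)) *\<^sub>R e) \<partial>M)"
  proof (rule Bochner_Integration.integral_cong[OF refl])
    fix \<tau>
    have "cis (- 2 * pi * (y \<bullet> \<xi>)) * cis ((y \<bullet> e - c) * \<tau>)
        = cis (- (\<tau> * c)) * cis (- 2 * pi * (y \<bullet> (\<xi> - (\<tau> / (2 * pi)) *\<^sub>R e)))" for y
      unfolding cis_mult by (rule arg_cong[where f=cis]) (simp add: inner_diff_right field_simps)
    then have "?f \<tau> y = cis (- (\<tau> * c)) * (of_real (w y) * cis (- 2 * pi * (y \<bullet> (\<xi> - (\<tau> / (2 * pi)) *\<^sub>R e))))" for y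
      by (metis mult.assoc mult.left_commute)
    then show "(\<integral>y. ?f \<tau> y \<partial>\<mu>) = cis (- (\<tau> * c)) * wft \<mu> w (\<xi> - (\<tau> / (2 * pi)) *\<^sub>R e)"
      unfolding wft_def by (simp only: integral_mult_right_zero)
  qed
  finally show ?thesis .
qed

text \<open>The shifts stay on lines in direction \<open>e\<close>, so a uniform bound on a set
  \<open>T\<close> invariant along such lines passes through the average with the same constant,
  whatever the length of \<open>e\<close>.\<close>

lemma wft_mult_window_bound:
  fixes \<mu> :: "'a::euclidean_space measure"
  assumes "finite_measure \<mu>" "sets \<mu> = sets borel" "w \<in> borel_measurable borel" "\<And>y. \<bar>w y\<bar> \<le> 1"
    and T: "\<And>\<xi> t. \<xi> \<in> T \<Longrightarrow> \<xi> + t *\<^sub>R e \<in> T" and A: "\<And>\<xi>. \<xi> \<in> T \<Longrightarrow> cmod (wft \<mu> w \<xi>) \<le> A" and "\<xi> \<in> T"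
  shows "cmod (wft \<mu> (\<lambda>y. w y * G (y \<bullet> e - c)) \<xi>) \<le> A"
proof -
  have "cmod (wft \<mu> w (\<xi> - t *\<^sub>R e)) \<le> A" for t
    using A[OF T[OF \<open>\<xi> \<in> T\<close>, of "- t"]] by simp
  then have "cmod (wft \<mu> (\<lambda>y. w y * G (y \<bullet> e - c)) \<xi>) \<le> (\<integral>\<tau>. A \<partial>M)"
    unfolding wft_mult_window[OF assms(1-4)] by (intro norm_integral_le) (auto simp: norm_mult)
  then show ?thesis using M_total by simp
qed

lemma wft_prod_window_bound:
  fixes \<mu> :: "'a::euclidean_space measure"
  assumes "finite_measure \<mu>" "sets \<mu> = sets borel" "w \<in> borel_measurable borel" "\<And>y. \<bar>w y\<bar> \<le> 1"
    and "finite I"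
    and T: "\<And>\<xi> t i. \<xi> \<in> T \<Longrightarrow> i \<in> I \<Longrightarrow> \<xi> + t *\<^sub>R e i \<in> T"
    and A: "\<And>\<xi>. \<xi> \<in> T \<Longrightarrow> cmod (wft \<mu> w \<xi>) \<le> A" and "\<xi> \<in> T"
  shows "cmod (wft \<mu> (\<lambda>y. w y * (\<Prod>i\<in>I. G (y \<bullet> e i - c i))) \<xi>) \<le> A"
  using \<open>finite I\<close> T \<open>\<xi> \<in> T\<close>
proof (induction I arbitrary: \<xi>)
  case empty then show ?case using A by simp
next
  case (insert i I)
  have "cmod (wft \<mu> (\<lambda>y. w y * (\<Prod>i\<in>I. G (y \<bullet> e i - c i)) * G (y \<bullet> e i - c i)) \<xi>) \<le> A"
  proof (rule wft_mult_window_bound[OF assms(1,2), where T=T])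
    show "(\<lambda>y. w y * (\<Prod>i\<in>I. G (y \<bullet> e i - c i))) \<in> borel_measurable borel"
      using assms(3) by measurable
    have "\<bar>\<Prod>i\<in>I. G (y \<bullet> e i - c i)\<bar> \<le> 1" for y
      unfolding abs_prod by (intro prod_le_1) (auto simp: abs_G_le_1)
    then show "\<bar>w y * (\<Prod>i\<in>I. G (y \<bullet> e i - c i))\<bar> \<le> 1" for y
      using assms(4)[of y] by (simp add: abs_mult mult_le_one)
  qed (use insert in auto)
  then show ?case using insert(1,2) by (simp add: mult_ac)
qed

lemma moment_powr:
  assumes "0 \<le> q" "q \<le> real p"
  shows "integrable M (\<lambda>x. \<bar>x\<bar> powr q)"
proof (rule Bochner_Integration.integrable_bound)
  show "integrable M (\<lambda>x. 1 + \<bar>x\<bar> ^ p)" using M_moment by simp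
  have "\<bar>x\<bar> powr q \<le> 1 + \<bar>x\<bar> ^ p" for x :: real
  proof (cases "\<bar>x\<bar> \<le> 1")
    case True
    then have "\<bar>x\<bar> powr q \<le> 1" using assms powr_le1[of q "\<bar>x\<bar>"] by (cases "x = 0") auto
    then show ?thesis by (smt (verit) zero_le_power abs_ge_zero)
  next
    case False
    then have "\<bar>x\<bar> powr q \<le> \<bar>x\<bar> powr real p" using assms by (intro powr_mono) auto
    then show ?thesis using False by (simp add: powr_realpow)
  qed
  then show "AE x in M. norm (\<bar>x\<bar> powr q) \<le> norm (1 + \<bar>x\<bar> ^ p)" by (intro AE_I2) auto
qed simp

text \<open>The weight at the original frequency is split between the shifted frequency and the
  shift. The first part is controlled by the decay of the old transform, the second by its trivial
  bound and the moment of \<open>M\<close>.\<close>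

lemma wft_mult_window_decay:
  fixes \<mu> :: "'a::euclidean_space measure"
  assumes fin: "finite_measure \<mu>" and s: "sets \<mu> = sets borel"
    and w: "w \<in> borel_measurable borel" "\<And>y. \<bar>w y\<bar> \<le> 1"
    and q: "0 \<le> q" "q \<le> real p"
    and B: "\<And>\<xi>. norm \<xi> powr q * cmod (wft \<mu> w \<xi>) \<le> B"
  shows "\<exists>B'. \<forall>\<xi>. norm \<xi> powr q * cmod (wft \<mu> (\<lambda>y. w y * G (y \<bullet> e - c)) \<xi>) \<le> B'"
proof (intro exI allI)
  fix \<xi>
  let ?m = "measure \<mu> (space \<mu>)"
  let ?g = "\<lambda>\<tau>. 2 powr q * B + 2 powr q * norm e powr q * ?m * \<bar>\<tau>\<bar> powr q"
  have "norm (\<integral>\<tau>. norm \<xi> powr q *\<^sub>R (cis (- (\<tau> * c)) * wft \<mu> w (\<xi> - (\<tau> / (2 * pi)) *\<^sub>R e)) \<partial>M) \<le> (\<integral>\<tau>. ?g \<tau> \<partial>M)"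
  proof (rule norm_integral_le)
    show "integrable M ?g" using moment_powr[OF q] by simp
    fix \<tau>
    let ?\<eta> = "(\<tau> / (2 * pi)) *\<^sub>R e"
    have "norm \<xi> powr q \<le> (norm (\<xi> - ?\<eta>) + norm ?\<eta>) powr q"
      using q norm_triangle_ineq[of "\<xi> - ?\<eta>" ?\<eta>] by (intro powr_mono2) auto
    also have "\<dots> \<le> 2 powr q * (norm (\<xi> - ?\<eta>) powr q + norm ?\<eta> powr q)"
      using q by (intro powr_add_le) auto
    finally have 1: "norm \<xi> powr q \<le> 2 powr q * (norm (\<xi> - ?\<eta>) powr q + norm ?\<eta> powr q)" .
    have "\<bar>\<tau>\<bar> * norm e / (2 * pi) \<le> \<bar>\<tau>\<bar> * norm e / 1"
      using pi_gt3 by (intro divide_left_mono) auto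
    then have "norm ?\<eta> \<le> \<bar>\<tau>\<bar> * norm e" by simp
    then have 2: "norm ?\<eta> powr q \<le> \<bar>\<tau>\<bar> powr q * norm e powr q"
      using q by (subst powr_mult[symmetric]) (auto intro!: powr_mono2)
    have "norm (norm \<xi> powr q *\<^sub>R (cis (- (\<tau> * c)) * wft \<mu> w (\<xi> - ?\<eta>))) = norm \<xi> powr q * cmod (wft \<mu> w (\<xi> - ?\<eta>))"
      by (simp add: norm_mult)
    also have "\<dots> \<le> 2 powr q * (norm (\<xi> - ?\<eta>) powr q + \<bar>\<tau>\<bar> powr q * norm e powr q) * cmod (wft \<mu> w (\<xi> - ?\<eta>))"
      using 1 2 by (intro mult_right_mono) (auto intro: order_trans mult_left_mono)
    also have "\<dots> = 2 powr q * (norm (\<xi> - ?\<eta>) powr q * cmod (wft \<mu> w (\<xi> - ?\<eta>))) + 2 powr q * norm e powr q * cmod (wft \<mu> w (\<xi> - ?\<eta>)) * \<bar>\<tau>\<bar> powr q"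
      by (simp add: algebra_simps)
    also have "\<dots> \<le> ?g \<tau>"
      using B norm_wft_le[OF fin w(2)] by (intro add_mono mult_left_mono mult_right_mono) auto
    finally show "norm (norm \<xi> powr q *\<^sub>R (cis (- (\<tau> * c)) * wft \<mu> w (\<xi> - ?\<eta>))) \<le> ?g \<tau>" .
  qed
  then show "norm \<xi> powr q * cmod (wft \<mu> (\<lambda>y. w y * G (y \<bullet> e - c)) \<xi>) \<le> (\<integral>\<tau>. ?g \<tau> \<partial>M)"
    unfolding wft_mult_window[OF fin s w] by simp
qed

lemma wft_prod_window_decay:
  fixes \<mu> :: "'a::euclidean_space measure"
  assumes fin: "finite_measure \<mu>" and s: "sets \<mu> = sets borel"
    and q: "0 \<le> q" "q \<le> real p"
    and B: "\<And>\<xi>. norm \<xi> powr q * cmod (fourier_transform \<mu> \<xi>) \<le> B"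
    and I: "finite I"
  shows "\<exists>B'. \<forall>\<xi>. norm \<xi> powr q * cmod (wft \<mu> (\<lambda>y. \<Prod>i\<in>I. G (y \<bullet> e i - c i)) \<xi>) \<le> B'"
  using I
proof (induction I)
  case empty
  have "wft \<mu> (\<lambda>y. 1) \<xi> = fourier_transform \<mu> \<xi>" for \<xi> by (simp add: wft_def fourier_transform_def)
  then show ?case using B by auto
next
  case (insert i I)
  then obtain B' where "\<And>\<xi>. norm \<xi> powr q * cmod (wft \<mu> (\<lambda>y. \<Prod>i\<in>I. G (y \<bullet> e i - c i)) \<xi>) \<le> B'" by auto
  moreover have "\<bar>\<Prod>i\<in>I. G (y \<bullet> e i - c i)\<bar> \<le> 1" for y
    unfolding abs_prod by (intro prod_le_1) (auto simp: abs_G_le_1)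
  ultimately have "\<exists>B'. \<forall>\<xi>. norm \<xi> powr q * cmod (wft \<mu> (\<lambda>y. (\<Prod>i\<in>I. G (y \<bullet> e i - c i)) * G (y \<bullet> e i - c i)) \<xi>) \<le> B'"
    by (intro wft_mult_window_decay fin s q) auto
  then show ?case using insert(1,2) by (simp add: mult.commute)
qed

end

text \<open>The complement of the support is a union of null open sets, and by the Lindelof property
  countably many of them suffice.\<close>

lemma msupport_complement_null:
  fixes \<mu> :: "'a::second_countable_topology measure"
  assumes s: "sets \<mu> = sets borel"
  shows "emeasure \<mu> (- msupport \<mu>) = 0" "closed (msupport \<mu>)"
proof -
  define F where "F = {U. open U \<and> emeasure \<mu> U = 0}"
  have F: "- msupport \<mu> = \<Union>F"
    by (auto simp: F_def msupport_def) 
  obtain F' where F': "F' \<subseteq> F" "countable F'" "\<Union>F' = \<Union>F"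
    using Lindelof[of F] by (auto simp: F_def)
  have "(\<Union>U\<in>F'. U) \<in> null_sets \<mu>"
    using F'(1,2) s by (intro null_sets_UN') (auto simp: F_def null_sets_def)
  then have "emeasure \<mu> (\<Union>F') = 0" by auto
  then show "emeasure \<mu> (- msupport \<mu>) = 0" using F F' by simp
  have "open (\<Union>F)" by (auto simp: F_def)
  then show "closed (msupport \<mu>)" unfolding closed_def F .
qed

section \<open>Geometry of charts\<close>

lemma has_derivative_partial:
  fixes F :: "real^'m::finite \<Rightarrow> 'b::real_normed_vector"
  assumes "F differentiable (at u)"
  shows "(F has_derivative (\<lambda>v. \<Sum>i\<in>UNIV. v $ i *\<^sub>R partial i F u)) (at u)"
proof -
  have d: "(F has_derivative frechet_derivative F (at u)) (at u)"
    using assms by (simp add: frechet_derivative_works)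
  then have lin: "linear (frechet_derivative F (at u))"
    by (rule has_derivative_linear)
  have "frechet_derivative F (at u) v = (\<Sum>i\<in>UNIV. v $ i *\<^sub>R partial i F u)" for v
  proof -
    have "v = (\<Sum>i\<in>UNIV. v $ i *\<^sub>R axis i 1)"
      using basis_expansion[of v] by (simp add: scalar_mult_eq_scaleR)
    then have "frechet_derivative F (at u) v = frechet_derivative F (at u) (\<Sum>i\<in>UNIV. v $ i *\<^sub>R axis i 1)" by simp
    also have "\<dots> = (\<Sum>i\<in>UNIV. v $ i *\<^sub>R partial i F u)"
      by (simp add: linear_sum[OF lin] linear_cmul[OF lin] partial_def)
    finally show ?thesis .
  qed
  then have "frechet_derivative F (at u) = (\<lambda>v. \<Sum>i\<in>UNIV. v $ i *\<^sub>R partial i F u)" by blast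
  with d show ?thesis by simp
qed

lemma smooth_on_differentiable:
  assumes "smooth_on V f" "open V" "u \<in> V"
  shows "foldr partial is f differentiable (at u)"
  using assms unfolding smooth_on_def differentiable_on_def by (metis at_within_open)

lemma smooth_on_continuous:
  assumes "smooth_on V f"
  shows "continuous_on V (foldr partial is f)"
  using assms unfolding smooth_on_def by (blast intro: differentiable_imp_continuous_on)

text \<open>The mean value inequality for F minus the linear map with columns \<open>a i\<close>.
  With \<open>a = 0\<close> it gives a Lipschitz bound, with \<open>a\<close> the partial
  derivatives at a base point it gives the remainder of a linearisation.\<close>

lemma partials_close_bound:
  fixes F :: "real^'m::finite \<Rightarrow> 'b::real_normed_vector" and \<epsilon> :: real
  assumes C: "convex C" and diff: "\<And>x. x \<in> C \<Longrightarrow> F differentiable (at x)"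
    and close: "\<And>x i. x \<in> C \<Longrightarrow> norm (partial i F x - a i) \<le> \<epsilon>"
    and u: "u \<in> C" and w: "w \<in> C"
  shows "norm (F u - F w - (\<Sum>i\<in>UNIV. (u - w) $ i *\<^sub>R a i)) \<le> CARD('m) * \<epsilon> * norm (u - w)"
proof -
  define g where "g x = F x - (\<Sum>i\<in>UNIV. x $ i *\<^sub>R a i)" for x
  have gd: "(g has_derivative (\<lambda>v. (\<Sum>i\<in>UNIV. v $ i *\<^sub>R (partial i F x - a i)))) (at x within C)" if "x \<in> C" for x
  proof -
    have "(g has_derivative (\<lambda>v. (\<Sum>i\<in>UNIV. v $ i *\<^sub>R partial i F x) - (\<Sum>i\<in>UNIV. v $ i *\<^sub>R a i))) (at x within C)"
      unfolding g_def
      by (intro has_derivative_diff has_derivative_at_withinI[OF has_derivative_partial] diff that)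
        (intro bounded_linear_imp_has_derivative bounded_linear_sum bounded_linear_scaleR_const bounded_linear_vec_nth)
    then show ?thesis by (simp add: scaleR_diff_right sum_subtractf)
  qed
  have on: "onorm (\<lambda>v. (\<Sum>i\<in>UNIV. v $ i *\<^sub>R (partial i F x - a i))) \<le> CARD('m) * \<epsilon>" if "x \<in> C" for x
  proof (rule onorm_bound)
    have "0 \<le> \<epsilon>" using close[OF that] norm_ge_zero order_trans by blast
    then show "0 \<le> CARD('m) * \<epsilon>" by simp
    fix v :: "real^'m"
    have "norm (\<Sum>i\<in>UNIV. v $ i *\<^sub>R (partial i F x - a i)) \<le> (\<Sum>i\<in>(UNIV::'m set). norm v * \<epsilon>)"
      using close[OF that] by (intro sum_norm_le) (auto simp: component_le_norm_cart intro!: mult_mono)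
    then show "norm (\<Sum>i\<in>UNIV. v $ i *\<^sub>R (partial i F x - a i)) \<le> CARD('m) * \<epsilon> * norm v"
      by (simp add: mult_ac)
  qed
  have "norm (g u - g w) \<le> CARD('m) * \<epsilon> * norm (u - w)"
    by (rule differentiable_bound[OF C gd on u w])
  also have "g u - g w = F u - F w - (\<Sum>i\<in>UNIV. (u - w) $ i *\<^sub>R a i)"
    by (simp add: g_def scaleR_diff_left sum_subtractf)
  finally show ?thesis .
qed

text \<open>The squared length of the image of v is the sum of v_i times its pairing with
  \<open>a i\<close>. If all pairings were small, this would contradict the lower bound for an
  injective linear map.\<close>

lemma linear_inj_gram_bound:
  fixes a :: "'m::finite \<Rightarrow> 'b::euclidean_space"
  assumes inj: "inj (\<lambda>v::real^'m. \<Sum>i\<in>UNIV. v $ i *\<^sub>R a i)"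
  obtains c where "c > 0" "\<And>v::real^'m. \<exists>i. c * norm v \<le> \<bar>(\<Sum>j\<in>UNIV. v $ j *\<^sub>R a j) \<bullet> a i\<bar>"
proof -
  let ?L = "\<lambda>v::real^'m. \<Sum>i\<in>UNIV. v $ i *\<^sub>R a i"
  have lin: "linear ?L"
    by (auto simp: linear_iff scaleR_add_left sum.distrib scaleR_sum_right)
  obtain B where B: "B > 0" "\<And>v. B * norm v \<le> norm (?L v)"
    using linear_inj_bounded_below_pos[OF lin inj] by (auto simp: mult.commute)
  show thesis
  proof (rule that[of "B\<^sup>2 / CARD('m)"])
    show "B\<^sup>2 / CARD('m) > 0" using B(1) by simp
    fix v :: "real^'m"
    show "\<exists>i. B\<^sup>2 / CARD('m) * norm v \<le> \<bar>?L v \<bullet> a i\<bar>"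
    proof (rule ccontr)
      assume "\<nexists>i. B\<^sup>2 / CARD('m) * norm v \<le> \<bar>?L v \<bullet> a i\<bar>"
      then have lt: "\<bar>?L v \<bullet> a i\<bar> < B\<^sup>2 / CARD('m) * norm v" for i by (meson not_le)
      then have v: "0 < norm v" using lt[of undefined] B(1)
        by (metis abs_ge_zero less_le_trans mult_zero_right norm_ge_zero order_le_less not_less)
      have "(B * norm v)\<^sup>2 \<le> (norm (?L v))\<^sup>2" using B by (intro power_mono) auto
      also have "\<dots> = ?L v \<bullet> ?L v" by (rule power2_norm_eq_inner)
      also have "\<dots> = (\<Sum>i\<in>UNIV. v $ i * (?L v \<bullet> a i))"
        by (simp only: inner_sum_right inner_scaleR_right)
      also have "\<dots> \<le> (\<Sum>i\<in>(UNIV::'m set). norm v * \<bar>?L v \<bullet> a i\<bar>)"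
      proof (intro sum_mono)
        fix i
        have "v $ i * (?L v \<bullet> a i) \<le> \<bar>v $ i\<bar> * \<bar>?L v \<bullet> a i\<bar>" by (metis abs_ge_self abs_mult)
        also have "\<dots> \<le> norm v * \<bar>?L v \<bullet> a i\<bar>" by (intro mult_right_mono component_le_norm_cart) auto
        finally show "v $ i * (?L v \<bullet> a i) \<le> norm v * \<bar>?L v \<bullet> a i\<bar>" .
      qed
      also have "\<dots> < (\<Sum>i\<in>(UNIV::'m set). norm v * (B\<^sup>2 / CARD('m) * norm v))"
        using v lt by (intro sum_strict_mono mult_strict_left_mono) auto
      also have "\<dots> = (B * norm v)\<^sup>2" by (simp add: power_mult_distrib power2_eq_square)
      finally show False by simp
    qed
  qed
qed

text \<open>Two families of tangent vectors serve different purposes. Those at \<open>w\<close> are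
  orthogonal to the normal at \<open>w\<close>, as the windows of a cap centred there require; those
  at \<open>u0\<close> are fixed and give a single coordinate system for sorting all points into
  caps.\<close>

lemma chart_geometry:
  fixes \<phi> :: "real^'m::finite \<Rightarrow> 'b::euclidean_space"
  assumes sm: "smooth_on V \<phi>" and V: "open V" "u0 \<in> V" and inj: "inj (frechet_derivative \<phi> (at u0))"
  obtains \<rho> c K where "0 < \<rho>" "0 < c" "0 < K" "ball u0 \<rho> \<subseteq> V"
    "\<And>u w. u \<in> ball u0 \<rho> \<Longrightarrow> w \<in> ball u0 \<rho> \<Longrightarrow> \<exists>i. c * norm (u - w) \<le> \<bar>(\<phi> u - \<phi> w) \<bullet> partial i \<phi> w\<bar>"
    "\<And>u w. u \<in> ball u0 \<rho> \<Longrightarrow> w \<in> ball u0 \<rho> \<Longrightarrow> \<exists>i. c * norm (u - w) \<le> \<bar>(\<phi> u - \<phi> w) \<bullet> partial i \<phi> u0\<bar>"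
    "\<And>u w. u \<in> ball u0 \<rho> \<Longrightarrow> w \<in> ball u0 \<rho> \<Longrightarrow> norm (\<phi> u - \<phi> w) \<le> K * norm (u - w)"
    "\<And>u w. u \<in> ball u0 \<rho> \<Longrightarrow> w \<in> ball u0 \<rho> \<Longrightarrow>
        norm (\<phi> u - \<phi> w - (\<Sum>i\<in>UNIV. (u - w) $ i *\<^sub>R partial i \<phi> w)) \<le> K * (norm (u - w))\<^sup>2"
    "\<And>u i. u \<in> ball u0 \<rho> \<Longrightarrow> norm (partial i \<phi> u) \<le> K"
    "\<And>u. u \<in> ball u0 \<rho> \<Longrightarrow> norm (\<phi> u) \<le> K"
proof -
  have d: "\<phi> differentiable (at u)" if "u \<in> V" for u
    using smooth_on_differentiable[OF sm V(1) that, of "[]"] by simp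
  have d1: "partial i \<phi> differentiable (at u)" if "u \<in> V" for u i
    using smooth_on_differentiable[OF sm V(1) that, of "[i]"] by simp
  have c1: "continuous_on V (partial i \<phi>)" for i using smooth_on_continuous[OF sm, of "[i]"] by simp
  have c2: "continuous_on V (partial i (partial j \<phi>))" for i j using smooth_on_continuous[OF sm, of "[i,j]"] by simp
  have c0: "continuous_on V \<phi>" using smooth_on_continuous[OF sm, of "[]"] by simp
  let ?m = "real CARD('m)"
  obtain \<rho>1 where \<rho>1: "\<rho>1 > 0" "cball u0 \<rho>1 \<subseteq> V" using V open_contains_cball by blast
  have bdd: "\<exists>K. \<forall>u\<in>cball u0 \<rho>1. norm (f u) \<le> K" if "continuous_on V f" for f :: "real^'m \<Rightarrow> 'b"
  proof -
    have "compact (f ` cball u0 \<rho>1)" by (intro compact_continuous_image continuous_on_subset[OF that \<rho>1(2)]) simp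
    then show ?thesis using compact_imp_bounded bounded_iff by (metis imageI)
  qed
  obtain K0 where K0: "\<And>u. u \<in> cball u0 \<rho>1 \<Longrightarrow> norm (\<phi> u) \<le> K0" using bdd[OF c0] by blast
  have "\<forall>i. \<exists>K. \<forall>u\<in>cball u0 \<rho>1. norm (partial i \<phi> u) \<le> K" using bdd[OF c1] by blast
  then obtain K1 where K1: "\<And>i u. u \<in> cball u0 \<rho>1 \<Longrightarrow> norm (partial i \<phi> u) \<le> K1 i" by metis
  have "\<forall>i j. \<exists>K. \<forall>u\<in>cball u0 \<rho>1. norm (partial i (partial j \<phi>) u) \<le> K" using bdd[OF c2] by blast
  then obtain K2 where K2: "\<And>i j u. u \<in> cball u0 \<rho>1 \<Longrightarrow> norm (partial i (partial j \<phi>) u) \<le> K2 i j" by metis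
  define k where "k = 1 + \<bar>K0\<bar> + (\<Sum>i\<in>UNIV. \<bar>K1 i\<bar>) + (\<Sum>i\<in>UNIV. \<Sum>j\<in>UNIV. \<bar>K2 i j\<bar>)"
  have s1: "\<bar>K1 i\<bar> \<le> (\<Sum>i\<in>UNIV. \<bar>K1 i\<bar>)" for i by (rule member_le_sum) auto
  have s2: "\<bar>K2 i j\<bar> \<le> (\<Sum>i\<in>UNIV. \<Sum>j\<in>UNIV. \<bar>K2 i j\<bar>)" for i j
  proof -
    have "\<bar>K2 i j\<bar> \<le> (\<Sum>j\<in>UNIV. \<bar>K2 i j\<bar>)" by (rule member_le_sum) auto
    also have "\<dots> \<le> (\<Sum>i\<in>UNIV. \<Sum>j\<in>UNIV. \<bar>K2 i j\<bar>)"
      by (rule member_le_sum[where f="\<lambda>i. \<Sum>j\<in>UNIV. \<bar>K2 i j\<bar>"]) (auto intro: sum_nonneg)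
    finally show ?thesis .
  qed
  have nn: "0 \<le> (\<Sum>i\<in>UNIV. \<bar>K1 i\<bar>)" "0 \<le> (\<Sum>i\<in>UNIV. \<Sum>j\<in>UNIV. \<bar>K2 i j\<bar>)" by (auto intro!: sum_nonneg)
  have k1: "1 \<le> k" unfolding k_def using nn by linarith
  have kb: "norm (\<phi> u) \<le> k" "norm (partial i \<phi> u) \<le> k" "norm (partial i (partial j \<phi>) u) \<le> k"
    if "u \<in> cball u0 \<rho>1" for u i j
    unfolding k_def using K0[OF that] K1[OF that, of i] K2[OF that, of i j] s1[of i] s2[of i j] nn by linarith+
  have lip1: "norm (partial j \<phi> u - partial j \<phi> w) \<le> ?m * k * norm (u - w)"
    if "u \<in> cball u0 \<rho>1" "w \<in> cball u0 \<rho>1" for u w j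
    using partials_close_bound[of "cball u0 \<rho>1" "partial j \<phi>" "\<lambda>_. 0" k u w] that kb(3) d1[OF subsetD[OF \<rho>1(2)]] by simp
  have lip0: "norm (\<phi> u - \<phi> w) \<le> ?m * k * norm (u - w)"
    if "u \<in> cball u0 \<rho>1" "w \<in> cball u0 \<rho>1" for u w
    using partials_close_bound[of "cball u0 \<rho>1" \<phi> "\<lambda>_. 0" k u w] that kb(2) d[OF subsetD[OF \<rho>1(2)]] by simp
  \<comment> \<open>Working on the segment from w to u rather than on the ball bounds the variation
    of the partial derivatives by a multiple of |u - w|, which makes the error quadratic.\<close>
  have tay: "norm (\<phi> u - \<phi> w - (\<Sum>i\<in>UNIV. (u - w) $ i *\<^sub>R partial i \<phi> w)) \<le> ?m * (?m * k * norm (u - w)) * norm (u - w)"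
    if uw: "u \<in> cball u0 \<rho>1" "w \<in> cball u0 \<rho>1" for u w
  proof (rule partials_close_bound[where C="closed_segment w u"])
    have sub: "closed_segment w u \<subseteq> cball u0 \<rho>1" using uw by (intro closed_segment_subset) auto
    show "\<phi> differentiable (at x)" if "x \<in> closed_segment w u" for x using that sub \<rho>1(2) d by blast
    show "norm (partial i \<phi> x - partial i \<phi> w) \<le> ?m * k * norm (u - w)" if "x \<in> closed_segment w u" for x i
    proof -
      have "norm (x - w) \<le> norm (u - w)" using that segment_bound(1) by blast
      then have "?m * k * norm (x - w) \<le> ?m * k * norm (u - w)" using k1 by (intro mult_left_mono) auto
      then show ?thesis using lip1[OF subsetD[OF sub that] uw(2), of i] by linarith
    qed
  qed auto
  have "frechet_derivative \<phi> (at u0) = (\<lambda>v. \<Sum>i\<in>UNIV. v $ i *\<^sub>R partial i \<phi> u0)"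
    by (rule frechet_derivative_at[OF has_derivative_partial[OF d[OF V(2)]], symmetric])
  then have inj': "inj (\<lambda>v::real^'m. \<Sum>i\<in>UNIV. v $ i *\<^sub>R partial i \<phi> u0)" using inj by simp
  obtain c where c: "c > 0" "\<And>v::real^'m. \<exists>i. c * norm v \<le> \<bar>(\<Sum>j\<in>UNIV. v $ j *\<^sub>R partial j \<phi> u0) \<bullet> partial i \<phi> u0\<bar>"
    using linear_inj_gram_bound[OF inj'] by blast
  \<comment> \<open>Collects the two errors in \<open>low\<close>: replacing the increment of
    \<open>\<phi>\<close> by its linearisation at \<open>u0\<close>, and replacing the tangent
    vector at \<open>x\<close> by the one at \<open>u0\<close>. The radius is then chosen so that
    they consume at most half of \<open>c\<close>.\<close>
  define Q where "Q = ?m * (?m * k) * k + ?m * k * (?m * k)"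
  have m1: "1 \<le> ?m" using zero_less_card_finite[where 'a='m] by linarith
  have mk: "1 \<le> ?m * k" using mult_mono[OF m1 k1] by simp
  have Q: "0 < Q" unfolding Q_def using mk k1 by (simp add: add_pos_pos)
  define \<rho> where "\<rho> = min \<rho>1 (c / (2 * Q))"
  have \<rho>: "0 < \<rho>" "\<rho> \<le> \<rho>1" "Q * \<rho> \<le> c / 2" using \<rho>1 c Q by (auto simp: \<rho>_def min_def field_simps)
  have sub: "ball u0 \<rho> \<subseteq> cball u0 \<rho>1" using \<rho> by auto
  have low: "\<exists>i. c / 2 * norm (u - w) \<le> \<bar>(\<phi> u - \<phi> w) \<bullet> partial i \<phi> x\<bar>"
    if uw: "u \<in> ball u0 \<rho>" "w \<in> ball u0 \<rho>" and x: "x \<in> ball u0 \<rho>" for u w x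
  proof -
    define v where "v = u - w"
    let ?L = "\<Sum>j\<in>UNIV. v $ j *\<^sub>R partial j \<phi> u0"
    obtain i where i: "c * norm v \<le> \<bar>?L \<bullet> partial i \<phi> u0\<bar>" using c(2) by blast
    have near: "norm (partial j \<phi> y - partial j \<phi> u0) \<le> ?m * k * \<rho>" if "y \<in> ball u0 \<rho>" for y j
    proof -
      have "norm (partial j \<phi> y - partial j \<phi> u0) \<le> ?m * k * norm (y - u0)"
        using lip1[OF subsetD[OF sub that], of u0 j] \<rho>1(1) by simp
      also have "\<dots> \<le> ?m * k * \<rho>" using that k1 by (intro mult_left_mono) (auto simp: dist_norm norm_minus_commute)
      finally show ?thesis .
    qed
    have 1: "norm (\<phi> u - \<phi> w - ?L) \<le> ?m * (?m * k * \<rho>) * norm v"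
      unfolding v_def
      by (rule partials_close_bound[where C="ball u0 \<rho>"]) (use near uw d[OF subsetD[OF \<rho>1(2) subsetD[OF sub]]] in simp_all)
    have nL: "norm ?L \<le> ?m * k * norm v"
    proof -
      have "norm ?L \<le> (\<Sum>j\<in>(UNIV::'m set). norm v * k)"
        using kb(2)[of u0] \<rho>1 by (intro sum_norm_le) (auto simp: component_le_norm_cart intro!: mult_mono)
      then show ?thesis by (simp add: mult_ac)
    qed
    have "\<bar>(\<phi> u - \<phi> w) \<bullet> partial i \<phi> x - ?L \<bullet> partial i \<phi> u0\<bar>
        = \<bar>(\<phi> u - \<phi> w - ?L) \<bullet> partial i \<phi> x + ?L \<bullet> (partial i \<phi> x - partial i \<phi> u0)\<bar>"
      by (simp add: inner_diff_left inner_diff_right)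
    also have "\<dots> \<le> norm (\<phi> u - \<phi> w - ?L) * norm (partial i \<phi> x) + norm ?L * norm (partial i \<phi> x - partial i \<phi> u0)"
      by (intro order_trans[OF abs_triangle_ineq] add_mono Cauchy_Schwarz_ineq2)
    also have "\<dots> \<le> (?m * (?m * k * \<rho>) * norm v) * k + (?m * k * norm v) * (?m * k * \<rho>)"
      using 1 nL near[OF x] kb(2)[of x] x sub k1 \<rho>(1) by (intro add_mono mult_mono) auto
    also have "\<dots> = Q * \<rho> * norm v" by (simp add: Q_def algebra_simps)
    also have "\<dots> \<le> c / 2 * norm v" using \<rho>(3) by (intro mult_right_mono) auto
    finally have "c / 2 * norm v \<le> \<bar>(\<phi> u - \<phi> w) \<bullet> partial i \<phi> x\<bar>"
      using i abs_triangle_ineq2_sym[of "?L \<bullet> partial i \<phi> u0" "(\<phi> u - \<phi> w) \<bullet> partial i \<phi> x"] by argo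
    then show ?thesis unfolding v_def by blast
  qed
  define KK where "KK = k + ?m * k + ?m * (?m * k)"
  have KK: "k \<le> KK" "?m * k \<le> KK" "?m * (?m * k) \<le> KK" "0 < KK"
    unfolding KK_def using k1 mk by (auto simp: add_nonneg_nonneg add_pos_nonneg)
  show thesis
  proof (rule that[of \<rho> "c / 2" KK])
    show "norm (\<phi> u - \<phi> w) \<le> KK * norm (u - w)" if "u \<in> ball u0 \<rho>" "w \<in> ball u0 \<rho>" for u w
      using lip0[of u w] that sub KK(2) by (meson mult_right_mono norm_ge_zero order_trans subsetD)
    show "norm (\<phi> u - \<phi> w - (\<Sum>i\<in>UNIV. (u - w) $ i *\<^sub>R partial i \<phi> w)) \<le> KK * (norm (u - w))\<^sup>2"
      if "u \<in> ball u0 \<rho>" "w \<in> ball u0 \<rho>" for u w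
    proof -
      have "norm (\<phi> u - \<phi> w - (\<Sum>i\<in>UNIV. (u - w) $ i *\<^sub>R partial i \<phi> w)) \<le> ?m * (?m * k) * (norm (u - w))\<^sup>2"
        using tay[OF subsetD[OF sub that(1)] subsetD[OF sub that(2)]] by (simp add: power2_eq_square mult_ac)
      also have "\<dots> \<le> KK * (norm (u - w))\<^sup>2" using KK by (intro mult_right_mono) auto
      finally show ?thesis .
    qed
    show "norm (partial i \<phi> u) \<le> KK" if "u \<in> ball u0 \<rho>" for u i
      using kb(2)[of u i] that sub KK(1) by (meson order_trans subsetD)
    show "norm (\<phi> u) \<le> KK" if "u \<in> ball u0 \<rho>" for u
      using kb(1)[of u] that sub KK(1) by (meson order_trans subsetD)
    show "\<exists>i. c / 2 * norm (u - w) \<le> \<bar>(\<phi> u - \<phi> w) \<bullet> partial i \<phi> u0\<bar>" if "u \<in> ball u0 \<rho>" "w \<in> ball u0 \<rho>" for u w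
      using low[OF that, of u0] \<rho> by simp
    show "\<exists>i. c / 2 * norm (u - w) \<le> \<bar>(\<phi> u - \<phi> w) \<bullet> partial i \<phi> w\<bar>" if "u \<in> ball u0 \<rho>" "w \<in> ball u0 \<rho>" for u w
      using low[OF that that(2)] .
  qed (use \<rho>(1) c(1) KK(4) order_trans[OF sub \<rho>1(2)] in simp_all)
qed

lemma normal_exists:
  fixes a :: "'m::finite \<Rightarrow> real^'n::finite"
  assumes "CARD('m) < CARD('n)"
  obtains N where "norm N = 1" "\<And>i. N \<bullet> a i = 0"
proof -
  have "dim (span (range a)) < DIM(real^'n)"
    using dim_le_card'[of "range a"] card_image_le[of "UNIV::'m set" a] assms by simp
  then obtain x where x: "x \<noteq> 0" "\<And>y. y \<in> span (range a) \<Longrightarrow> orthogonal x y"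
    using orthogonal_to_subspace_exists[of "range a"] by auto
  show thesis
  proof (rule that[of "x /\<^sub>R norm x"])
    show "norm (x /\<^sub>R norm x) = 1" using x by simp
    show "(x /\<^sub>R norm x) \<bullet> a i = 0" for i using x(2)[of "a i"] by (simp add: span_base orthogonal_def)
  qed
qed

section \<open>The upper bound\<close>

text \<open>The weight \<open>w0\<close> is multiplied by windows in the directions \<open>(a i, - \<phi> w \<bullet> a i)\<close>, which cut out the cap around \<open>w\<close>.
  Their frequencies are orthogonal to \<open>(N, 0)\<close>, so they never bring the frequency \<open>\<epsilon>X\<^sup>2(N, - \<phi> w \<bullet> N)\<close> closer
  to the origin than \<open>\<epsilon>X\<^sup>2\<close>.\<close>

lemma (in window) cap_bound:
  fixes \<mu> :: "((real^'n::finite) \<times> real) measure" and \<phi> :: "real^'m::finite \<Rightarrow> real^'n" and q :: real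
    and a :: "'m \<Rightarrow> real^'n"
  assumes fin: "finite_measure \<mu>" and s [simp, measurable_cong]: "sets \<mu> = sets borel"
    and w0 [measurable]: "w0 \<in> borel_measurable borel" and w01: "\<And>y. 0 \<le> w0 y" "\<And>y. w0 y \<le> 1"
    and q: "0 \<le> q" and B0: "\<And>\<xi>. norm \<xi> powr q * cmod (wft \<mu> w0 \<xi>) \<le> B0"
    and AEY: "AE y in \<mu>. w0 y \<noteq> 0 \<longrightarrow> y \<in> Y"
    and Y: "\<And>y. y \<in> Y \<Longrightarrow> \<exists>u\<in>D. fst y = snd y *\<^sub>R \<phi> u \<and> H1 \<le> \<bar>snd y\<bar> \<and> \<bar>snd y\<bar> \<le> H2"
    and pos: "0 < H1" "0 < H2" "0 < K" "0 < c" "0 < \<alpha>" "0 < \<epsilon>" "1 \<le> X" "0 \<le> Z"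
    and N: "norm N = 1" "\<And>i. N \<bullet> a i = 0"
    and a: "\<And>i. norm (a i) \<le> K"
    and low: "\<And>u. u \<in> D \<Longrightarrow> \<exists>i. c * norm (u - w) \<le> \<bar>(\<phi> u - \<phi> w) \<bullet> a i\<bar>"
    and up: "\<And>u. u \<in> D \<Longrightarrow> norm (\<phi> u - \<phi> w) \<le> K * norm (u - w)"
    and nrm: "\<And>u. u \<in> D \<Longrightarrow> \<bar>(\<phi> u - \<phi> w) \<bullet> N\<bar> \<le> K * (norm (u - w))\<^sup>2"
    and E [measurable]: "E \<in> sets borel"
    and EZ: "\<And>y u. y \<in> Y \<Longrightarrow> y \<in> E \<Longrightarrow> u \<in> D \<Longrightarrow> fst y = snd y *\<^sub>R \<phi> u \<Longrightarrow> norm (u - w) \<le> Z / X"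
    and \<alpha>: "\<alpha> * H2 * K\<^sup>2 * Z \<le> \<delta>"
    and \<epsilon>: "2 * \<epsilon> * H2 * K * (r / (\<alpha> * c * H1))\<^sup>2 \<le> 1 / 3"
  shows "(\<integral>y. w0 y * indicator E y \<partial>\<mu>) \<le> 2 ^ (CARD('m) + 1) * B0 * (\<epsilon> * X\<^sup>2) powr (- q)"
proof -
  interpret \<mu>: finite_measure \<mu> by fact
  have sp: "space \<mu> = UNIV" using sets_eq_imp_space_eq[OF s] by simp
  define e where "e i = (\<alpha> * X) *\<^sub>R (a i, - (\<phi> w \<bullet> a i))" for i
  define b where "b y = (\<Prod>i\<in>UNIV. G (y \<bullet> e i - 0))" for y
  define \<xi>0 where "\<xi>0 = (\<epsilon> * X\<^sup>2) *\<^sub>R (N, - (\<phi> w \<bullet> N))"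
  define T where "T = {\<xi> :: (real^'n) \<times> real. fst \<xi> \<bullet> N = \<epsilon> * X\<^sup>2}"
  have [measurable]: "b \<in> borel_measurable borel" unfolding b_def by measurable
  have b01: "0 \<le> b y" "b y \<le> 1" for y
    unfolding b_def by (auto intro!: prod_nonneg prod_le_1 simp: G_nonneg G_le_1)
  have eX: "0 < \<epsilon> * X\<^sup>2" using pos by simp
  have ft: "cmod (wft \<mu> (\<lambda>y. w0 y * b y) \<xi>0) \<le> B0 * (\<epsilon> * X\<^sup>2) powr (- q)"
    unfolding b_def
  proof (rule wft_prod_window_bound[where T=T])
    show "\<bar>w0 y\<bar> \<le> 1" for y using w01[of y] by simp
    show "\<xi> + t *\<^sub>R e i \<in> T" if "\<xi> \<in> T" for \<xi> t i
      using that N(2)[of i] by (simp add: T_def e_def inner_add_left inner_add_right inner_commute)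
    have "N \<bullet> N = 1" using N(1) by (simp add: dot_square_norm)
    then show "\<xi>0 \<in> T" by (simp add: T_def \<xi>0_def)
    show "cmod (wft \<mu> w0 \<xi>) \<le> B0 * (\<epsilon> * X\<^sup>2) powr (- q)" if "\<xi> \<in> T" for \<xi>
    proof -
      have "\<epsilon> * X\<^sup>2 \<le> norm (fst \<xi>) * norm N" using that norm_cauchy_schwarz[of "fst \<xi>" N] by (simp add: T_def)
      also have "\<dots> \<le> norm \<xi>" using N(1) norm_fst_le[of "fst \<xi>" "snd \<xi>"] by simp
      finally have le: "\<epsilon> * X\<^sup>2 \<le> norm \<xi>" .
      then have "(\<epsilon> * X\<^sup>2) powr q * cmod (wft \<mu> w0 \<xi>) \<le> norm \<xi> powr q * cmod (wft \<mu> w0 \<xi>)"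
        using eX q by (intro mult_right_mono powr_mono2) auto
      also have "\<dots> \<le> B0" by (rule B0)
      finally have "cmod (wft \<mu> w0 \<xi>) \<le> B0 / (\<epsilon> * X\<^sup>2) powr q"
        using pos_le_divide_eq[of "(\<epsilon> * X\<^sup>2) powr q"] eX by (metis mult.commute powr_gt_zero less_irrefl)
      then show ?thesis by (simp only: powr_minus divide_inverse)
    qed
  qed (use fin s w0 in auto)
  \<comment> \<open>The last component of \<open>e i\<close> subtracts the value at the cap centre:
    pairing with (h \<open>\<phi> u\<close>, h) leaves h times the displacement from
    \<open>\<phi> w\<close>, paired with \<open>a i\<close>.\<close>
  have dote: "y \<bullet> e i = \<alpha> * X * snd y * ((\<phi> u - \<phi> w) \<bullet> a i)" if "fst y = snd y *\<^sub>R \<phi> u" for y u i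
    using that by (cases y) (simp add: e_def inner_diff_left algebra_simps)
  have dotx: "y \<bullet> \<xi>0 = \<epsilon> * X\<^sup>2 * snd y * ((\<phi> u - \<phi> w) \<bullet> N)" if "fst y = snd y *\<^sub>R \<phi> u" for y u
    using that by (cases y) (simp add: \<xi>0_def inner_diff_left algebra_simps)
  let ?C = "\<lambda>y. cos (- 2 * pi * (y \<bullet> \<xi>0))"
  \<comment> \<open>One factor 1/2 comes from each of the windows and one more from the cosine.
    Outside \<open>E\<close> the right side must still be nonnegative, which holds because the
    cosine is positive wherever the windows do not vanish.\<close>
  have ptw: "AE y in \<mu>. w0 y * indicator E y / 2 ^ (CARD('m) + 1) \<le> w0 y * b y * ?C y"
    using AEY
  proof eventually_elim
    case (elim y)
    show ?case
    proof (cases "w0 y = 0")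
      case False
      with elim have yY: "y \<in> Y" by simp
      obtain u where u: "u \<in> D" "fst y = snd y *\<^sub>R \<phi> u" "H1 \<le> \<bar>snd y\<bar>" "\<bar>snd y\<bar> \<le> H2"
        using Y[OF yY] by blast
      \<comment> \<open>Inside \<open>E\<close> the parameter is within Z/X of \<open>w\<close>, so
        the choice of \<open>\<alpha>\<close> keeps every window argument below
        \<open>\<delta>\<close>.\<close>
      have bE: "1 / 2 ^ CARD('m) \<le> b y" if "y \<in> E"
      proof -
        have nz: "norm (u - w) \<le> Z / X" by (rule EZ[OF yY that u(1,2)])
        have "1 / 2 \<le> G (y \<bullet> e i - 0)" for i
        proof (rule G_ge)
          have "\<bar>(\<phi> u - \<phi> w) \<bullet> a i\<bar> \<le> norm (\<phi> u - \<phi> w) * norm (a i)" by (rule Cauchy_Schwarz_ineq2)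
          also have "\<dots> \<le> (K * (Z / X)) * K"
            using order_trans[OF up[OF u(1)] mult_left_mono[OF nz]] a[of i] pos by (intro mult_mono) auto
          finally have 1: "\<bar>(\<phi> u - \<phi> w) \<bullet> a i\<bar> \<le> (K * (Z / X)) * K" .
          have "\<bar>y \<bullet> e i - 0\<bar> = \<alpha> * X * \<bar>snd y\<bar> * \<bar>(\<phi> u - \<phi> w) \<bullet> a i\<bar>"
            using pos by (simp add: dote[OF u(2)] abs_mult)
          also have "\<dots> \<le> \<alpha> * X * H2 * ((K * (Z / X)) * K)"
            using 1 u(4) pos by (intro mult_mono) auto
          also have "\<dots> = \<alpha> * H2 * K\<^sup>2 * Z" using pos by (simp add: power2_eq_square)
          finally show "\<bar>y \<bullet> e i - 0\<bar> \<le> \<delta>" using \<alpha> by simp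
        qed
        then have "(\<Prod>i\<in>(UNIV::'m set). 1 / 2) \<le> b y" unfolding b_def by (intro prod_mono) auto
        then show ?thesis by (simp add: power_divide)
      qed
      \<comment> \<open>Conversely, a nonzero product of windows forces u to within O(1/X) of
        \<open>w\<close>, through the tangent direction that sees |u - w|. The normal displacement
        is then O(1/X^2) and compensates the frequency.\<close>
      have Cb: "1 / 2 \<le> ?C y" if "b y \<noteq> 0"
      proof -
        obtain i where i: "c * norm (u - w) \<le> \<bar>(\<phi> u - \<phi> w) \<bullet> a i\<bar>" using low[OF u(1)] by blast
        have "G (y \<bullet> e i - 0) \<noteq> 0" using that unfolding b_def by (simp add: prod_zero_iff)
        then have "\<bar>y \<bullet> e i - 0\<bar> < r" using G_support not_le by blast
        then have "\<alpha> * X * \<bar>snd y\<bar> * \<bar>(\<phi> u - \<phi> w) \<bullet> a i\<bar> < r" using pos by (simp add: dote[OF u(2)] abs_mult)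
        moreover have "\<alpha> * X * H1 * (c * norm (u - w)) \<le> \<alpha> * X * \<bar>snd y\<bar> * \<bar>(\<phi> u - \<phi> w) \<bullet> a i\<bar>"
          using i u pos by (intro mult_mono) auto
        ultimately have "\<alpha> * X * H1 * (c * norm (u - w)) \<le> r" by simp
        then have nb: "norm (u - w) \<le> r / (\<alpha> * c * H1) / X" using pos by (simp add: field_simps)
        have "\<bar>2 * pi * (y \<bullet> \<xi>0)\<bar> = 2 * pi * (\<epsilon> * X\<^sup>2 * \<bar>snd y\<bar> * \<bar>(\<phi> u - \<phi> w) \<bullet> N\<bar>)"
          using pos by (simp add: dotx[OF u(2)] abs_mult)
        also have "\<dots> \<le> 2 * pi * (\<epsilon> * X\<^sup>2 * H2 * (K * (r / (\<alpha> * c * H1) / X)\<^sup>2))"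
        proof -
          have "K * (norm (u - w))\<^sup>2 \<le> K * (r / (\<alpha> * c * H1) / X)\<^sup>2" using nb pos by (intro mult_left_mono power_mono) auto
          then have "\<bar>(\<phi> u - \<phi> w) \<bullet> N\<bar> \<le> K * (r / (\<alpha> * c * H1) / X)\<^sup>2" using nrm[OF u(1)] by simp
          then show ?thesis using u(4) pos by (intro mult_left_mono mult_mono) auto
        qed
        also have "\<dots> = pi * (2 * \<epsilon> * H2 * K * (r / (\<alpha> * c * H1))\<^sup>2)" using pos by (simp add: power_divide power_mult_distrib field_simps)
        \<comment> \<open>The bound 1/3 in the hypothesis on \<open>\<epsilon>\<close> is chosen for
          the value cos(pi/3) = 1/2.\<close>
        also have "\<dots> \<le> pi * (1 / 3)" using \<epsilon> by (intro mult_left_mono) auto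
        finally have "\<bar>2 * pi * (y \<bullet> \<xi>0)\<bar> \<le> pi / 3" by simp
        then have "cos (pi / 3) \<le> cos \<bar>2 * pi * (y \<bullet> \<xi>0)\<bar>" by (intro cos_monotone_0_pi_le) auto
        then show ?thesis by (simp add: cos_60)
      qed
      have "indicator E y / 2 ^ (CARD('m) + 1) \<le> b y * ?C y"
      proof (cases "b y = 0")
        case True
        then have "y \<notin> E" using bE by (metis less_le_not_le zero_less_divide_1_iff zero_less_numeral zero_less_power)
        then show ?thesis using True by simp
      next
        case False
        have "indicator E y / 2 ^ (CARD('m) + 1) \<le> b y * (1 / 2)"
          using bE b01(1)[of y] by (auto simp: indicator_def)
        also have "\<dots> \<le> b y * ?C y" using Cb[OF False] b01(1)[of y] by (intro mult_left_mono) auto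
        finally show ?thesis .
      qed
      then have "w0 y * (indicator E y / 2 ^ (CARD('m) + 1)) \<le> w0 y * (b y * ?C y)"
        using w01(1) by (intro mult_left_mono)
      then show ?thesis by simp
    qed simp
  qed
  have bnd: "\<bar>w0 y * b y * ?C y\<bar> \<le> 1" for y
    unfolding abs_mult using w01[of y] b01[of y] by (intro mult_le_one) auto
  have i1: "integrable \<mu> (\<lambda>y. of_real (w0 y * b y) * cis (- 2 * pi * (y \<bullet> \<xi>0)))"
    using w01 b01 by (intro \<mu>.integrable_const_bound[where B=1]) (auto simp: norm_mult intro!: mult_le_one)
  have "(\<integral>y. w0 y * indicator E y / 2 ^ (CARD('m) + 1) \<partial>\<mu>) \<le> (\<integral>y. w0 y * b y * ?C y \<partial>\<mu>)"
  proof (rule integral_mono_AE[OF _ _ ptw])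
    show "integrable \<mu> (\<lambda>y. w0 y * indicator E y / 2 ^ (CARD('m) + 1))"
      using w01 by (intro \<mu>.integrable_const_bound[where B=1] integrable_divide) (auto simp: indicator_def)
    show "integrable \<mu> (\<lambda>y. w0 y * b y * ?C y)"
      using bnd by (intro \<mu>.integrable_const_bound[where B=1]) auto
  qed
  also have "(\<integral>y. w0 y * b y * ?C y \<partial>\<mu>) = Re (wft \<mu> (\<lambda>y. w0 y * b y) \<xi>0)"
    unfolding wft_def integral_Re[OF i1, symmetric] by simp
  also have "\<dots> \<le> cmod (wft \<mu> (\<lambda>y. w0 y * b y) \<xi>0)" by (rule complex_Re_le_cmod)
  also have "\<dots> \<le> B0 * (\<epsilon> * X\<^sup>2) powr (- q)" by (rule ft)
  finally show ?thesis by (simp add: field_simps)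
qed

text \<open>The caps are preimages of grid cells of side 1/X under m coordinates read off the point
  of the cone. There are O(X^m) cells and each has mass O(X^(-2q)), so the total mass would tend to
  0 if 2q exceeded m.\<close>

lemma (in window) cone_patch_decay_le:
  fixes \<mu> :: "((real^'n::finite) \<times> real) measure" and \<phi> :: "real^'m::finite \<Rightarrow> real^'n" and q :: real
    and a0 :: "'m \<Rightarrow> real^'n"
  assumes card: "CARD('m) < CARD('n)"
    and fin: "finite_measure \<mu>" and s [simp, measurable_cong]: "sets \<mu> = sets borel"
    and w0 [measurable]: "w0 \<in> borel_measurable borel" and w01: "\<And>y. 0 \<le> w0 y" "\<And>y. w0 y \<le> 1"
    and q: "0 \<le> q" and B0: "\<And>\<xi>. norm \<xi> powr q * cmod (wft \<mu> w0 \<xi>) \<le> B0"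
    and AEY: "AE y in \<mu>. w0 y \<noteq> 0 \<longrightarrow> y \<in> Y"
    and Y: "\<And>y. y \<in> Y \<Longrightarrow> \<exists>u\<in>D. fst y = snd y *\<^sub>R \<phi> u \<and> H1 \<le> \<bar>snd y\<bar> \<and> \<bar>snd y\<bar> \<le> H2"
    and pos: "0 < H1" "0 < H2" "0 < K" "0 < c"
    and low: "\<And>u w. u \<in> D \<Longrightarrow> w \<in> D \<Longrightarrow> \<exists>i. c * norm (u - w) \<le> \<bar>(\<phi> u - \<phi> w) \<bullet> partial i \<phi> w\<bar>"
    and low0: "\<And>u w. u \<in> D \<Longrightarrow> w \<in> D \<Longrightarrow> \<exists>i. c * norm (u - w) \<le> \<bar>(\<phi> u - \<phi> w) \<bullet> a0 i\<bar>"
    and up: "\<And>u w. u \<in> D \<Longrightarrow> w \<in> D \<Longrightarrow> norm (\<phi> u - \<phi> w) \<le> K * norm (u - w)"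
    and tay: "\<And>u w. u \<in> D \<Longrightarrow> w \<in> D \<Longrightarrow>
        norm (\<phi> u - \<phi> w - (\<Sum>i\<in>UNIV. (u - w) $ i *\<^sub>R partial i \<phi> w)) \<le> K * (norm (u - w))\<^sup>2"
    and part: "\<And>u i. u \<in> D \<Longrightarrow> norm (partial i \<phi> u) \<le> K"
    and a0: "\<And>i. norm (a0 i) \<le> K"
    and bd: "\<And>u. u \<in> D \<Longrightarrow> norm (\<phi> u) \<le> K"
    and I0: "0 < (\<integral>y. w0 y \<partial>\<mu>)"
  shows "2 * q \<le> real CARD('m)"
proof (rule ccontr)
  assume "\<not> 2 * q \<le> real CARD('m)"
  then have qm: "real CARD('m) < 2 * q" by simp
  interpret \<mu>: finite_measure \<mu> by fact
  let ?m = "CARD('m)"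
  \<comment> \<open>The scale required by \<open>cap_bound\<close> for caps of radius Z/X with Z =
    1/c, the size of a grid cell in the parameter domain.\<close>
  define \<alpha> where "\<alpha> = \<delta> / (H2 * K\<^sup>2 * (1 / c))"
  have \<alpha>: "0 < \<alpha>" "\<alpha> * H2 * K\<^sup>2 * (1 / c) \<le> \<delta>" using pos \<delta>_pos by (auto simp: \<alpha>_def)
  define P where "P = 2 * H2 * K * (r / (\<alpha> * c * H1))\<^sup>2"
  have P: "0 < P" using pos \<alpha> r_pos by (simp add: P_def)
  define \<epsilon> where "\<epsilon> = 1 / (3 * P)"
  have \<epsilon>: "0 < \<epsilon>" using P by (simp add: \<epsilon>_def)
  have "\<epsilon> * P = 1 / 3" using P by (simp add: \<epsilon>_def)
  then have \<epsilon>2: "2 * \<epsilon> * H2 * K * (r / (\<alpha> * c * H1))\<^sup>2 \<le> 1 / 3" by (simp add: P_def mult_ac)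
  have "0 \<le> B0" using B0[of 0] by (meson order_trans mult_nonneg_nonneg norm_ge_zero powr_ge_zero)
  define CC where "CC = 2 ^ (?m + 1) * B0 * \<epsilon> powr (- q)"
  have CC: "0 \<le> CC" using \<open>0 \<le> B0\<close> by (simp add: CC_def)
  \<comment> \<open>Dividing by the last component recovers the coordinates of the point of the
    surface, so membership in a cell is a Borel condition on \<open>y\<close> itself and involves no
    choice of a parameter.\<close>
  define v where "v y i = (fst y /\<^sub>R snd y) \<bullet> a0 i" for y :: "(real^'n) \<times> real" and i
  have [measurable]: "(\<lambda>y. v y i) \<in> borel_measurable borel" for i
  proof -
    have [measurable]: "(fst :: (real^'n) \<times> real \<Rightarrow> _) \<in> borel_measurable borel" "(snd :: (real^'n) \<times> real \<Rightarrow> _) \<in> borel_measurable borel"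
      by (intro borel_measurable_continuous_onI continuous_intros)+
    show ?thesis unfolding v_def by (intro borel_measurable_inner borel_measurable_scaleR borel_measurable_inverse borel_measurable_const) auto
  qed
  have vY: "v y i = \<phi> u \<bullet> a0 i" if "y \<in> Y" "fst y = snd y *\<^sub>R \<phi> u" for y u i
  proof -
    have "snd y \<noteq> 0" using Y[OF that(1)] pos by auto
    then show ?thesis using that(2) by (simp add: v_def)
  qed
  have main: "(\<integral>y. w0 y \<partial>\<mu>) \<le> (2 * K\<^sup>2 + 5) ^ ?m * CC * X powr (real ?m - 2 * q)" if X: "1 \<le> X" for X
  proof -
    define E where "E z = {y. \<forall>i. \<lfloor>X * v y i\<rfloor> = z i}" for z :: "'m \<Rightarrow> int"
    have E_meas [measurable]: "E z \<in> sets borel" for z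
    proof -
      have "E z = (\<Inter>i. {y. \<lfloor>X * v y i\<rfloor> = z i})" by (auto simp: E_def)
      moreover have "{y. \<lfloor>X * v y i\<rfloor> = z i} \<in> sets borel" for i by measurable
      ultimately show ?thesis by (auto intro!: sets.finite_INT)
    qed
    define b where "b = \<lceil>K\<^sup>2 * X\<rceil> + 1"
    have "0 \<le> K\<^sup>2 * X" using X by simp
    then have b0: "0 \<le> b" unfolding b_def by linarith
    define Z where "Z = (PiE (UNIV::'m set) (\<lambda>_. {- b..b}))"
    have Zf: "finite Z" unfolding Z_def by (intro finite_PiE) auto
    have "card Z = card {- b..b} ^ ?m" unfolding Z_def by (simp add: card_PiE)
    then have "real (card Z) = (2 * real_of_int b + 1) ^ ?m" using b0 by simp
    \<comment> \<open>Here 2b + 1 is at most 2 K^2 X + 5, and the constant is absorbed because X is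
      at least 1.\<close>
    also have "\<dots> \<le> ((2 * K\<^sup>2 + 5) * X) ^ ?m"
    proof (rule power_mono)
      have "real_of_int b \<le> K\<^sup>2 * X + 2" unfolding b_def by linarith
      then show "2 * real_of_int b + 1 \<le> (2 * K\<^sup>2 + 5) * X" using X by (simp add: algebra_simps)
    qed (use b0 in simp)
    finally have cZ: "real (card Z) \<le> (2 * K\<^sup>2 + 5) ^ ?m * X ^ ?m" by (simp add: power_mult_distrib)
    have each: "(\<integral>y. w0 y * indicator (E z) y \<partial>\<mu>) \<le> CC * X powr (- 2 * q)" for z
    \<comment> \<open>A cell that misses \<open>Y\<close> carries no weight; in any other cell the
      parameter of an arbitrary point serves as cap centre.\<close>
    proof (cases "Y \<inter> E z = {}")
      case True
      have "(\<integral>y. w0 y * indicator (E z) y \<partial>\<mu>) = (\<integral>y. 0 \<partial>\<mu>)"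
        using AEY True by (intro integral_cong_AE) (auto simp: indicator_def elim!: eventually_mono)
      then show ?thesis using CC by simp
    next
      case False
      then obtain y1 where y1: "y1 \<in> Y" "y1 \<in> E z" by blast
      obtain w where w: "w \<in> D" "fst y1 = snd y1 *\<^sub>R \<phi> w" using Y[OF y1(1)] by blast
      obtain N where N: "norm N = 1" "\<And>i. N \<bullet> partial i \<phi> w = 0"
        using normal_exists[OF card, of "\<lambda>i. partial i \<phi> w"] by blast
      have "(\<integral>y. w0 y * indicator (E z) y \<partial>\<mu>) \<le> 2 ^ (?m + 1) * B0 * (\<epsilon> * X\<^sup>2) powr (- q)"
      proof (rule cap_bound[where D=D and Y=Y and \<phi>=\<phi> and w=w and N=N and a="\<lambda>i. partial i \<phi> w"
            and ?H1.0=H1 and ?H2.0=H2 and K=K and c=c and \<alpha>=\<alpha> and Z="1/c"])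
        show "\<bar>(\<phi> u - \<phi> w) \<bullet> N\<bar> \<le> K * (norm (u - w))\<^sup>2" if "u \<in> D" for u
        proof -
          have "(\<Sum>i\<in>UNIV. (u - w) $ i *\<^sub>R partial i \<phi> w) \<bullet> N = 0"
            using N(2) by (simp add: inner_sum_right inner_commute[of _ N])
          then have "\<bar>(\<phi> u - \<phi> w) \<bullet> N\<bar> = \<bar>(\<phi> u - \<phi> w - (\<Sum>i\<in>UNIV. (u - w) $ i *\<^sub>R partial i \<phi> w)) \<bullet> N\<bar>"
            by (simp add: inner_diff_left)
          also have "\<dots> \<le> norm (\<phi> u - \<phi> w - (\<Sum>i\<in>UNIV. (u - w) $ i *\<^sub>R partial i \<phi> w)) * norm N"
            by (rule Cauchy_Schwarz_ineq2)
          also have "\<dots> \<le> K * (norm (u - w))\<^sup>2" using tay[OF that w(1)] N(1) by simp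
          finally show ?thesis .
        qed
        show "norm (u - w) \<le> 1 / c / X" if yu: "y \<in> Y" "y \<in> E z" "u \<in> D" "fst y = snd y *\<^sub>R \<phi> u" for y u
        proof -
          obtain i where i: "c * norm (u - w) \<le> \<bar>(\<phi> u - \<phi> w) \<bullet> a0 i\<bar>" using low0[OF yu(3) w(1)] by blast
          \<comment> \<open>Equal integer parts mean coordinates within 1/X, and the fixed tangents
            convert this into a parameter distance of at most 1/(cX).\<close>
          have "\<lfloor>X * v y i\<rfloor> = \<lfloor>X * v y1 i\<rfloor>" using yu(2) y1(2) by (simp add: E_def)
          then have "\<bar>X * v y i - X * v y1 i\<bar> \<le> 1" by linarith
          then have "X * \<bar>v y i - v y1 i\<bar> \<le> 1" using X by (simp flip: right_diff_distrib add: abs_mult)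
          moreover have "v y i - v y1 i = (\<phi> u - \<phi> w) \<bullet> a0 i"
            using vY[OF yu(1,4)] vY[OF y1(1) w(2)] by (simp add: inner_diff_left)
          ultimately have "X * \<bar>(\<phi> u - \<phi> w) \<bullet> a0 i\<bar> \<le> 1" by simp
          moreover have "X * (c * norm (u - w)) \<le> X * \<bar>(\<phi> u - \<phi> w) \<bullet> a0 i\<bar>" using i X by (intro mult_left_mono) auto
          ultimately have "X * (c * norm (u - w)) \<le> 1" by simp
          then show ?thesis using X pos by (simp add: field_simps)
        qed
      qed (use fin s w0 w01 q B0 AEY Y pos \<alpha> \<epsilon> \<epsilon>2 X N part[OF w(1)] low[OF _ w(1)] up[OF _ w(1)] in auto)
      also have "\<dots> = CC * X powr (- 2 * q)"
      proof -
        have "(X\<^sup>2) powr (- q) = X powr (- 2 * q)" using X by (simp add: powr_powr flip: powr_numeral)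
        then show ?thesis using X \<epsilon> by (simp add: CC_def powr_mult)
      qed
      finally show ?thesis .
    qed
    have int: "integrable \<mu> (\<lambda>y. w0 y * indicator (E z) y)" for z
      using w01 by (intro \<mu>.integrable_const_bound[where B=1]) (auto simp: indicator_def)
    have "(\<integral>y. w0 y \<partial>\<mu>) = (\<integral>y. (\<Sum>z\<in>Z. w0 y * indicator (E z) y) \<partial>\<mu>)"
    proof (rule integral_cong_AE)
      show "AE y in \<mu>. w0 y = (\<Sum>z\<in>Z. w0 y * indicator (E z) y)"
        using AEY
      proof eventually_elim
        case (elim y)
        show ?case
        proof (cases "w0 y = 0")
          case False
          with elim have yY: "y \<in> Y" by simp
          obtain u where u: "u \<in> D" "fst y = snd y *\<^sub>R \<phi> u" using Y[OF yY] by blast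
          define z0 where "z0 = (\<lambda>i. \<lfloor>X * v y i\<rfloor>)"
          have "z0 i \<in> {- b..b}" for i
          proof -
            have "\<bar>v y i\<bar> \<le> norm (\<phi> u) * norm (a0 i)" unfolding vY[OF yY u(2)] by (rule Cauchy_Schwarz_ineq2)
            also have "\<dots> \<le> K * K" using bd[OF u(1)] a0[of i] pos by (intro mult_mono) auto
            finally have "\<bar>v y i\<bar> \<le> K\<^sup>2" by (simp add: power2_eq_square)
            then have "X * \<bar>v y i\<bar> \<le> X * K\<^sup>2" using X by (intro mult_left_mono) auto
            then have "\<bar>X * v y i\<bar> \<le> K\<^sup>2 * X" using X by (simp add: abs_mult mult.commute)
            then show ?thesis unfolding z0_def b_def by (auto simp: le_floor_iff floor_le_iff) linarith+
          qed
          then have z0: "z0 \<in> Z" unfolding Z_def by (auto simp: PiE_def)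
          have "(\<Sum>z\<in>Z. w0 y * indicator (E z) y) = (\<Sum>z\<in>Z. if z = z0 then w0 y else 0)"
            by (intro sum.cong) (auto simp: E_def z0_def indicator_def)
          also have "\<dots> = w0 y" using z0 Zf by simp
          finally show ?thesis by simp
        qed simp
      qed
    qed measurable
    also have "\<dots> = (\<Sum>z\<in>Z. \<integral>y. w0 y * indicator (E z) y \<partial>\<mu>)" by (intro Bochner_Integration.integral_sum int)
    also have "\<dots> \<le> (\<Sum>z\<in>Z. CC * X powr (- 2 * q))" by (intro sum_mono each)
    also have "\<dots> = real (card Z) * (CC * X powr (- 2 * q))" by simp
    also have "\<dots> \<le> ((2 * K\<^sup>2 + 5) ^ ?m * X ^ ?m) * (CC * X powr (- 2 * q))"
      using cZ CC by (intro mult_right_mono) auto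
    also have "\<dots> = (2 * K\<^sup>2 + 5) ^ ?m * CC * (X powr real ?m * X powr (- 2 * q))"
      using X by (simp add: powr_realpow)
    also have "X powr real ?m * X powr (- 2 * q) = X powr (real ?m - 2 * q)"
      by (simp flip: powr_add)
    finally show ?thesis .
  qed
  \<comment> \<open>The bound \<open>main\<close> has a negative power of X and a left side
    independent of X; letting X tend to infinity contradicts positive mass.\<close>
  have "((\<lambda>X. (2 * K\<^sup>2 + 5) ^ ?m * CC * X powr (real ?m - 2 * q)) \<longlongrightarrow> (2 * K\<^sup>2 + 5) ^ ?m * CC * 0) at_top"
    using qm by (intro tendsto_mult tendsto_const tendsto_neg_powr filterlim_ident) simp
  moreover have "eventually (\<lambda>X. (\<integral>y. w0 y \<partial>\<mu>) \<le> (2 * K\<^sup>2 + 5) ^ ?m * CC * X powr (real ?m - 2 * q)) at_top"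
    using main by (auto intro!: eventually_at_top_linorderI[of 1])
  ultimately have "(\<integral>y. w0 y \<partial>\<mu>) \<le> (2 * K\<^sup>2 + 5) ^ ?m * CC * 0"
    by (intro tendsto_lowerbound) auto
  then show False using I0 by simp
qed

text \<open>A measure carried by the origin has constant Fourier transform. This removes the apex,
  the one point of the cone where the surface point cannot be recovered from its position.\<close>

lemma no_decay_if_supported_at_point:
  fixes \<mu> :: "'a::euclidean_space measure"
  assumes fin: "finite_measure \<mu>" and s [simp, measurable_cong]: "sets \<mu> = sets borel" and nz: "emeasure \<mu> (space \<mu>) \<noteq> 0"
    and supp: "msupport \<mu> \<subseteq> {0}" and q: "0 < q"
    and B: "\<And>\<xi>. norm \<xi> powr q * cmod (fourier_transform \<mu> \<xi>) \<le> B"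
  shows False
proof -
  interpret finite_measure \<mu> by fact
  have "AE y in \<mu>. y \<in> msupport \<mu>"
    using msupport_complement_null[OF s] by (intro AE_I[where N="- msupport \<mu>"]) auto
  then have "AE y in \<mu>. y = 0" by eventually_elim (use supp in auto)
  then have "fourier_transform \<mu> \<xi> = (\<integral>y. 1 \<partial>\<mu>)" for \<xi>
    unfolding fourier_transform_def by (intro integral_cong_AE) (auto elim!: eventually_mono)
  then have ft: "cmod (fourier_transform \<mu> \<xi>) = measure \<mu> (space \<mu>)" for \<xi> by simp
  have pos: "0 < measure \<mu> (space \<mu>)" using nz by (simp add: emeasure_eq_measure zero_less_measure_iff)
  obtain b :: 'a where b: "b \<in> Basis" by (meson SOME_Basis)
  have le: "t powr q * measure \<mu> (space \<mu>) \<le> B" if "0 < t" for t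
    using B[of "t *\<^sub>R b"] b that by (simp add: ft)
  have "0 \<le> B" using B[of 0] ft by simp
  \<comment> \<open>At this frequency the weighted transform equals \<open>B + 1\<close>.\<close>
  have "(((B + 1) / measure \<mu> (space \<mu>)) powr (1 / q)) powr q * measure \<mu> (space \<mu>) \<le> B"
    using pos \<open>0 \<le> B\<close> by (intro le) simp
  then show False using pos q \<open>0 \<le> B\<close> by (simp add: powr_powr)
qed

text \<open>Localisation around a point of the support other than the apex. Its surface point may
  lie on the boundary of S: only the smoothness of \<open>\<phi>\<close> on the open set
  \<open>V\<close> is used, and the chart need not fill a neighbourhood.\<close>

lemma cone_decay_le:
  fixes S :: "(real^'n::finite) set"
  assumes card: "CARD('n) = CARD('m::finite) + 1"
    and mfd: "smooth_submanifold_bdry TYPE('m) S"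
    and \<mu>: "\<mu> \<in> measures_on (cone_over S)"
    and s0: "0 \<le> s" and B: "\<And>\<xi>. norm \<xi> powr (s / 2) * cmod (fourier_transform \<mu> \<xi>) \<le> B"
  shows "s \<le> real CARD('m)"
proof (cases "s = 0")
  case False
  with s0 have sp: "0 < s" by simp
  have fin: "finite_measure \<mu>" and s [simp, measurable_cong]: "sets \<mu> = sets borel"
    and nz: "emeasure \<mu> (space \<mu>) \<noteq> 0" and supp: "msupport \<mu> \<subseteq> cone_over S"
    using \<mu> by (auto simp: measures_on_def)
  interpret \<mu>: finite_measure \<mu> by fact
  have "\<not> msupport \<mu> \<subseteq> {0}"
    using no_decay_if_supported_at_point[OF fin s nz _ _ B] sp by auto
  then obtain y0 where y0: "y0 \<in> msupport \<mu>" "y0 \<noteq> 0" by auto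
  then obtain p0 h0 where ph: "y0 = (h0 *\<^sub>R p0, h0)" "p0 \<in> S"
    using subsetD[OF supp y0(1)] by (auto simp: cone_over_def)
  have h0: "h0 \<noteq> 0" using y0(2) ph(1) by (auto simp: zero_prod_def)
  obtain U V and \<phi> :: "real^'m \<Rightarrow> real^'n" and k where p0U: "p0 \<in> U" and ch: "hs_chart S U V \<phi> k"
    using mfd ph(2) unfolding smooth_submanifold_bdry_def by blast
  then obtain \<psi> where U: "open U" and V: "open V" and sm: "smooth_on V \<phi>"
    and inj: "\<And>u. u \<in> V \<Longrightarrow> inj (frechet_derivative \<phi> (at u))"
    and hom: "homeomorphism (V \<inter> half_space k) (S \<inter> U) \<phi> \<psi>"
    unfolding hs_chart_def by blast
  define u0 where "u0 = \<psi> p0"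
  have u0: "u0 \<in> V" "\<phi> u0 = p0"
    using hom ph(2) p0U by (auto simp: u0_def homeomorphism_def)
  obtain \<rho> c K where pos: "0 < \<rho>" "0 < c" "0 < K" and sub: "ball u0 \<rho> \<subseteq> V"
    and geo: "\<And>u w. u \<in> ball u0 \<rho> \<Longrightarrow> w \<in> ball u0 \<rho> \<Longrightarrow> \<exists>i. c * norm (u - w) \<le> \<bar>(\<phi> u - \<phi> w) \<bullet> partial i \<phi> w\<bar>"
    "\<And>u w. u \<in> ball u0 \<rho> \<Longrightarrow> w \<in> ball u0 \<rho> \<Longrightarrow> \<exists>i. c * norm (u - w) \<le> \<bar>(\<phi> u - \<phi> w) \<bullet> partial i \<phi> u0\<bar>"
    "\<And>u w. u \<in> ball u0 \<rho> \<Longrightarrow> w \<in> ball u0 \<rho> \<Longrightarrow> norm (\<phi> u - \<phi> w) \<le> K * norm (u - w)"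
    "\<And>u w. u \<in> ball u0 \<rho> \<Longrightarrow> w \<in> ball u0 \<rho> \<Longrightarrow>
        norm (\<phi> u - \<phi> w - (\<Sum>i\<in>UNIV. (u - w) $ i *\<^sub>R partial i \<phi> w)) \<le> K * (norm (u - w))\<^sup>2"
    "\<And>u i. u \<in> ball u0 \<rho> \<Longrightarrow> norm (partial i \<phi> u) \<le> K"
    "\<And>u. u \<in> ball u0 \<rho> \<Longrightarrow> norm (\<phi> u) \<le> K"
    by (rule chart_geometry[OF sm V u0(1) inj[OF u0(1)]]) blast
  have cont: "continuous_on (S \<inter> U) \<psi>" using hom by (simp add: homeomorphism_def)
  have "openin (top_of_set (S \<inter> U)) ((S \<inter> U) \<inter> \<psi> -` ball u0 \<rho>)"
    using cont by (intro continuous_openin_preimage_gen) auto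
  then obtain U1 where U1: "open U1" "(S \<inter> U) \<inter> \<psi> -` ball u0 \<rho> = (S \<inter> U) \<inter> U1"
    by (auto simp: openin_open)
  \<comment> \<open>Continuity of the inverse chart shrinks \<open>U\<close> so that all surface
    points in it have parameters in the ball on which the geometric estimates hold.\<close>
  define U' where "U' = U \<inter> U1"
  have U': "open U'" unfolding U'_def by (rule open_Int[OF U U1(1)])
  have "p0 \<in> (S \<inter> U) \<inter> \<psi> -` ball u0 \<rho>" using ph(2) p0U pos by (simp add: u0_def)
  then have p0U': "p0 \<in> U'" using U1(2) p0U unfolding U'_def by blast
  have par: "\<exists>u\<in>ball u0 \<rho>. \<phi> u = p" if "p \<in> S" "p \<in> U'" for p
  proof -
    have "\<psi> p \<in> ball u0 \<rho>" using that U1(2) unfolding U'_def by blast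
    moreover have "\<phi> (\<psi> p) = p" using hom that by (auto simp: homeomorphism_def U'_def)
    ultimately show ?thesis by blast
  qed
  have "\<forall>\<^sub>F y in nhds y0. \<bar>h0\<bar> / 2 < \<bar>snd y\<bar> \<and> \<bar>snd y\<bar> < 2 * \<bar>h0\<bar> \<and> fst y /\<^sub>R snd y \<in> U'"
  proof (intro eventually_conj)
    have t: "filterlim (\<lambda>y. \<bar>snd y\<bar>) (nhds \<bar>h0\<bar>) (nhds y0)"
      using tendsto_rabs[OF tendsto_snd[OF filterlim_ident[of "nhds y0"]]] ph(1) by simp
    show "\<forall>\<^sub>F y in nhds y0. \<bar>h0\<bar> / 2 < \<bar>snd y\<bar>" by (intro order_tendstoD(1)[OF t]) (use h0 in simp)
    show "\<forall>\<^sub>F y in nhds y0. \<bar>snd y\<bar> < 2 * \<bar>h0\<bar>" by (intro order_tendstoD(2)[OF t]) (use h0 in simp)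
    have "filterlim (\<lambda>y. inverse (snd y) *\<^sub>R fst y) (nhds (inverse (snd y0) *\<^sub>R fst y0)) (nhds y0)"
      using ph(1) h0 by (intro tendsto_scaleR tendsto_inverse tendsto_fst tendsto_snd filterlim_ident) auto
    then show "\<forall>\<^sub>F y in nhds y0. fst y /\<^sub>R snd y \<in> U'"
      using topological_tendstoD[OF _ U', of _ "p0"] p0U' ph(1) h0 by simp
  qed
  then obtain \<eta> where \<eta>: "0 < \<eta>"
    and near: "\<And>y. dist y y0 < \<eta> \<Longrightarrow> \<bar>h0\<bar> / 2 < \<bar>snd y\<bar> \<and> \<bar>snd y\<bar> < 2 * \<bar>h0\<bar> \<and> fst y /\<^sub>R snd y \<in> U'"
    unfolding eventually_nhds_metric by blast
  \<comment> \<open>The weight |xi|^(s/2) has to survive the localisation, so at least s/2 moments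
    are requested.\<close>
  obtain M G r \<delta> where win: "window M G r \<delta> (nat \<lceil>s / 2\<rceil>)" using window_exists by blast
  interpret window M G r \<delta> "nat \<lceil>s / 2\<rceil>" by (rule win)
  let ?Ba = "Basis :: ((real^'n) \<times> real) set"
  let ?D = "real DIM((real^'n) \<times> real)"
  \<comment> \<open>Each coordinate window confines its coordinate to within r /
    \<open>\<kappa>\<close>; summing over all coordinates gives distance at most
    \<open>\<eta>\<close> / 2.\<close>
  define \<kappa> where "\<kappa> = 2 * ?D * r / \<eta>"
  have \<kappa>: "0 < \<kappa>" using r_pos \<eta> by (simp add: \<kappa>_def)
  define w0 where "w0 y = (\<Prod>b\<in>?Ba. G (y \<bullet> (\<kappa> *\<^sub>R b) - \<kappa> * (y0 \<bullet> b)))" for y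
  have arg: "y \<bullet> (\<kappa> *\<^sub>R b) - \<kappa> * (y0 \<bullet> b) = \<kappa> * ((y - y0) \<bullet> b)" for y b
    by (simp add: inner_diff_left right_diff_distrib)
  have [measurable]: "w0 \<in> borel_measurable borel" unfolding w0_def by measurable
  have w01: "0 \<le> w0 y" "w0 y \<le> 1" for y
    unfolding w0_def by (auto intro!: prod_nonneg prod_le_1 simp: G_nonneg G_le_1)
  have w0s: "dist y y0 < \<eta>" if "w0 y \<noteq> 0" for y
  proof -
    have "\<bar>(y - y0) \<bullet> b\<bar> \<le> r / \<kappa>" if b: "b \<in> ?Ba" for b
    proof -
      have "G (\<kappa> * ((y - y0) \<bullet> b)) \<noteq> 0" using \<open>w0 y \<noteq> 0\<close> b unfolding w0_def arg by (simp add: prod_zero_iff)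
      then have "\<bar>\<kappa> * ((y - y0) \<bullet> b)\<bar> < r" using G_support not_le by blast
      then show ?thesis using \<kappa> by (simp add: abs_mult field_simps)
    qed
    then have "(\<Sum>b\<in>?Ba. \<bar>(y - y0) \<bullet> b\<bar>) \<le> (\<Sum>b\<in>?Ba. r / \<kappa>)" by (intro sum_mono)
    then have "norm (y - y0) \<le> ?D * (r / \<kappa>)" using norm_le_l1[of "y - y0"] by (simp del: DIM_prod)
    also have "\<dots> = \<eta> / 2" using r_pos \<eta> by (simp add: \<kappa>_def del: DIM_prod)
    finally show ?thesis using \<eta> by (simp add: dist_norm)
  qed
  have w0l: "1 / 2 ^ DIM((real^'n) \<times> real) \<le> w0 y" if "dist y y0 < \<delta> / \<kappa>" for y
  proof -
    have "1 / 2 \<le> G (y \<bullet> (\<kappa> *\<^sub>R b) - \<kappa> * (y0 \<bullet> b))" if b: "b \<in> ?Ba" for b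
    proof (rule G_ge)
      have "\<bar>(y - y0) \<bullet> b\<bar> \<le> norm (y - y0)" using b Basis_le_norm by blast
      also have "\<dots> < \<delta> / \<kappa>" using \<open>dist y y0 < \<delta> / \<kappa>\<close> by (simp add: dist_norm)
      finally show "\<bar>y \<bullet> (\<kappa> *\<^sub>R b) - \<kappa> * (y0 \<bullet> b)\<bar> \<le> \<delta>" unfolding arg using \<kappa> by (simp add: abs_mult field_simps)
    qed
    then have "(\<Prod>b\<in>?Ba. 1 / 2) \<le> w0 y" unfolding w0_def by (intro prod_mono) auto
    then show ?thesis by (simp add: power_divide del: DIM_prod)
  qed
  \<comment> \<open>Near \<open>y0\<close> all windows exceed 1/2, and a ball around a point of the
    support has positive measure.\<close>
  have I0: "0 < (\<integral>y. w0 y \<partial>\<mu>)"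
  proof -
    let ?O = "ball y0 (\<delta> / \<kappa>)"
    have "0 < emeasure \<mu> ?O" using y0(1) \<delta>_pos \<kappa> unfolding msupport_def by simp
    then have "0 < measure \<mu> ?O" by (simp add: \<mu>.emeasure_eq_measure)
    then have "0 < (\<integral>y. (1 / 2 ^ DIM((real^'n) \<times> real)) * indicat_real ?O y \<partial>\<mu>)" by (simp del: DIM_prod)
    also have "\<dots> \<le> (\<integral>y. w0 y \<partial>\<mu>)"
    proof (rule integral_mono)
      show "integrable \<mu> w0" using w01 by (intro \<mu>.integrable_const_bound[where B=1]) auto
      show "(1 / 2 ^ DIM((real^'n) \<times> real)) * indicat_real ?O y \<le> w0 y" for y
        using w0l[of y] w01(1)[of y] by (auto simp: indicator_def dist_commute simp del: DIM_prod)
      show "integrable \<mu> (\<lambda>y. (1 / 2 ^ DIM((real^'n) \<times> real)) * indicat_real ?O y)"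
        by (intro integrable_mult_right \<mu>.integrable_const_bound[where B=1] borel_measurable_indicator) auto
    qed
    finally show ?thesis .
  qed
  \<comment> \<open>The support is conull and lies in the cone, so requiring membership in it gives
    almost every point of nonzero weight a representation by the chart.\<close>
  define Y where "Y = {y \<in> msupport \<mu>. w0 y \<noteq> 0}"
  have "AE y in \<mu>. y \<in> msupport \<mu>"
    using msupport_complement_null[OF s] by (intro AE_I[where N="- msupport \<mu>"]) auto
  then have AEY: "AE y in \<mu>. w0 y \<noteq> 0 \<longrightarrow> y \<in> Y" by eventually_elim (simp add: Y_def)
  have Y: "\<exists>u\<in>ball u0 \<rho>. fst y = snd y *\<^sub>R \<phi> u \<and> \<bar>h0\<bar> / 2 \<le> \<bar>snd y\<bar> \<and> \<bar>snd y\<bar> \<le> 2 * \<bar>h0\<bar>" if "y \<in> Y" for y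
  proof -
    have n: "\<bar>h0\<bar> / 2 < \<bar>snd y\<bar>" "\<bar>snd y\<bar> < 2 * \<bar>h0\<bar>" "fst y /\<^sub>R snd y \<in> U'"
      using near[OF w0s[of y]] that by (auto simp: Y_def)
    have "y \<in> cone_over S" using that supp by (auto simp: Y_def)
    then obtain x h where xh: "y = (h *\<^sub>R x, h)" "x \<in> S" by (auto simp: cone_over_def)
    have "h \<noteq> 0" using n(1) h0 xh by auto
    then have "x \<in> U'" using n(3) xh by simp
    then obtain u where "u \<in> ball u0 \<rho>" "\<phi> u = x" using par[OF xh(2)] by blast
    then show ?thesis using n xh by (intro bexI[of _ u]) auto
  qed
  have "s / 2 \<le> real (nat \<lceil>s / 2\<rceil>)" using sp by linarith
  then obtain B0 where B0: "\<And>\<xi>. norm \<xi> powr (s / 2) * cmod (wft \<mu> w0 \<xi>) \<le> B0"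
    using wft_prod_window_decay[OF fin s _ _ B, of ?Ba "\<lambda>b. \<kappa> *\<^sub>R b" "\<lambda>b. \<kappa> * (y0 \<bullet> b)"] sp
    unfolding w0_def[abs_def] by auto
  have "2 * (s / 2) \<le> real CARD('m)"
    by (rule cone_patch_decay_le[where \<mu>=\<mu> and ?w0.0=w0 and Y=Y and D="ball u0 \<rho>" and \<phi>=\<phi> and ?H1.0="\<bar>h0\<bar> / 2" and ?H2.0="2 * \<bar>h0\<bar>"
          and K=K and c=c and ?a0.0="\<lambda>i. partial i \<phi> u0" and ?B0.0=B0])
      (use card fin s w01 sp B0 AEY Y h0 pos geo I0 in auto)
  then show ?thesis by simp
qed simp

section \<open>Nonstationary phase\<close>

text \<open>Integration by parts is always along one fixed direction, so only the restriction of a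
  function to lines in that direction has to be differentiable.\<close>

definition has_dir_deriv :: "('a::real_normed_vector \<Rightarrow> 'b::real_normed_vector) \<Rightarrow> 'b \<Rightarrow> 'a \<Rightarrow> 'a \<Rightarrow> bool" where
  "has_dir_deriv f f' u e \<longleftrightarrow> ((\<lambda>t::real. f (u + t *\<^sub>R e)) has_vector_derivative f') (at 0)"

lemma has_dir_deriv_shift:
  assumes "has_dir_deriv f f' (u + s *\<^sub>R e) e"
  shows "((\<lambda>t::real. f (u + t *\<^sub>R e)) has_vector_derivative f') (at s)"
proof -
  have d: "((\<lambda>t::real. f ((u + s *\<^sub>R e) + t *\<^sub>R e)) has_vector_derivative f') (at (s - s))"
    using assms by (simp add: has_dir_deriv_def)
  have "((\<lambda>t. t - s) has_vector_derivative 1) (at s)"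
    by (auto intro!: derivative_eq_intros)
  from vector_diff_chain_at[OF this d] show ?thesis
    by (simp add: o_def algebra_simps flip: scaleR_add_left)
qed

lemma has_dir_deriv_cong_open:
  assumes "open A" "u \<in> A" "\<And>x. x \<in> A \<Longrightarrow> f x = g x"
  shows "has_dir_deriv f f' u e \<longleftrightarrow> has_dir_deriv g f' u e"
proof -
  have "\<forall>\<^sub>F t in nhds (0::real). u + t *\<^sub>R e \<in> A"
  proof (rule topological_tendstoD[OF _ assms(1)])
    show "((\<lambda>t. u + t *\<^sub>R e) \<longlongrightarrow> u + 0 *\<^sub>R e) (nhds 0)" by (intro tendsto_intros filterlim_ident)
  qed (use assms in simp)
  then have "\<forall>\<^sub>F t in nhds (0::real). f (u + t *\<^sub>R e) = g (u + t *\<^sub>R e)"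
    by eventually_elim (use assms in auto)
  then show ?thesis unfolding has_dir_deriv_def
    using assms(3)[OF assms(2)] by (intro has_vector_derivative_cong_ev) auto
qed

lemma has_dir_deriv_unique_locally_0:
  assumes "has_dir_deriv f f' u e" "open A" "u \<in> A" "\<And>x. x \<in> A \<Longrightarrow> f x = 0"
  shows "f' = 0"
proof -
  have "has_dir_deriv (\<lambda>x. 0) f' u e"
    using assms(1) has_dir_deriv_cong_open[OF assms(2,3), of f "\<lambda>x. 0"] assms(4) by simp
  then have "((\<lambda>t::real. 0::'b) has_vector_derivative f') (at 0)" by (simp add: has_dir_deriv_def)
  then show ?thesis using vector_derivative_unique_at[OF _ has_vector_derivative_const] by blast
qed

lemma has_dir_deriv_mult:
  fixes f g :: "'a::real_normed_vector \<Rightarrow> 'b::real_normed_algebra"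
  assumes "has_dir_deriv f f' u e" "has_dir_deriv g g' u e"
  shows "has_dir_deriv (\<lambda>x. f x * g x) (f u * g' + f' * g u) u e"
  using has_vector_derivative_mult[OF assms[unfolded has_dir_deriv_def]] by (simp add: has_dir_deriv_def)

lemma has_dir_deriv_bounded_linear:
  assumes "has_dir_deriv f f' u e" "bounded_linear L"
  shows "has_dir_deriv (\<lambda>x. L (f x)) (L f') u e"
  using bounded_linear.has_vector_derivative[OF assms(2) assms(1)[unfolded has_dir_deriv_def]]
  by (simp add: has_dir_deriv_def)

lemma has_dir_deriv_inverse:
  fixes f :: "'a::real_normed_vector \<Rightarrow> real"
  assumes "has_dir_deriv f f' u e" "f u \<noteq> 0"
  shows "has_dir_deriv (\<lambda>x. 1 / f x) (- f' * (1 / f u * (1 / f u))) u e"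
  using assms unfolding has_dir_deriv_def has_real_derivative_iff_has_vector_derivative[symmetric]
  by (auto intro!: derivative_eq_intros simp: field_simps power2_eq_square)

lemma has_dir_deriv_cis:
  fixes f :: "'a::real_normed_vector \<Rightarrow> real"
  assumes "has_dir_deriv f f' u e"
  shows "has_dir_deriv (\<lambda>x. cis (f x)) (f' *\<^sub>R (\<i> * cis (f u))) u e"
  using has_derivative_cis[OF assms[unfolded has_dir_deriv_def has_vector_derivative_def]]
  by (simp add: has_dir_deriv_def has_vector_derivative_def)

lemma has_derivative_imp_dir_deriv:
  assumes "(f has_derivative f') (at u)"
  shows "has_dir_deriv f (f' e) u e"
proof -
  have "((\<lambda>t::real. u + t *\<^sub>R e) has_derivative (\<lambda>t. t *\<^sub>R e)) (at 0)"
    by (auto intro!: derivative_eq_intros)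
  then have "((\<lambda>t::real. f (u + t *\<^sub>R e)) has_derivative (\<lambda>t. f' (t *\<^sub>R e))) (at 0)"
    using has_derivative_compose[of "\<lambda>t::real. u + t *\<^sub>R e" "\<lambda>t. t *\<^sub>R e" 0 UNIV f f'] assms by simp
  then show ?thesis
    using linear_cmul[OF has_derivative_linear[OF assms]] by (simp add: has_dir_deriv_def has_vector_derivative_def)
qed

lemma has_dir_deriv_tendsto:
  assumes "has_dir_deriv f f' u e"
  shows "((\<lambda>h. (f (u + h *\<^sub>R e) - f u) /\<^sub>R h) \<longlongrightarrow> f') (at 0)"
proof -
  have lim: "((\<lambda>h. norm (f (u + h *\<^sub>R e) - f u - h *\<^sub>R f') / norm h) \<longlongrightarrow> 0) (at 0)"
    using assms unfolding has_dir_deriv_def has_vector_derivative_def has_derivative_at by simp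
  have eq: "norm (f (u + h *\<^sub>R e) - f u - h *\<^sub>R f') / norm h = norm ((f (u + h *\<^sub>R e) - f u) /\<^sub>R h - f')" if "h \<noteq> 0" for h
  proof -
    have "(f (u + h *\<^sub>R e) - f u) /\<^sub>R h - f' = (f (u + h *\<^sub>R e) - f u - h *\<^sub>R f') /\<^sub>R h"
      using that by (simp add: scaleR_diff_right)
    then show ?thesis by (simp add: divide_inverse mult.commute)
  qed
  have ev: "\<forall>\<^sub>F h in at 0. norm (f (u + h *\<^sub>R e) - f u - h *\<^sub>R f') / norm h = norm ((f (u + h *\<^sub>R e) - f u) /\<^sub>R h - f')"
    unfolding eventually_at_filter using eq by (intro always_eventually) blast
  have "((\<lambda>h. norm ((f (u + h *\<^sub>R e) - f u) /\<^sub>R h - f')) \<longlongrightarrow> 0) (at 0)"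
    by (rule Lim_transform_eventually[OF lim ev])
  then show ?thesis by (simp add: tendsto_norm_zero_iff LIM_zero_iff)
qed

lemma has_dir_deriv_bound:
  assumes "\<And>u. has_dir_deriv f (f' u) u e" "\<And>u. norm (f' u) \<le> B"
  shows "norm (f (u + s *\<^sub>R e) - f (u + t *\<^sub>R e)) \<le> B * \<bar>s - t\<bar>"
proof -
  have "norm (f (u + s *\<^sub>R e) - f (u + t *\<^sub>R e)) \<le> B * norm (s - t)"
  proof (rule differentiable_bound[of UNIV "\<lambda>t. f (u + t *\<^sub>R e)" "\<lambda>x h. h *\<^sub>R f' (u + x *\<^sub>R e)"])
    show "((\<lambda>t. f (u + t *\<^sub>R e)) has_derivative (\<lambda>h. h *\<^sub>R f' (u + x *\<^sub>R e))) (at x within UNIV)" for x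
      using has_dir_deriv_shift[OF assms(1)] by (simp add: has_vector_derivative_def)
    show "onorm (\<lambda>h. h *\<^sub>R f' (u + x *\<^sub>R e)) \<le> B" for x
    proof (rule onorm_bound)
      show "0 \<le> B" using assms(2) norm_ge_zero order_trans by blast
      show "norm (h *\<^sub>R f' (u + x *\<^sub>R e)) \<le> B * norm h" for h
        using assms(2)[of "u + x *\<^sub>R e"] by (simp add: mult.commute[of B] mult_left_mono)
    qed
  qed auto
  then show ?thesis by simp
qed

lemma lborel_integral_shift:
  fixes g :: "'a::euclidean_space \<Rightarrow> 'b::{banach,second_countable_topology}"
  shows "(\<integral>u. g (u + c) \<partial>lborel) = (\<integral>u. g u \<partial>lborel)"
proof (cases "g \<in> borel_measurable borel")
  case True
  then have "(\<integral>u. g u \<partial>distr lborel borel ((+) c)) = (\<integral>u. g (c + u) \<partial>lborel)"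
    by (intro integral_distr) auto
  then show ?thesis by (simp add: lborel_distr_plus add.commute)
next
  \<comment> \<open>A translate of a nonmeasurable function is nonmeasurable, so both integrals take
    the default value 0.\<close>
  case False
  have "(\<lambda>u. g (u + c)) \<notin> borel_measurable borel"
  proof
    assume "(\<lambda>u. g (u + c)) \<in> borel_measurable borel"
    then have "(\<lambda>u. g ((u - c) + c)) \<in> borel_measurable borel"
      by (rule measurable_compose[rotated]) measurable
    with False show False by simp
  qed
  with False have "\<not> integrable lborel g" "\<not> integrable lborel (\<lambda>u. g (u + c))"
    using borel_measurable_integrable[of lborel g] borel_measurable_integrable[of lborel "\<lambda>u. g (u + c)"] by auto
  then show ?thesis by (simp add: not_integrable_integral_eq)
qed

lemma integrable_lborel_shift:
  fixes g :: "'a::euclidean_space \<Rightarrow> 'b::{banach,second_countable_topology}"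
  assumes "integrable lborel g"
  shows "integrable lborel (\<lambda>u. g (u + c))"
proof -
  have "integrable (distr lborel borel ((+) c)) g" using assms by (simp add: lborel_distr_plus)
  then show ?thesis using assms by (subst (asm) integrable_distr_eq) (auto simp: add.commute)
qed

text \<open>Translation invariance of Lebesgue measure makes the integral of each difference quotient vanish.\<close>

lemma integral_dir_deriv_zero:
  fixes g :: "'a::euclidean_space \<Rightarrow> complex"
  assumes d: "\<And>u. has_dir_deriv g (g' u) u e"
    and cont: "continuous_on UNIV g" "continuous_on UNIV g'"
    and supp: "bounded K" "\<And>u. u \<notin> K \<Longrightarrow> g u = 0"
    and bdd: "\<And>u. norm (g' u) \<le> B"
  shows "(\<integral>u. g' u \<partial>lborel) = 0"
proof -
  obtain R where R: "0 < R" "K \<subseteq> cball 0 R" using supp(1) by (meson bounded_subset_ballD order_trans ball_subset_cball)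
  have B0: "0 \<le> B" using bdd norm_ge_zero order_trans by blast
  define t :: "nat \<Rightarrow> real" where "t n = 1 / real (Suc n)" for n
  have t: "0 < t n" "t n \<le> 1" for n by (auto simp: t_def)
  have tl: "t \<longlonglongrightarrow> 0" unfolding t_def using LIMSEQ_inverse_real_of_nat by (simp add: inverse_eq_divide)
  define D where "D n u = (g (u + t n *\<^sub>R e) - g u) /\<^sub>R t n" for n u
  have [measurable]: "g \<in> borel_measurable borel" "g' \<in> borel_measurable borel"
    using cont by (auto intro: borel_measurable_continuous_onI)
  have gint: "integrable lborel g"
  proof -
    have "integrable lborel (\<lambda>u. indicator (cball 0 R) u *\<^sub>R g u)"
      by (rule borel_integrable_compact) (use cont in \<open>auto intro: continuous_on_subset\<close>)
    moreover have "g u = 0" if "u \<notin> cball 0 R" for u using that supp(2) R(2) by blast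
    then have "(\<lambda>u. indicator (cball 0 R) u *\<^sub>R g u) = g"
      by (intro ext) (auto simp: indicator_def simp del: mem_cball)
    ultimately show ?thesis by simp
  qed
  have D0: "(\<integral>u. D n u \<partial>lborel) = 0" for n
  proof -
    show ?thesis unfolding D_def
      using gint integrable_lborel_shift[OF gint] lborel_integral_shift[of g] by simp
  qed
  have "(\<lambda>n. \<integral>u. D n u \<partial>lborel) \<longlonglongrightarrow> (\<integral>u. g' u \<partial>lborel)"
  \<comment> \<open>The steps \<open>t n\<close> are at most 1, so all difference quotients vanish
    outside one ball of radius R + |e|; the mean value inequality bounds them by \<open>B\<close>
    inside.\<close>
  proof (rule integral_dominated_convergence[where w="\<lambda>u. B * indicator (cball 0 (R + norm e)) u"])
    show "integrable lborel (\<lambda>u. B * indicat_real (cball 0 (R + norm e)) u :: real)"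
      by (intro integrable_mult_right integrable_real_indicator) (auto simp: emeasure_lborel_cball_finite[unfolded infinity_ennreal_def])
    show "AE u in lborel. (\<lambda>n. D n u) \<longlonglongrightarrow> g' u"
    proof (rule AE_I2)
      fix u
      have "t n \<noteq> 0" for n using t(1)[of n] by simp
      then have "filterlim t (at 0) sequentially" using tl by (simp add: filterlim_at)
      from filterlim_compose[OF has_dir_deriv_tendsto[OF d] this]
      show "(\<lambda>n. D n u) \<longlonglongrightarrow> g' u" unfolding D_def .
    qed
    show "AE u in lborel. norm (D n u) \<le> B * indicator (cball 0 (R + norm e)) u" for n
    proof (rule AE_I2)
      fix u
      show "norm (D n u) \<le> B * indicator (cball 0 (R + norm e)) u"
      proof (cases "u \<in> cball 0 (R + norm e)")
        case True
        have "norm (g (u + t n *\<^sub>R e) - g (u + 0 *\<^sub>R e)) \<le> B * \<bar>t n - 0\<bar>"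
          using d bdd by (rule has_dir_deriv_bound)
        moreover have "norm (D n u) = norm (g (u + t n *\<^sub>R e) - g u) / t n"
          using t[of n] by (simp add: D_def divide_inverse mult.commute)
        ultimately show ?thesis using True t[of n] by (simp add: pos_divide_le_eq)
      next
        case False
        then have far: "R + norm e < norm u" by simp
        have te: "norm (t n *\<^sub>R e) \<le> norm e" using t[of n] by (simp add: mult_left_le_one_le)
        have KR: "norm x \<le> R" if "x \<in> K" for x using subsetD[OF R(2) that] by simp
        have "u \<notin> K" using far KR[of u] norm_ge_zero[of e] by linarith
        moreover have "u + t n *\<^sub>R e \<notin> K"
          using far te KR[of "u + t n *\<^sub>R e"] norm_diff_ineq[of u "t n *\<^sub>R e"] by linarith
        ultimately show ?thesis using False supp(2) by (simp add: D_def)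
      qed
    qed
    show "D n \<in> borel_measurable lborel" for n unfolding D_def by measurable
    show "g' \<in> borel_measurable lborel" by simp
  qed
  then show ?thesis using D0 by (simp add: LIMSEQ_const_iff)
qed

text \<open>Families of functions indexed by a parameter \<open>\<theta>\<close>, the \<open>\<theta>\<close>-th one living on the slice of \<open>D\<close> over \<open>\<theta>\<close>;
  the bounds are uniform in \<open>\<theta>\<close>, and \<open>dbdd N D e f\<close> controls \<open>N\<close> derivatives in the direction \<open>e \<theta>\<close>.\<close>

definition bdd_cont_on :: "('p \<times> 'a::real_normed_vector) set \<Rightarrow> ('p \<Rightarrow> 'a \<Rightarrow> real) \<Rightarrow> bool" where
  "bdd_cont_on D f \<longleftrightarrow> (\<exists>B. \<forall>\<theta> u. (\<theta>, u) \<in> D \<longrightarrow> \<bar>f \<theta> u\<bar> \<le> B) \<and> (\<forall>\<theta>. continuous_on {u. (\<theta>, u) \<in> D} (f \<theta>))"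

primrec dbdd :: "nat \<Rightarrow> ('p \<times> 'a::real_normed_vector) set \<Rightarrow> ('p \<Rightarrow> 'a) \<Rightarrow> ('p \<Rightarrow> 'a \<Rightarrow> real) \<Rightarrow> bool" where
  "dbdd 0 D e f \<longleftrightarrow> bdd_cont_on D f"
| "dbdd (Suc N) D e f \<longleftrightarrow> bdd_cont_on D f \<and>
     (\<exists>f'. (\<forall>\<theta> u. (\<theta>, u) \<in> D \<longrightarrow> has_dir_deriv (f \<theta>) (f' \<theta> u) u (e \<theta>)) \<and> dbdd N D e f')"

lemma bdd_cont_on_mult:
  assumes "bdd_cont_on D f" "bdd_cont_on D g"
  shows "bdd_cont_on D (\<lambda>\<theta> u. f \<theta> u * g \<theta> u)"
proof -
  obtain A B where AB: "\<And>\<theta> u. (\<theta>, u) \<in> D \<Longrightarrow> \<bar>f \<theta> u\<bar> \<le> A" "\<And>\<theta> u. (\<theta>, u) \<in> D \<Longrightarrow> \<bar>g \<theta> u\<bar> \<le> B"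
    using assms unfolding bdd_cont_on_def by blast
  have "\<bar>f \<theta> u * g \<theta> u\<bar> \<le> \<bar>A\<bar> * \<bar>B\<bar>" if "(\<theta>, u) \<in> D" for \<theta> u
    unfolding abs_mult using AB(1)[OF that] AB(2)[OF that] by (intro mult_mono) auto
  then show ?thesis using assms unfolding bdd_cont_on_def by (auto intro!: continuous_on_mult)
qed

lemma bdd_cont_on_add:
  assumes "bdd_cont_on D f" "bdd_cont_on D g"
  shows "bdd_cont_on D (\<lambda>\<theta> u. f \<theta> u + g \<theta> u)"
proof -
  obtain A B where AB: "\<And>\<theta> u. (\<theta>, u) \<in> D \<Longrightarrow> \<bar>f \<theta> u\<bar> \<le> A" "\<And>\<theta> u. (\<theta>, u) \<in> D \<Longrightarrow> \<bar>g \<theta> u\<bar> \<le> B"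
    using assms unfolding bdd_cont_on_def by blast
  have "\<bar>f \<theta> u + g \<theta> u\<bar> \<le> A + B" if "(\<theta>, u) \<in> D" for \<theta> u
    using AB(1)[OF that] AB(2)[OF that] by linarith
  then show ?thesis using assms unfolding bdd_cont_on_def by (auto intro!: continuous_on_add)
qed

lemma dbdd_imp_bdd_cont_on: "dbdd N D e f \<Longrightarrow> bdd_cont_on D f"
  by (cases N) auto

lemma dbdd_SucI:
  assumes "bdd_cont_on D f" "\<And>\<theta> u. (\<theta>, u) \<in> D \<Longrightarrow> has_dir_deriv (f \<theta>) (f' \<theta> u) u (e \<theta>)" "dbdd N D e f'"
  shows "dbdd (Suc N) D e f"
  using assms by auto

lemma dbdd_SucD: "dbdd (Suc N) D e f \<Longrightarrow> dbdd N D e f"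
  by (induction N arbitrary: f) (auto dest: dbdd_imp_bdd_cont_on)

lemma dbdd_add: "dbdd N D e f \<Longrightarrow> dbdd N D e g \<Longrightarrow> dbdd N D e (\<lambda>\<theta> u. f \<theta> u + g \<theta> u)"
proof (induction N arbitrary: f g)
  case 0 then show ?case by (auto intro: bdd_cont_on_add)
next
  case (Suc N)
  obtain f' g' where f': "\<And>\<theta> u. (\<theta>, u) \<in> D \<Longrightarrow> has_dir_deriv (f \<theta>) (f' \<theta> u) u (e \<theta>)" "dbdd N D e f'"
    and g': "\<And>\<theta> u. (\<theta>, u) \<in> D \<Longrightarrow> has_dir_deriv (g \<theta>) (g' \<theta> u) u (e \<theta>)" "dbdd N D e g'"
    using Suc.prems by auto
  have "\<And>\<theta> u. (\<theta>, u) \<in> D \<Longrightarrow> has_dir_deriv (\<lambda>u. f \<theta> u + g \<theta> u) (f' \<theta> u + g' \<theta> u) u (e \<theta>)"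
    using f'(1) g'(1) unfolding has_dir_deriv_def by (intro has_vector_derivative_add) auto
  then show ?case
    using Suc.IH[OF f'(2) g'(2)] Suc.prems
    by (auto intro!: bdd_cont_on_add exI[of _ "\<lambda>\<theta> u. f' \<theta> u + g' \<theta> u"])
qed

lemma dbdd_mult: "dbdd N D e f \<Longrightarrow> dbdd N D e g \<Longrightarrow> dbdd N D e (\<lambda>\<theta> u. f \<theta> u * g \<theta> u)"
proof (induction N arbitrary: f g)
  case 0 then show ?case by (auto intro: bdd_cont_on_mult)
next
  case (Suc N)
  obtain f' g' where f': "\<And>\<theta> u. (\<theta>, u) \<in> D \<Longrightarrow> has_dir_deriv (f \<theta>) (f' \<theta> u) u (e \<theta>)" "dbdd N D e f'"
    and g': "\<And>\<theta> u. (\<theta>, u) \<in> D \<Longrightarrow> has_dir_deriv (g \<theta>) (g' \<theta> u) u (e \<theta>)" "dbdd N D e g'"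
    using Suc.prems by auto
  have "dbdd N D e (\<lambda>\<theta> u. f \<theta> u * g' \<theta> u + f' \<theta> u * g \<theta> u)"
    using Suc.IH f'(2) g'(2) dbdd_SucD[OF Suc.prems(1)] dbdd_SucD[OF Suc.prems(2)] by (intro dbdd_add) auto
  moreover have "\<And>\<theta> u. (\<theta>, u) \<in> D \<Longrightarrow> has_dir_deriv (\<lambda>u. f \<theta> u * g \<theta> u) (f \<theta> u * g' \<theta> u + f' \<theta> u * g \<theta> u) u (e \<theta>)"
    using f'(1) g'(1) by (intro has_dir_deriv_mult) auto
  ultimately show ?case using Suc.prems
    by (auto intro!: bdd_cont_on_mult exI[of _ "\<lambda>\<theta> u. f \<theta> u * g' \<theta> u + f' \<theta> u * g \<theta> u"])
qed

lemma has_dir_deriv_const: "has_dir_deriv (\<lambda>u. c) 0 u e"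
  by (simp add: has_dir_deriv_def)

lemma dbdd_const: "dbdd N D e (\<lambda>\<theta> u. c)"
  by (induction N arbitrary: c)
    (auto simp: bdd_cont_on_def intro!: exI[of _ "\<lambda>\<theta> u. 0"] has_dir_deriv_const)

text \<open>The derivative -g' / g^2 involves 1/g again but is needed to one order less, so the
  induction closes. The lower bound \<open>c\<close> keeps all constants uniform in the
  parameter.\<close>

lemma dbdd_inverse:
  assumes "0 < c" "\<And>\<theta> u. (\<theta>, u) \<in> D \<Longrightarrow> c \<le> \<bar>g \<theta> u\<bar>"
  shows "dbdd N D e g \<Longrightarrow> dbdd N D e (\<lambda>\<theta> u. 1 / g \<theta> u)"
proof (induction N)
  case (Suc N)
  have nz: "g \<theta> u \<noteq> 0" if "(\<theta>, u) \<in> D" for \<theta> u using assms(1) assms(2)[OF that] by auto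
  have bc: "bdd_cont_on D (\<lambda>\<theta> u. 1 / g \<theta> u)" using Suc dbdd_SucD dbdd_imp_bdd_cont_on by blast
  obtain g' where g': "\<And>\<theta> u. (\<theta>, u) \<in> D \<Longrightarrow> has_dir_deriv (g \<theta>) (g' \<theta> u) u (e \<theta>)" "dbdd N D e g'"
    using Suc.prems by auto
  let ?d = "\<lambda>\<theta> u. (- 1 * g' \<theta> u) * (1 / g \<theta> u * (1 / g \<theta> u))"
  have i: "dbdd N D e (\<lambda>\<theta> u. 1 / g \<theta> u)" using Suc dbdd_SucD by blast
  have "dbdd N D e ?d" by (intro dbdd_mult i g' dbdd_const)
  moreover have "has_dir_deriv (\<lambda>u. 1 / g \<theta> u) (?d \<theta> u) u (e \<theta>)" if "(\<theta>, u) \<in> D" for \<theta> u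
    using has_dir_deriv_inverse[OF g'(1)[OF that] nz[OF that]] by simp
  ultimately show ?case by (intro dbdd_SucI[OF bc, where f'="?d"])
next
  case 0
  have nz: "g \<theta> u \<noteq> 0" if "(\<theta>, u) \<in> D" for \<theta> u using assms(1) assms(2)[OF that] by auto
  have "\<bar>1 / g \<theta> u\<bar> \<le> 1 / c" if "(\<theta>, u) \<in> D" for \<theta> u
    using assms(1) assms(2)[OF that] by (simp add: frac_le)
  then show ?case using 0 nz unfolding dbdd.simps bdd_cont_on_def by (auto intro!: continuous_on_divide)
qed

text \<open>For families whose successive derivatives are given explicitly as a sequence.\<close>

lemma dbdd_chain:
  assumes "\<And>k. bdd_cont_on D (F k)"
    and "\<And>k \<theta> u. (\<theta>, u) \<in> D \<Longrightarrow> has_dir_deriv (F k \<theta>) (F (Suc k) \<theta> u) u (e \<theta>)"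
  shows "dbdd N D e (F k)"
proof (induction N arbitrary: k)
  case (Suc N) then show ?case using assms by (auto intro!: exI[of _ "F (Suc k)"])
qed (simp add: assms)

lemma integral_bounded_on_ball:
  fixes f :: "'a::euclidean_space \<Rightarrow> 'b::{banach,second_countable_topology}"
  assumes "\<And>u. norm (f u) \<le> B" "\<And>u. u \<notin> cball x0 R \<Longrightarrow> f u = 0"
  shows "norm (\<integral>u. f u \<partial>lborel) \<le> B * measure lborel (cball x0 R)"
proof -
  have "norm (\<integral>u. f u \<partial>lborel) \<le> (\<integral>u. B * indicator (cball x0 R) u \<partial>lborel)"
  proof (rule norm_integral_le)
    show "integrable lborel (\<lambda>u. B * indicat_real (cball x0 R) u)"
      by (intro integrable_mult_right integrable_real_indicator) (auto simp: emeasure_lborel_cball_finite[unfolded infinity_ennreal_def])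
    show "norm (f u) \<le> B * indicator (cball x0 R) u" for u
      using assms by (cases "u \<in> cball x0 R") (auto simp del: mem_cball)
  qed
  then show ?thesis by simp
qed

text \<open>With p = q / \<open>\<Phi>1\<close>, the derivative of p
  cis(\<open>\<Lambda> \<Phi>\<close>) is p' cis(\<open>\<Lambda> \<Phi>\<close>) + i
  \<open>\<Lambda>\<close> q cis(\<open>\<Lambda> \<Phi>\<close>) and integrates to zero, which
  trades the integral for q against that for p' at a gain of one factor \<open>\<Lambda>\<close>. As
  p' inherits support and bounds, \<open>N\<close> rounds are possible, uniformly in the
  parameter.\<close>

lemma nonstationary_phase:
  fixes D :: "('p \<times> 'a::euclidean_space) set"
  assumes op: "\<And>\<theta>. open {u. (\<theta>, u) \<in> D}" and sub: "\<And>\<theta> u. (\<theta>, u) \<in> D \<Longrightarrow> u \<in> cball x0 R"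
    and K: "\<And>\<theta>. compact (K \<theta>)" "\<And>\<theta>. K \<theta> \<subseteq> {u. (\<theta>, u) \<in> D}"
    and ph: "\<And>\<theta> u. (\<theta>, u) \<in> D \<Longrightarrow> has_dir_deriv (\<Phi> \<theta>) (\<Phi>1 \<theta> u) u (e \<theta>)"
      "\<And>\<theta>. continuous_on {u. (\<theta>, u) \<in> D} (\<Phi> \<theta>)"
    and c: "0 < c" "\<And>\<theta> u. (\<theta>, u) \<in> D \<Longrightarrow> c \<le> \<bar>\<Phi>1 \<theta> u\<bar>"
  shows "dbdd N D e \<Phi>1 \<Longrightarrow> dbdd N D e q \<Longrightarrow> (\<And>\<theta> u. (\<theta>, u) \<in> D \<Longrightarrow> u \<notin> K \<theta> \<Longrightarrow> q \<theta> u = 0) \<Longrightarrow>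
    \<exists>C. \<forall>\<theta> \<Lambda>. 0 < \<Lambda> \<longrightarrow> cmod (\<integral>u. indicator {u. (\<theta>, u) \<in> D} u *\<^sub>R (of_real (q \<theta> u) * cis (\<Lambda> * \<Phi> \<theta> u)) \<partial>lborel) \<le> C / \<Lambda> ^ N"
proof (induction N arbitrary: q)
  case 0
  then obtain B where B: "\<And>\<theta> u. (\<theta>, u) \<in> D \<Longrightarrow> \<bar>q \<theta> u\<bar> \<le> B" unfolding dbdd.simps bdd_cont_on_def by blast
  have "cmod (\<integral>u. indicator {u. (\<theta>, u) \<in> D} u *\<^sub>R (of_real (q \<theta> u) * cis (\<Lambda> * \<Phi> \<theta> u)) \<partial>lborel) \<le> \<bar>B\<bar> * measure lborel (cball x0 R)" for \<theta> \<Lambda>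
    using B sub by (intro integral_bounded_on_ball) (fastforce simp: indicator_def norm_mult)+
  then show ?case by (intro exI[of _ "\<bar>B\<bar> * measure lborel (cball x0 R)"]) simp
next
  case (Suc N)
  define p where "p \<theta> u = q \<theta> u * (1 / \<Phi>1 \<theta> u)" for \<theta> u
  have dp: "dbdd (Suc N) D e p"
    unfolding p_def by (intro dbdd_mult Suc.prems dbdd_inverse[OF c] )
  then obtain p' where p': "\<And>\<theta> u. (\<theta>, u) \<in> D \<Longrightarrow> has_dir_deriv (p \<theta>) (p' \<theta> u) u (e \<theta>)" "dbdd N D e p'" by auto
  have p0: "p \<theta> u = 0" if "(\<theta>, u) \<in> D" "u \<notin> K \<theta>" for \<theta> u using Suc.prems(3)[OF that] by (simp add: p_def)
  have opK: "open ({u. (\<theta>, u) \<in> D} - K \<theta>)" for \<theta>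
    using op K(1) by (intro open_Diff compact_imp_closed)
  \<comment> \<open>Off the compact set p vanishes on an open set, hence so does its derivative;
    this is what lets the induction hypothesis be applied to p'.\<close>
  have p'0: "p' \<theta> u = 0" if "(\<theta>, u) \<in> D" "u \<notin> K \<theta>" for \<theta> u
    by (rule has_dir_deriv_unique_locally_0[OF p'(1)[OF that(1)] opK[of \<theta>]]) (use that p0 in auto)
  obtain C where C: "\<And>\<theta> \<Lambda>. 0 < \<Lambda> \<Longrightarrow> cmod (\<integral>u. indicator {u. (\<theta>, u) \<in> D} u *\<^sub>R (of_real (p' \<theta> u) * cis (\<Lambda> * \<Phi> \<theta> u)) \<partial>lborel) \<le> C / \<Lambda> ^ N"
    using Suc.IH[OF dbdd_SucD[OF Suc.prems(1)] p'(2) p'0] by blast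
  have "cmod (\<integral>u. indicator {u. (\<theta>, u) \<in> D} u *\<^sub>R (of_real (q \<theta> u) * cis (\<Lambda> * \<Phi> \<theta> u)) \<partial>lborel) \<le> C / \<Lambda> ^ Suc N" if L: "0 < \<Lambda>" for \<theta> \<Lambda>
  proof -
    let ?S = "{u. (\<theta>, u) \<in> D}"
    let ?c = "\<lambda>u. cis (\<Lambda> * \<Phi> \<theta> u)"
    let ?I = "\<lambda>f u. indicator ?S u *\<^sub>R (of_real (f u) * ?c u)"
    \<comment> \<open>Extension by zero stays continuous on the whole space: the slice and the
      complement of the compact support are open, cover everything, and the function is continuous
      on each.\<close>
    have ext: "continuous_on UNIV (?I f)" "integrable lborel (?I f)"
      if "continuous_on ?S f" "\<And>u. u \<in> ?S \<Longrightarrow> u \<notin> K \<theta> \<Longrightarrow> f u = 0" for f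
    proof -
      have "continuous_on ?S (\<lambda>u. of_real (f u) * ?c u)"
        using that(1) ph(2)[of \<theta>] by (intro continuous_intros)
      then have 1: "continuous_on ?S (?I f)" by (rule continuous_on_eq) auto
      have "continuous_on (- K \<theta>) (\<lambda>u. 0::complex)" by simp
      then have 2: "continuous_on (- K \<theta>) (?I f)"
        by (rule continuous_on_eq) (use that(2) in \<open>auto simp: indicator_def\<close>)
      have "continuous_on (?S \<union> - K \<theta>) (?I f)"
        by (rule continuous_on_open_Un[OF op _ 1 2]) (use K(1) compact_imp_closed in \<open>auto simp: open_Compl\<close>)
      moreover have "?S \<union> - K \<theta> = UNIV" using K(2) by blast
      ultimately show cont: "continuous_on UNIV (?I f)" by simp
      have "integrable lborel (\<lambda>u. indicator (K \<theta>) u *\<^sub>R ?I f u)"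
        by (rule borel_integrable_compact[OF K(1)]) (rule continuous_on_subset[OF cont], simp)
      also have "(\<lambda>u. indicator (K \<theta>) u *\<^sub>R ?I f u) = ?I f"
        using that(2) by (intro ext) (auto simp: indicator_def)
      finally show "integrable lborel (?I f)" .
    qed
    have cq: "continuous_on ?S (q \<theta>)" using Suc.prems(2) dbdd_imp_bdd_cont_on unfolding bdd_cont_on_def by blast
    have cp: "continuous_on ?S (p \<theta>)" using dp dbdd_imp_bdd_cont_on unfolding bdd_cont_on_def by blast
    have cp': "continuous_on ?S (p' \<theta>)" using p'(2) dbdd_imp_bdd_cont_on unfolding bdd_cont_on_def by blast
    define g' where "g' u = ?I (p' \<theta>) u + (\<i> * of_real \<Lambda>) * ?I (q \<theta>) u" for u
    have eq: "continuous_on UNIV (?I (q \<theta>))" "integrable lborel (?I (q \<theta>))"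
      by (rule ext; use cq Suc.prems(3) in auto)+
    have ep: "continuous_on UNIV (?I (p \<theta>))" by (rule ext) (use cp p0 in auto)
    have ep': "continuous_on UNIV (?I (p' \<theta>))" "integrable lborel (?I (p' \<theta>))"
      by (rule ext; use cp' p'0 in auto)+
    have cg': "continuous_on UNIV g'" unfolding g'_def by (intro continuous_intros eq ep')
    have g'0: "g' u = 0" if "u \<notin> K \<theta>" for u
      using that p'0 Suc.prems(3) by (auto simp: g'_def indicator_def)
    have "compact (g' ` K \<theta>)" by (intro compact_continuous_image K continuous_on_subset[OF cg']) auto
    then obtain B where B: "\<And>u. u \<in> K \<theta> \<Longrightarrow> norm (g' u) \<le> B" using compact_imp_bounded bounded_iff by (metis imageI)
    have zero: "(\<integral>u. g' u \<partial>lborel) = 0"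
    proof (rule integral_dir_deriv_zero[OF _ ep cg'])
      show "bounded (K \<theta>)" using K(1) compact_imp_bounded by blast
      show "?I (p \<theta>) u = 0" if "u \<notin> K \<theta>" for u using that p0 by (auto simp: indicator_def)
      show "norm (g' u) \<le> \<bar>B\<bar>" for u using B[of u] g'0[of u] by (cases "u \<in> K \<theta>") auto
      show "has_dir_deriv (?I (p \<theta>)) (g' u) u (e \<theta>)" for u
      proof (cases "u \<in> ?S")
        case True
        then have uD: "(\<theta>, u) \<in> D" by simp
        have 1: "has_dir_deriv (\<lambda>u. of_real (p \<theta> u) :: complex) (of_real (p' \<theta> u)) u (e \<theta>)"
          by (rule has_dir_deriv_bounded_linear[OF p'(1)[OF uD]]) (rule bounded_linear_of_real)
        have "has_dir_deriv (\<lambda>u. \<Lambda> * \<Phi> \<theta> u) (\<Lambda> * \<Phi>1 \<theta> u) u (e \<theta>)"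
          by (rule has_dir_deriv_bounded_linear[OF ph(1)[OF uD]]) (rule bounded_linear_mult_right)
        from has_dir_deriv_mult[OF 1 has_dir_deriv_cis[OF this]]
        have "has_dir_deriv (\<lambda>u. of_real (p \<theta> u) * ?c u) (of_real (p \<theta> u) * ((\<Lambda> * \<Phi>1 \<theta> u) *\<^sub>R (\<i> * ?c u)) + of_real (p' \<theta> u) * ?c u) u (e \<theta>)" .
        also have "of_real (p \<theta> u) * ((\<Lambda> * \<Phi>1 \<theta> u) *\<^sub>R (\<i> * ?c u)) + of_real (p' \<theta> u) * ?c u = g' u"
        proof -
          have "p \<theta> u * \<Phi>1 \<theta> u = q \<theta> u" using c(1) c(2)[OF uD] by (auto simp: p_def)
          then have "q \<theta> u = p \<theta> u * \<Phi>1 \<theta> u" by simp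
          then show ?thesis using True by (simp add: g'_def scaleR_conv_of_real mult_ac)
        qed
        finally show ?thesis
          using has_dir_deriv_cong_open[OF op True, of "?I (p \<theta>)" "\<lambda>u. of_real (p \<theta> u) * ?c u"] by simp
      next
        case False
        then have "u \<in> - K \<theta>" using K(2) by blast
        moreover have "open (- K \<theta>)" using compact_imp_closed[OF K(1)] by (rule open_Compl)
        ultimately have "has_dir_deriv (?I (p \<theta>)) 0 u (e \<theta>) \<longleftrightarrow> has_dir_deriv (\<lambda>u. 0::complex) 0 u (e \<theta>)"
          by (intro has_dir_deriv_cong_open) (use p0 in \<open>auto simp: indicator_def\<close>)
        then show ?thesis using g'0 \<open>u \<in> - K \<theta>\<close> has_dir_deriv_const by simp
      qed
    qed
    have split: "(\<integral>u. g' u \<partial>lborel) = (\<integral>u. ?I (p' \<theta>) u \<partial>lborel) + (\<i> * of_real \<Lambda>) * (\<integral>u. ?I (q \<theta>) u \<partial>lborel)"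
      unfolding g'_def using ep'(2) eq(2)
      by (subst Bochner_Integration.integral_add) (auto simp only: integral_mult_right_zero integrable_mult_right)
    have "(\<i> * of_real \<Lambda>) * (\<integral>u. ?I (q \<theta>) u \<partial>lborel) = - (\<integral>u. ?I (p' \<theta>) u \<partial>lborel)"
      by (rule iffD1[OF add_eq_0_iff]) (use zero split in argo)
    then have "cmod ((\<i> * of_real \<Lambda>) * (\<integral>u. ?I (q \<theta>) u \<partial>lborel)) = cmod (\<integral>u. ?I (p' \<theta>) u \<partial>lborel)" by simp
    then have "\<Lambda> * cmod (\<integral>u. ?I (q \<theta>) u \<partial>lborel) \<le> C / \<Lambda> ^ N" using C[OF L, of \<theta>] L by (simp add: norm_mult)
    then show ?thesis using L by (simp add: field_simps)
  qed
  then show ?case by blast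
qed

section \<open>Oscillatory integrals over a chart\<close>

lemma DERIV_max_0_power:
  assumes "1 \<le> k"
  shows "((\<lambda>x::real. max 0 x ^ Suc k) has_real_derivative real (Suc k) * max 0 x ^ k) (at x)"
proof -
  consider "0 < x" | "x < 0" | "x = 0" by linarith
  then show ?thesis
  proof cases
    case 1
    have "((\<lambda>x::real. x ^ Suc k) has_real_derivative real (Suc k) * x ^ k) (at x)"
      using DERIV_pow[of "Suc k" x] by simp
    then have "((\<lambda>x::real. max 0 x ^ Suc k) has_real_derivative real (Suc k) * x ^ k) (at x)"
      by (rule has_field_derivative_transform_within_open[where S="{0<..}"]) (use 1 in auto)
    then show ?thesis using 1 by simp
  next
    case 2
    have "((\<lambda>x::real. 0) has_real_derivative 0) (at x)" by simp
    then have "((\<lambda>x::real. max 0 x ^ Suc k) has_real_derivative 0) (at x)"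
      by (rule has_field_derivative_transform_within_open[where S="{..<0}"]) (use 2 in auto)
    moreover have "max 0 x ^ k = 0" using 2 assms by (simp add: zero_power)
    ultimately show ?thesis by (simp only: mult_zero_right)
  next
    case 3
    have lim: "((\<lambda>h::real. (max 0 (0 + h) ^ Suc k - max 0 0 ^ Suc k) / h) \<longlongrightarrow> 0) (at 0)"
    proof (rule Lim_null_comparison)
      show "((\<lambda>h::real. \<bar>h\<bar> ^ k) \<longlongrightarrow> 0) (at 0)"
        using assms by (auto intro!: tendsto_eq_intros simp: zero_power)
      have "norm ((max 0 (0 + h) ^ Suc k - max 0 0 ^ Suc k) / h) \<le> \<bar>h\<bar> ^ k" for h :: real
        by (cases "0 < h") (auto simp: max_def abs_mult)
      then show "\<forall>\<^sub>F h in at 0. norm ((max 0 (0 + h) ^ Suc k - max 0 0 ^ Suc k) / h) \<le> \<bar>h\<bar> ^ k" for h :: real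
        by (intro always_eventually) blast
    qed
    have zero: "real (Suc k) * max 0 x ^ k = 0" using 3 assms by (simp add: zero_power)
    show ?thesis unfolding zero unfolding DERIV_def 3 by (rule lim)
  qed
qed

lemma has_dir_deriv_real_comp:
  fixes g :: "'a::real_normed_vector \<Rightarrow> real"
  assumes "(F has_real_derivative F') (at (g u))" "has_dir_deriv g g' u e"
  shows "has_dir_deriv (\<lambda>u. F (g u)) (F' * g') u e"
  using DERIV_chain2[of F F' "\<lambda>t. g (u + t *\<^sub>R e)" 0 g' UNIV] assms
  by (simp add: has_dir_deriv_def has_real_derivative_iff_has_vector_derivative)

text \<open>A power of a truncated quadratic polynomial. Its differentiability along lines is
  governed by the exponent, and a directional derivative is a lower power times a linear factor, so
  all bounds come out by induction on the exponent.\<close>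

definition bump :: "'a::real_inner \<Rightarrow> real \<Rightarrow> nat \<Rightarrow> 'a \<Rightarrow> real" where
  "bump c \<rho> k u = max 0 (\<rho>\<^sup>2 - (norm (u - c))\<^sup>2) ^ k"

lemma bump_nonneg: "0 \<le> bump c \<rho> k u" by (simp add: bump_def)

lemma bump_le: "bump c \<rho> k u \<le> (\<rho>\<^sup>2) ^ k"
  unfolding bump_def by (intro power_mono) auto

lemma bump_eq_0: "1 \<le> k \<Longrightarrow> 0 \<le> \<rho> \<Longrightarrow> u \<notin> ball c \<rho> \<Longrightarrow> bump c \<rho> k u = 0"
  unfolding bump_def
  by (auto simp: max_def dist_norm norm_minus_commute power_mono not_less zero_power)

lemma bump_continuous: "continuous_on A (bump c \<rho> k)"
  unfolding bump_def by (intro continuous_intros)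

lemma bdd_cont_on_bump: "bdd_cont_on D (\<lambda>\<theta> u. bump c \<rho> k (u + v \<theta>))"
  unfolding bdd_cont_on_def
proof (intro conjI exI allI impI)
  show "\<bar>bump c \<rho> k (u + v \<theta>)\<bar> \<le> (\<rho>\<^sup>2) ^ k" for u \<theta>
    using bump_le[of c \<rho> k "u + v \<theta>"] bump_nonneg[of c \<rho> k "u + v \<theta>"] by simp
  show "continuous_on {u. (\<theta>, u) \<in> D} (\<lambda>u. bump c \<rho> k (u + v \<theta>))" for \<theta>
    by (rule continuous_on_compose2[OF bump_continuous[of UNIV]]) (auto intro!: continuous_on_add continuous_on_id continuous_on_const)
qed

text \<open>Every derivative lowers the exponent by one and adds a linear factor \<open>g1\<close>,
  hence the demand \<open>N + 1 \<le> k\<close>. The shift \<open>v \<theta>\<close> covers the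
  translated bump that squaring an integral produces.\<close>

lemma dbdd_bump:
  fixes D :: "('p \<times> 'a::euclidean_space) set"
  assumes e: "\<And>\<theta> u. (\<theta>, u) \<in> D \<Longrightarrow> norm (e \<theta>) \<le> 1"
    and R: "\<And>\<theta> u. (\<theta>, u) \<in> D \<Longrightarrow> norm (u + v \<theta> - c) \<le> R"
  shows "N + 1 \<le> k \<Longrightarrow> dbdd N D e (\<lambda>\<theta> u. bump c \<rho> k (u + v \<theta>))"
proof (induction N arbitrary: k)
  case 0
  then show ?case using bdd_cont_on_bump by simp
next
  case (Suc N)
  then obtain k' where k: "k = Suc k'" "N + 1 \<le> k'" "1 \<le> k'" by (cases k) auto
  have bc: "bdd_cont_on D (\<lambda>\<theta> u. bump c \<rho> k (u + v \<theta>))" by (rule bdd_cont_on_bump)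
  define g1 where "g1 \<theta> u = - 2 * ((u + v \<theta> - c) \<bullet> e \<theta>)" for \<theta> u
  have d0: "has_dir_deriv (\<lambda>u. \<rho>\<^sup>2 - (norm (u + v \<theta> - c))\<^sup>2) (g1 \<theta> u) u (e \<theta>)" for \<theta> u
  proof -
    have "((\<lambda>u. \<rho>\<^sup>2 - (u + v \<theta> - c) \<bullet> (u + v \<theta> - c)) has_derivative (\<lambda>h. - 2 * ((u + v \<theta> - c) \<bullet> h))) (at u)"
      by (auto intro!: derivative_eq_intros simp: inner_commute)
    from has_derivative_imp_dir_deriv[OF this, of "e \<theta>"] show ?thesis by (simp add: g1_def power2_norm_eq_inner)
  qed
  have d1: "has_dir_deriv (g1 \<theta>) (- 2 * (e \<theta> \<bullet> e \<theta>)) u (e \<theta>)" for \<theta> u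
  proof -
    have "((\<lambda>u. - 2 * ((u + v \<theta> - c) \<bullet> e \<theta>)) has_derivative (\<lambda>h. - 2 * (h \<bullet> e \<theta>))) (at u)"
      by (auto intro!: derivative_eq_intros)
    from has_derivative_imp_dir_deriv[OF this, of "e \<theta>"] show ?thesis unfolding g1_def[abs_def] by simp
  qed
  \<comment> \<open>The derivatives of the linear factor: the factor itself, a constant, then
    zeros.\<close>
  define F where "F n = (case n of 0 \<Rightarrow> g1 | Suc 0 \<Rightarrow> (\<lambda>\<theta> u. - 2 * (e \<theta> \<bullet> e \<theta>)) | _ \<Rightarrow> (\<lambda>\<theta> u. 0))" for n
  have "dbdd N D e (F 0)"
  proof (rule dbdd_chain)
    fix n \<theta> u
    show "has_dir_deriv (F n \<theta>) (F (Suc n) \<theta> u) u (e \<theta>)"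
      using d1[of \<theta> u] has_dir_deriv_const by (auto simp: F_def split: nat.split)
  next
    fix n
    have "\<bar>g1 \<theta> u\<bar> \<le> 2 * (\<bar>R\<bar> * 1)" if "(\<theta>, u) \<in> D" for \<theta> u
    proof -
      have "\<bar>(u + v \<theta> - c) \<bullet> e \<theta>\<bar> \<le> norm (u + v \<theta> - c) * norm (e \<theta>)" by (rule Cauchy_Schwarz_ineq2)
      also have "\<dots> \<le> \<bar>R\<bar> * 1" using R[OF that] e[OF that] by (intro mult_mono) auto
      finally show ?thesis by (simp add: g1_def abs_mult)
    qed
    then have 1: "bdd_cont_on D g1" unfolding bdd_cont_on_def g1_def by (auto intro!: continuous_intros)
    have "\<bar>- 2 * (e \<theta> \<bullet> e \<theta>)\<bar> \<le> 2" if "(\<theta>, u) \<in> D" for \<theta> u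
      using e[OF that] by (simp add: abs_square_le_1 flip: power2_norm_eq_inner)
    then have 2: "bdd_cont_on D (\<lambda>\<theta> u. - 2 * (e \<theta> \<bullet> e \<theta>))" unfolding bdd_cont_on_def by (intro conjI exI[of _ "2::real"]) (blast, simp)
    show "bdd_cont_on D (F n)" using 1 2 by (auto simp: F_def bdd_cont_on_def split: nat.split)
  qed
  then have g1: "dbdd N D e g1" by (simp add: F_def)
  let ?d = "\<lambda>\<theta> u. real k * bump c \<rho> k' (u + v \<theta>) * g1 \<theta> u"
  have "has_dir_deriv (\<lambda>u. bump c \<rho> k (u + v \<theta>)) (?d \<theta> u) u (e \<theta>)" for \<theta> u
    unfolding bump_def k(1)
    by (rule has_dir_deriv_real_comp[OF DERIV_max_0_power[OF k(3)] d0])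
  moreover have "dbdd N D e ?d" by (intro dbdd_mult dbdd_const g1 Suc.IH k)
  ultimately show ?case by (intro dbdd_SucI[OF bc, where f'="?d"])
qed

text \<open>The squared modulus is a double integral; writing one variable as the other plus v turns
  it into an integral over v of autocorrelations, which are then estimated one v at a time.\<close>

lemma integral_square_le:
  fixes A :: "'a::euclidean_space \<Rightarrow> complex" and g :: "'a \<Rightarrow> real"
  assumes A: "integrable lborel A" and g: "integrable lborel g"
    and le: "\<And>v. cmod (\<integral>u. A (u + v) * cnj (A u) \<partial>lborel) \<le> g v"
  shows "(cmod (\<integral>u. A u \<partial>lborel))\<^sup>2 \<le> (\<integral>v. g v \<partial>lborel)"
proof -
  have [measurable]: "A \<in> borel_measurable borel" using A by simp
  have [measurable]: "cnj \<in> borel_measurable borel" by (intro borel_measurable_continuous_onI continuous_intros)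
  let ?I = "\<integral>u. A u \<partial>lborel"
  have sh: "(\<integral>v. A (u + v) \<partial>lborel) = ?I" "integrable lborel (\<lambda>v. A (u + v))"
    "(\<integral>v. cmod (A (u + v)) \<partial>lborel) = (\<integral>u. cmod (A u) \<partial>lborel)" for u
    using lborel_integral_shift[of A u] integrable_lborel_shift[OF A, of u] lborel_integral_shift[of "\<lambda>u. cmod (A u)" u]
    by (simp_all add: add.commute)
  have int: "integrable (lborel \<Otimes>\<^sub>M lborel) (\<lambda>(u, v). A (u + v) * cnj (A u))"
  proof (rule lborel_pair.Fubini_integrable)
    have "(\<lambda>(u, v). A (u + v) * cnj (A u)) \<in> borel_measurable (borel \<Otimes>\<^sub>M borel)" by measurable
    then show "(\<lambda>(u, v). A (u + v) * cnj (A u)) \<in> borel_measurable (lborel \<Otimes>\<^sub>M lborel)" by (simp cong: measurable_cong_sets)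
    show "integrable lborel (\<lambda>u. \<integral>v. norm ((\<lambda>(u, v). A (u + v) * cnj (A u)) (u, v)) \<partial>lborel)"
      using A by (simp add: norm_mult sh)
    show "AE u in lborel. integrable lborel (\<lambda>v. (\<lambda>(u, v). A (u + v) * cnj (A u)) (u, v))"
      using sh(2) by simp
  qed
  have "(cmod ?I)\<^sup>2 = cmod (?I * cnj ?I)" by (simp add: norm_mult power2_eq_square)
  also have "?I * cnj ?I = (\<integral>u. ?I * cnj (A u) \<partial>lborel)" by simp
  also have "\<dots> = (\<integral>u. (\<integral>v. A (u + v) * cnj (A u) \<partial>lborel) \<partial>lborel)" by (simp add: sh)
  also have "\<dots> = (\<integral>v. (\<integral>u. A (u + v) * cnj (A u) \<partial>lborel) \<partial>lborel)"
    by (rule lborel_pair.Fubini_integral[OF int, symmetric])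
  also have "cmod \<dots> \<le> (\<integral>v. g v \<partial>lborel)" by (rule norm_integral_le[OF g le])
  finally show ?thesis .
qed

text \<open>The source of the factor \<open>\<Lambda>\<close> to the power -m: the profile splits
  into one-dimensional integrals, each scaled by 1 / \<open>\<Lambda>\<close>.\<close>

lemma integral_prod_1_plus_square:
  fixes \<Lambda> :: real
  assumes "0 < \<Lambda>"
  defines "\<kappa> \<equiv> (\<integral>x. 1 / (1 + (x::real)\<^sup>2) \<partial>lborel)"
  shows "integrable lborel (\<lambda>v::'a::euclidean_space. \<Prod>b\<in>Basis. 1 / (1 + (\<Lambda> * (v \<bullet> b))\<^sup>2))"
    and "(\<integral>v. (\<Prod>b\<in>Basis. 1 / (1 + (\<Lambda> * (v \<bullet> (b::'a)))\<^sup>2)) \<partial>lborel) = (\<kappa> / \<Lambda>) ^ DIM('a)"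
proof -
  have k0: "0 \<le> \<kappa>" unfolding \<kappa>_def by (intro Bochner_Integration.integral_nonneg) simp
  have 1: "(\<integral>\<^sup>+x. ennreal (1 / (1 + (\<Lambda> * x)\<^sup>2)) \<partial>lborel) = ennreal (\<kappa> / \<Lambda>)"
  proof -
    have "\<kappa> = \<bar>\<Lambda>\<bar> *\<^sub>R (\<integral>x. 1 / (1 + (0 + \<Lambda> * x)\<^sup>2) \<partial>lborel)"
      unfolding \<kappa>_def using assms(1) by (intro lborel_integral_real_affine) simp
    then have "(\<integral>x. 1 / (1 + (\<Lambda> * x)\<^sup>2) \<partial>lborel) = \<kappa> / \<Lambda>" using assms(1) by simp
    moreover have "integrable lborel (\<lambda>x. 1 / (1 + (\<Lambda> * x)\<^sup>2))"
      using lborel_integrable_real_affine[OF integrable_inverse_1_plus_square_lborel, of \<Lambda> 0] assms(1) by simp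
    ultimately show ?thesis by (subst nn_integral_eq_integral) auto
  qed
  have "(\<integral>\<^sup>+v. ennreal (\<Prod>b\<in>Basis. 1 / (1 + (\<Lambda> * (v \<bullet> (b::'a)))\<^sup>2)) \<partial>lborel)
      = (\<integral>\<^sup>+v. (\<Prod>b\<in>Basis. ennreal (1 / (1 + (\<Lambda> * (v \<bullet> (b::'a)))\<^sup>2))) \<partial>lborel)"
    by (intro nn_integral_cong) (simp add: prod_ennreal)
  also have "\<dots> = (\<Prod>b\<in>(Basis::'a set). (\<integral>\<^sup>+x. ennreal (1 / (1 + (\<Lambda> * x)\<^sup>2)) \<partial>lborel))"
    by (rule nn_integral_lborel_prod) auto
  also have "\<dots> = ennreal ((\<kappa> / \<Lambda>) ^ DIM('a))"
    unfolding 1 using k0 assms(1) by (simp add: ennreal_power)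
  finally have nn: "(\<integral>\<^sup>+v. ennreal (\<Prod>b\<in>Basis. 1 / (1 + (\<Lambda> * (v \<bullet> (b::'a)))\<^sup>2)) \<partial>lborel) = ennreal ((\<kappa> / \<Lambda>) ^ DIM('a))" .
  have "has_bochner_integral lborel (\<lambda>v. \<Prod>b\<in>Basis. 1 / (1 + (\<Lambda> * (v \<bullet> (b::'a)))\<^sup>2)) ((\<kappa> / \<Lambda>) ^ DIM('a))"
    by (rule has_bochner_integral_nn_integral[OF _ _ _ nn]) (use k0 assms(1) in \<open>auto intro!: prod_nonneg\<close>)
  then show "integrable lborel (\<lambda>v::'a::euclidean_space. \<Prod>b\<in>Basis. 1 / (1 + (\<Lambda> * (v \<bullet> b))\<^sup>2))"
    "(\<integral>v. (\<Prod>b\<in>Basis. 1 / (1 + (\<Lambda> * (v \<bullet> (b::'a)))\<^sup>2)) \<partial>lborel) = (\<kappa> / \<Lambda>) ^ DIM('a)"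
    by (auto simp: has_bochner_integral_iff)
qed

text \<open>The product of the denominators is at most (1 + t^2)^m with t = \<open>\<Lambda>\<close>
  |v|, so decay of order 2m in t yields an integrable majorant. This fixes the number 2m of
  integrations by parts and with it the bump exponent 2m + 1.\<close>

lemma le_prod_1_plus_square:
  fixes v :: "'a::euclidean_space"
  assumes "0 < \<Lambda>" "0 \<le> C" "0 \<le> x" "x \<le> C" "v \<noteq> 0 \<Longrightarrow> x \<le> C / (\<Lambda> * norm v) ^ (2 * DIM('a))"
  shows "x \<le> C * 2 ^ DIM('a) * (\<Prod>b\<in>Basis. 1 / (1 + (\<Lambda> * (v \<bullet> b))\<^sup>2))"
proof -
  let ?m = "DIM('a)" and ?t = "\<Lambda> * norm v"
  let ?P = "\<Prod>b\<in>(Basis::'a set). (1 + (\<Lambda> * (v \<bullet> b))\<^sup>2)"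
  have P1: "0 < ?P" by (intro prod_pos) (auto simp: add_pos_nonneg)
  have "?P \<le> (\<Prod>b\<in>(Basis::'a set). (1 + ?t\<^sup>2))"
  proof (intro prod_mono conjI add_left_mono)
    fix b :: 'a assume "b \<in> Basis"
    then have "\<bar>\<Lambda> * (v \<bullet> b)\<bar> \<le> ?t" using assms(1) by (simp add: abs_mult Basis_le_norm)
    then show "(\<Lambda> * (v \<bullet> b))\<^sup>2 \<le> ?t\<^sup>2" using abs_le_square_iff[of "\<Lambda> * (v \<bullet> b)" ?t] by linarith
  qed simp
  then have P2: "?P \<le> (1 + ?t\<^sup>2) ^ ?m" by simp
  have "x * ?P \<le> C * 2 ^ ?m"
  \<comment> \<open>For |v| below 1 / \<open>\<Lambda>\<close> the trivial bound is used, above it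
    the decay.\<close>
  proof (cases "?t \<le> 1")
    case True
    then have "(1 + ?t\<^sup>2) ^ ?m \<le> 2 ^ ?m" using assms(1) by (intro power_mono) (auto simp: abs_square_le_1)
    then have "?P \<le> 2 ^ ?m" using P2 by linarith
    then show ?thesis using assms P1 by (intro mult_mono) auto
  next
    case False
    then have v: "v \<noteq> 0" by auto
    have "(1 + ?t\<^sup>2) ^ ?m \<le> (2 * ?t\<^sup>2) ^ ?m" using False one_le_power[of ?t 2] by (intro power_mono) auto
    also have "\<dots> = 2 ^ ?m * ?t ^ (2 * ?m)" by (simp add: power_mult_distrib power_mult)
    finally have "?P \<le> 2 ^ ?m * ?t ^ (2 * ?m)" using P2 by linarith
    then have "x * ?P \<le> (C / ?t ^ (2 * ?m)) * (2 ^ ?m * ?t ^ (2 * ?m))"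
      using assms(5)[OF v] assms(2,3) P1 False by (intro mult_mono) auto
    then show ?thesis using v assms(1) by simp
  qed
  then have "x \<le> C * 2 ^ ?m / ?P" using P1 by (simp add: pos_le_divide_eq)
  then show ?thesis by (simp add: prod_dividef)
qed

lemma smooth_on_bounded:
  fixes f :: "real^'m::finite \<Rightarrow> 'b::real_normed_vector"
  assumes sm: "smooth_on V f" and sub: "cball u0 r \<subseteq> V"
  shows "\<exists>B. \<forall>u\<in>cball u0 r. norm (foldr partial is f u) \<le> B"
proof -
  have "compact (foldr partial is f ` cball u0 r)"
    by (intro compact_continuous_image continuous_on_subset[OF smooth_on_continuous[OF sm] sub]) simp
  then show ?thesis using compact_imp_bounded bounded_iff by (metis imageI)
qed

lemma smooth_on_lipschitz:
  fixes f :: "real^'m::finite \<Rightarrow> 'b::real_normed_vector"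
  assumes sm: "smooth_on V f" and V: "open V" and sub: "cball u0 r \<subseteq> V"
  shows "\<exists>B. \<forall>u\<in>cball u0 r. \<forall>w\<in>cball u0 r. norm (foldr partial is f u - foldr partial is f w) \<le> B * norm (u - w)"
proof -
  have "\<forall>j. \<exists>B. \<forall>u\<in>cball u0 r. norm (foldr partial (j # is) f u) \<le> B" using smooth_on_bounded[OF sm sub] by blast
  then obtain B where B: "\<And>j u. u \<in> cball u0 r \<Longrightarrow> norm (foldr partial (j # is) f u) \<le> B j" by metis
  define b where "b = (\<Sum>j\<in>UNIV. \<bar>B j\<bar>)"
  have bb: "norm (partial j (foldr partial is f) u - 0) \<le> b" if "u \<in> cball u0 r" for j u
  proof -
    have "norm (partial j (foldr partial is f) u) \<le> \<bar>B j\<bar>" using B[OF that, of j] by simp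
    also have "\<dots> \<le> b" unfolding b_def by (rule member_le_sum) auto
    finally show ?thesis by simp
  qed
  have "norm (foldr partial is f u - foldr partial is f w) \<le> CARD('m) * b * norm (u - w)"
    if uw: "u \<in> cball u0 r" "w \<in> cball u0 r" for u w
  proof -
    have "norm (foldr partial is f u - foldr partial is f w - (\<Sum>i\<in>UNIV. (u - w) $ i *\<^sub>R 0)) \<le> CARD('m) * b * norm (u - w)"
      by (rule partials_close_bound[OF convex_cball _ bb uw]) (use smooth_on_differentiable[OF sm V] sub in auto)
    then show ?thesis by simp
  qed
  then show ?thesis by blast
qed

lemma smooth_on_dir_deriv:
  fixes f :: "real^'m::finite \<Rightarrow> 'b::real_normed_vector"
  assumes "smooth_on V f" "open V" "u \<in> V"
  shows "has_dir_deriv (foldr partial is f) (foldr partial (i # is) f u) u (axis i 1)"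
proof -
  have "(foldr partial is f has_derivative frechet_derivative (foldr partial is f) (at u)) (at u)"
    using smooth_on_differentiable[OF assms] by (simp add: frechet_derivative_works)
  from has_derivative_imp_dir_deriv[OF this, of "axis i 1"] show ?thesis by (simp add: partial_def)
qed

lemma has_dir_deriv_translate:
  assumes "has_dir_deriv f f' (u + v) e"
  shows "has_dir_deriv (\<lambda>u. f (u + v)) f' u e"
  using assms by (simp add: has_dir_deriv_def add_ac)

lemma has_dir_deriv_diff:
  assumes "has_dir_deriv f f' u e" "has_dir_deriv g g' u e"
  shows "has_dir_deriv (\<lambda>u. f u - g u) (f' - g') u e"
  using assms unfolding has_dir_deriv_def by (intro has_vector_derivative_diff)

section \<open>Decay of the surface integral away from the normal directions and near them\<close>

lemma bump_phase_integral_le: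
  assumes "0 < \<rho>" "1 \<le> k"
  shows "cmod (\<integral>u. of_real (bump u0 \<rho> k u * bump u0 \<rho> k (u + v)) * cis (f u) \<partial>lborel) \<le> (\<rho>\<^sup>2) ^ k * (\<rho>\<^sup>2) ^ k * measure lborel (cball u0 \<rho>)"
proof (rule integral_bounded_on_ball)
  fix u
  have "\<bar>bump u0 \<rho> k u\<bar> * \<bar>bump u0 \<rho> k (u + v)\<bar> \<le> (\<rho>\<^sup>2) ^ k * (\<rho>\<^sup>2) ^ k"
    using bump_le bump_nonneg by (intro mult_mono) (auto simp: abs_of_nonneg[OF bump_nonneg])
  then show "norm (of_real (bump u0 \<rho> k u * bump u0 \<rho> k (u + v)) * cis (f u)) \<le> (\<rho>\<^sup>2) ^ k * (\<rho>\<^sup>2) ^ k"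
    by (simp add: norm_mult)
  assume "u \<notin> cball u0 \<rho>"
  then have "bump u0 \<rho> k u = 0" using assms by (intro bump_eq_0) auto
  then show "of_real (bump u0 \<rho> k u * bump u0 \<rho> k (u + v)) * cis (f u) = 0" by simp
qed

lemma bump_cis_integrable:
  fixes f :: "'a::euclidean_space \<Rightarrow> real"
  assumes "0 < \<rho>" "1 \<le> k" "continuous_on (cball u0 \<rho>) f"
  shows "integrable lborel (\<lambda>u. of_real (bump u0 \<rho> k u) * cis (f u))"
proof -
  have "integrable lborel (\<lambda>u. indicator (cball u0 \<rho>) u *\<^sub>R (of_real (bump u0 \<rho> k u) * cis (f u)))"
    using assms(3) by (intro borel_integrable_compact continuous_intros bump_continuous compact_cball)
  also have "(\<lambda>u. indicator (cball u0 \<rho>) u *\<^sub>R (of_real (bump u0 \<rho> k u) * cis (f u))) = (\<lambda>u. of_real (bump u0 \<rho> k u) * cis (f u))"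
  proof
    fix u
    show "indicator (cball u0 \<rho>) u *\<^sub>R (of_real (bump u0 \<rho> k u) * cis (f u)) = of_real (bump u0 \<rho> k u) * cis (f u)"
      using bump_eq_0[OF assms(2), of \<rho> u u0] assms(1) by (cases "u \<in> cball u0 \<rho>") auto
  qed
  finally show ?thesis .
qed

text \<open>The direction of integration may depend on \<open>\<omega>\<close>, so the parameter is
  the pair of \<open>\<omega>\<close> and a coordinate i along which the phase is steep on the whole
  ball. One constant then serves all such directions.\<close>

lemma nonstationary_decay:
  fixes \<phi> :: "real^'m::finite \<Rightarrow> real^'n::finite"
  assumes sm: "smooth_on V \<phi>" and V: "open V" and sub: "cball u0 \<rho>2 \<subseteq> V" and \<rho>: "0 < \<rho>" "\<rho> < \<rho>2" and c: "0 < c"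
  shows "\<exists>C. \<forall>\<omega> \<Lambda>. norm \<omega> = 1 \<longrightarrow> (\<exists>i. \<forall>u\<in>ball u0 \<rho>2. c \<le> \<bar>partial i \<phi> u \<bullet> \<omega>\<bar>) \<longrightarrow> 0 < \<Lambda> \<longrightarrow>
    cmod (\<integral>u. of_real (bump u0 \<rho> (Suc N) u) * cis (\<Lambda> * (\<phi> u \<bullet> \<omega>)) \<partial>lborel) \<le> C / \<Lambda> ^ N"
proof -
  define good where "good \<omega> i \<longleftrightarrow> norm \<omega> = 1 \<and> (\<forall>u\<in>ball u0 \<rho>2. c \<le> \<bar>partial i \<phi> u \<bullet> \<omega>\<bar>)" for \<omega> :: "real^'n" and i :: 'm
  \<comment> \<open>Parameters that are not \<open>good\<close> get an empty slice, so every
    hypothesis of the phase lemma holds vacuously for them.\<close>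
  define D where "D = {((\<omega>, i), u). good \<omega> i \<and> u \<in> ball u0 \<rho>2}"
  define e where "e = (\<lambda>(\<omega>::real^'n, i::'m). axis i 1 :: real^'m)"
  define F where "F k = (\<lambda>(\<omega>, i) u. foldr partial (replicate k i) \<phi> u \<bullet> \<omega>)" for k
  define q where "q = (\<lambda>(\<theta>::(real^'n) \<times> 'm) u. bump u0 \<rho> (Suc N) (u + 0))"
  have slice: "{u. (\<theta>, u) \<in> D} = (if good (fst \<theta>) (snd \<theta>) then ball u0 \<rho>2 else {})" for \<theta>
    by (cases \<theta>) (auto simp: D_def)
  have inV: "u \<in> V" if "u \<in> ball u0 \<rho>2" for u using that sub by auto
  have cF: "continuous_on {u. (\<theta>, u) \<in> D} (F k \<theta>)" for \<theta> k
  proof -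
    obtain \<omega> i where \<theta>: "\<theta> = (\<omega>, i)" by (cases \<theta>)
    have "continuous_on {u. (\<theta>, u) \<in> D} (foldr partial (replicate k i) \<phi>)"
      by (rule continuous_on_subset[OF smooth_on_continuous[OF sm]]) (use inV in \<open>auto simp: D_def\<close>)
    then show ?thesis unfolding F_def \<theta> prod.case by (intro continuous_intros)
  qed
  have bF: "bdd_cont_on D (F k)" for k
  proof -
    have "\<forall>i. \<exists>B. \<forall>u\<in>cball u0 \<rho>2. norm (foldr partial (replicate k i) \<phi> u) \<le> B"
      using smooth_on_bounded[OF sm sub] by blast
    then obtain B where B: "\<And>i u. u \<in> cball u0 \<rho>2 \<Longrightarrow> norm (foldr partial (replicate k i) \<phi> u) \<le> B i" by metis
    have "\<bar>F k \<theta> u\<bar> \<le> (\<Sum>i\<in>UNIV. \<bar>B i\<bar>)" if D: "(\<theta>, u) \<in> D" for \<theta> u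
    proof -
      obtain \<omega> i where \<theta>: "\<theta> = (\<omega>, i)" by (cases \<theta>)
      have "\<bar>foldr partial (replicate k i) \<phi> u \<bullet> \<omega>\<bar> \<le> norm (foldr partial (replicate k i) \<phi> u) * norm \<omega>" by (rule Cauchy_Schwarz_ineq2)
      also have "\<dots> \<le> \<bar>B i\<bar>" using B[of u i] D by (auto simp: \<theta> D_def good_def)
      also have "\<dots> \<le> (\<Sum>i\<in>UNIV. \<bar>B i\<bar>)" by (rule member_le_sum) auto
      finally show ?thesis by (simp add: F_def \<theta>)
    qed
    then show ?thesis unfolding bdd_cont_on_def using cF by blast
  qed
  have dF: "has_dir_deriv (F k \<theta>) (F (Suc k) \<theta> u) u (e \<theta>)" if D: "(\<theta>, u) \<in> D" for k \<theta> u
  proof -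
    obtain \<omega> i where \<theta>: "\<theta> = (\<omega>, i)" by (cases \<theta>)
    have "u \<in> V" using D inV by (auto simp: \<theta> D_def)
    from has_dir_deriv_bounded_linear[OF smooth_on_dir_deriv[OF sm V this, of "replicate k i" i] bounded_linear_inner_left[of \<omega>]]
    show ?thesis by (simp add: F_def \<theta> e_def)
  qed
  have "\<exists>C. \<forall>\<theta> \<Lambda>. 0 < \<Lambda> \<longrightarrow> cmod (\<integral>u. indicator {u. (\<theta>, u) \<in> D} u *\<^sub>R (of_real (q \<theta> u) * cis (\<Lambda> * F 0 \<theta> u)) \<partial>lborel) \<le> C / \<Lambda> ^ N"
  proof (rule nonstationary_phase[where e=e and ?\<Phi>1.0="F 1" and c=c and R=\<rho>2 and K="\<lambda>\<theta>. if good (fst \<theta>) (snd \<theta>) then cball u0 \<rho> else {}"])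
    show "open {u. (\<theta>, u) \<in> D}" for \<theta> unfolding slice by simp
    show "u \<in> cball u0 \<rho>2" if "(\<theta>, u) \<in> D" for \<theta> u using that by (auto simp: D_def)
    show "(if good (fst \<theta>) (snd \<theta>) then cball u0 \<rho> else {}) \<subseteq> {u. (\<theta>, u) \<in> D}" for \<theta>
      unfolding slice using \<rho> by auto
    show "has_dir_deriv (F 0 \<theta>) (F 1 \<theta> u) u (e \<theta>)" if "(\<theta>, u) \<in> D" for \<theta> u
      using dF[OF that, of 0] by simp
    show "c \<le> \<bar>F 1 \<theta> u\<bar>" if "(\<theta>, u) \<in> D" for \<theta> u
      using that by (auto simp: D_def F_def good_def)
    show "dbdd N D e (F 1)" by (rule dbdd_chain[where F=F and k=1]) (use bF dF in auto)
    show "dbdd N D e q" unfolding q_def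
      by (rule dbdd_bump[where R=\<rho>2]) (auto simp: D_def e_def dist_norm norm_minus_commute)
    show "q \<theta> u = 0" if "(\<theta>, u) \<in> D" "u \<notin> (if good (fst \<theta>) (snd \<theta>) then cball u0 \<rho> else {})" for \<theta> u
      using that \<rho> by (auto simp: q_def D_def intro!: bump_eq_0)
  qed (use c cF in auto)
  then obtain C where C: "\<And>\<theta> \<Lambda>. 0 < \<Lambda> \<Longrightarrow> cmod (\<integral>u. indicator {u. (\<theta>, u) \<in> D} u *\<^sub>R (of_real (q \<theta> u) * cis (\<Lambda> * F 0 \<theta> u)) \<partial>lborel) \<le> C / \<Lambda> ^ N"
    by blast
  show ?thesis
  proof (intro exI allI impI)
    fix \<omega> :: "real^'n" and \<Lambda> :: real
    assume "norm \<omega> = 1" "\<exists>i. \<forall>u\<in>ball u0 \<rho>2. c \<le> \<bar>partial i \<phi> u \<bullet> \<omega>\<bar>" and L: "0 < \<Lambda>"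
    then obtain i where g: "good \<omega> i" by (auto simp: good_def)
    have "of_real (bump u0 \<rho> (Suc N) u) * cis (\<Lambda> * (\<phi> u \<bullet> \<omega>)) = indicator {u. ((\<omega>, i), u) \<in> D} u *\<^sub>R (of_real (q (\<omega>, i) u) * cis (\<Lambda> * F 0 (\<omega>, i) u))" for u
      using bump_eq_0[of "Suc N" \<rho> u u0] g \<rho> unfolding slice by (cases "u \<in> ball u0 \<rho>2") (auto simp: q_def F_def)
    then show "cmod (\<integral>u. of_real (bump u0 \<rho> (Suc N) u) * cis (\<Lambda> * (\<phi> u \<bullet> \<omega>)) \<partial>lborel) \<le> C / \<Lambda> ^ N"
      using C[OF L, of "(\<omega>, i)"] by simp
  qed
qed

text \<open>After squaring, the correlation at v has phase (\<open>\<phi>\<close>(u+v) -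
  \<open>\<phi>\<close>(u)) paired with \<open>\<omega>\<close>, without stationary points.
  Nonstationary phase gives (\<open>\<Lambda>\<close> |v|)^(-2m) for it, and integration over v
  gives the claim.\<close>

lemma stationary_decay:
  fixes \<phi> :: "real^'m::finite \<Rightarrow> real^'n::finite"
  assumes sm: "smooth_on V \<phi>" and V: "open V" and sub: "cball u0 \<rho>2 \<subseteq> V" and \<rho>: "0 < \<rho>" "\<rho> < \<rho>2" and c: "0 < c"
    and ph: "\<And>v. \<exists>i. \<forall>\<omega> u. \<omega> \<in> W \<longrightarrow> u \<in> cball u0 \<rho>2 \<longrightarrow> u + v \<in> cball u0 \<rho>2 \<longrightarrow>
      c * norm v \<le> \<bar>(partial i \<phi> (u + v) - partial i \<phi> u) \<bullet> \<omega>\<bar>"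
    and W: "\<And>\<omega>. \<omega> \<in> W \<Longrightarrow> norm \<omega> = 1"
  shows "\<exists>C\<ge>0. \<forall>\<omega>\<in>W. \<forall>\<Lambda>>0.
    (cmod (\<integral>u. of_real (bump u0 \<rho> (2 * CARD('m) + 1) u) * cis (\<Lambda> * (\<phi> u \<bullet> \<omega>)) \<partial>lborel))\<^sup>2 \<le> C / \<Lambda> ^ CARD('m)"
proof -
  let ?N = "2 * CARD('m)"
  let ?b = "bump u0 \<rho> (?N + 1) :: real^'m \<Rightarrow> real"
  define good where "good v \<omega> i \<longleftrightarrow> v \<noteq> 0 \<and> \<omega> \<in> W \<and> (\<forall>u. u \<in> cball u0 \<rho>2 \<longrightarrow> u + v \<in> cball u0 \<rho>2 \<longrightarrow>
      c * norm v \<le> \<bar>(partial i \<phi> (u + v) - partial i \<phi> u) \<bullet> \<omega>\<bar>)" for v :: "real^'m" and \<omega> :: "real^'n" and i :: 'm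
  define D where "D = {((v, \<omega>, i), u). good v \<omega> i \<and> u \<in> ball u0 \<rho>2 \<and> u + v \<in> ball u0 \<rho>2}"
  define e where "e = (\<lambda>(v::real^'m, \<omega>::real^'n, i::'m). axis i 1 :: real^'m)"
  \<comment> \<open>Dividing by |v| and using \<open>\<Lambda>\<close> |v| as the large parameter
    makes the family uniform in v: the Lipschitz bounds of the partial derivatives control all
    \<open>F k\<close>, and the hypothesis \<open>ph\<close> bounds \<open>F 1\<close> from
    below.\<close>
  define F where "F k = (\<lambda>(v, \<omega>, i) u. ((foldr partial (replicate k i) \<phi> (u + v) - foldr partial (replicate k i) \<phi> u) \<bullet> \<omega>) * (1 / norm v))" for k
  define q where "q = (\<lambda>(v, \<omega>::real^'n, i::'m) u. ?b (u + 0) * ?b (u + v))"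
  \<comment> \<open>Both the bump and its translate have to be nonzero, so the support is an
    intersection of two balls.\<close>
  define K where "K = (\<lambda>(v, \<omega>, i). if good v \<omega> i then cball u0 \<rho> \<inter> cball (u0 - v) \<rho> else {})"
  have sh: "u + v \<in> ball u0 r \<longleftrightarrow> u \<in> ball (u0 - v) r" "u + v \<in> cball u0 r \<longleftrightarrow> u \<in> cball (u0 - v) r" for u v :: "real^'m" and r
    by (auto simp: dist_norm algebra_simps)
  have slice: "{u. ((v, \<omega>, i), u) \<in> D} = (if good v \<omega> i then ball u0 \<rho>2 \<inter> ball (u0 - v) \<rho>2 else {})" for v \<omega> i
    unfolding D_def using sh(1) by auto
  have inV: "u \<in> V" if "u \<in> ball u0 \<rho>2" for u using that sub by auto
  have cF: "continuous_on {u. (\<theta>, u) \<in> D} (F k \<theta>)" for \<theta> k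
  proof -
    obtain v \<omega> i where \<theta>: "\<theta> = (v, \<omega>, i)" by (cases \<theta>)
    let ?P = "foldr partial (replicate k i) \<phi>"
    have P: "continuous_on (ball u0 \<rho>2) ?P" by (rule continuous_on_subset[OF smooth_on_continuous[OF sm]]) (use inV in blast)
    have "continuous_on {u. (\<theta>, u) \<in> D} ?P" by (rule continuous_on_subset[OF P]) (auto simp: D_def \<theta>)
    moreover have "continuous_on {u. (\<theta>, u) \<in> D} (\<lambda>u. ?P (u + v))"
      by (rule continuous_on_compose2[OF P]) (auto simp: D_def \<theta> intro!: continuous_intros)
    ultimately show ?thesis unfolding F_def \<theta> prod.case by (intro continuous_intros)
  qed
  have bF: "bdd_cont_on D (F k)" for k
  proof -
    have "\<forall>i. \<exists>B. \<forall>u\<in>cball u0 \<rho>2. \<forall>w\<in>cball u0 \<rho>2. norm (foldr partial (replicate k i) \<phi> u - foldr partial (replicate k i) \<phi> w) \<le> B * norm (u - w)"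
      using smooth_on_lipschitz[OF sm V sub] by blast
    then obtain B where B: "\<And>i u w. u \<in> cball u0 \<rho>2 \<Longrightarrow> w \<in> cball u0 \<rho>2 \<Longrightarrow> norm (foldr partial (replicate k i) \<phi> u - foldr partial (replicate k i) \<phi> w) \<le> B i * norm (u - w)" by metis
    have "\<bar>F k \<theta> u\<bar> \<le> (\<Sum>i\<in>UNIV. \<bar>B i\<bar>)" if D: "(\<theta>, u) \<in> D" for \<theta> u
    proof -
      obtain v \<omega> i where \<theta>: "\<theta> = (v, \<omega>, i)" by (cases \<theta>)
      have g: "good v \<omega> i" "u \<in> cball u0 \<rho>2" "u + v \<in> cball u0 \<rho>2" using D by (auto simp: \<theta> D_def)
      let ?P = "foldr partial (replicate k i) \<phi>"
      have v: "v \<noteq> 0" and \<omega>: "norm \<omega> = 1" using g W by (auto simp: good_def)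
      have "\<bar>(?P (u + v) - ?P u) \<bullet> \<omega>\<bar> \<le> norm (?P (u + v) - ?P u) * norm \<omega>" by (rule Cauchy_Schwarz_ineq2)
      also have "\<dots> \<le> B i * norm v" using B[OF g(3,2), of i] \<omega> by simp
      finally have "\<bar>F k \<theta> u\<bar> \<le> B i" using v by (simp add: F_def \<theta> abs_mult divide_le_eq)
      also have "\<dots> \<le> \<bar>B i\<bar>" by simp
      also have "\<dots> \<le> (\<Sum>i\<in>UNIV. \<bar>B i\<bar>)" by (rule member_le_sum) auto
      finally show ?thesis .
    qed
    then show ?thesis unfolding bdd_cont_on_def using cF by blast
  qed
  have dF: "has_dir_deriv (F k \<theta>) (F (Suc k) \<theta> u) u (e \<theta>)" if D: "(\<theta>, u) \<in> D" for k \<theta> u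
  proof -
    obtain v \<omega> i where \<theta>: "\<theta> = (v, \<omega>, i)" by (cases \<theta>)
    have uV: "u \<in> V" "u + v \<in> V" using D inV by (auto simp: \<theta> D_def)
    note d = has_dir_deriv_diff[OF has_dir_deriv_translate[OF smooth_on_dir_deriv[OF sm V uV(2), of "replicate k i" i]]
        smooth_on_dir_deriv[OF sm V uV(1), of "replicate k i" i]]
    have "bounded_linear (\<lambda>x. (x \<bullet> \<omega>) * (1 / norm v))"
      by (intro bounded_linear_mult_const bounded_linear_inner_left)
    from has_dir_deriv_bounded_linear[OF d this]
    show ?thesis by (simp add: F_def \<theta> e_def)
  qed
  have "\<exists>C. \<forall>\<theta> \<Lambda>. 0 < \<Lambda> \<longrightarrow> cmod (\<integral>u. indicator {u. (\<theta>, u) \<in> D} u *\<^sub>R (of_real (q \<theta> u) * cis (\<Lambda> * F 0 \<theta> u)) \<partial>lborel) \<le> C / \<Lambda> ^ ?N"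
  proof (rule nonstationary_phase[where e=e and ?\<Phi>1.0="F 1" and c=c and R=\<rho>2 and K=K])
    show "open {u. (\<theta>, u) \<in> D}" for \<theta> by (cases \<theta>) (auto simp only: slice split: if_split intro!: open_Int open_ball open_empty)
    show "u \<in> cball u0 \<rho>2" if "(\<theta>, u) \<in> D" for \<theta> u using that by (auto simp: D_def)
    show "compact (K \<theta>)" for \<theta> by (cases \<theta>) (auto simp: K_def intro!: compact_Int)
    show "K \<theta> \<subseteq> {u. (\<theta>, u) \<in> D}" for \<theta>
    proof (cases \<theta>)
      case (fields v \<omega> i)
      have "cball u0 \<rho> \<inter> cball (u0 - v) \<rho> \<subseteq> ball u0 \<rho>2 \<inter> ball (u0 - v) \<rho>2" using \<rho> by auto
      then show ?thesis unfolding fields slice K_def by auto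
    qed
    show "has_dir_deriv (F 0 \<theta>) (F 1 \<theta> u) u (e \<theta>)" if "(\<theta>, u) \<in> D" for \<theta> u
      using dF[OF that, of 0] by simp
    show "c \<le> \<bar>F 1 \<theta> u\<bar>" if D: "(\<theta>, u) \<in> D" for \<theta> u
    proof -
      obtain v \<omega> i where \<theta>: "\<theta> = (v, \<omega>, i)" by (cases \<theta>)
      have g: "good v \<omega> i" "u \<in> cball u0 \<rho>2" "u + v \<in> cball u0 \<rho>2" using D by (auto simp: \<theta> D_def)
      then have "c * norm v \<le> \<bar>(partial i \<phi> (u + v) - partial i \<phi> u) \<bullet> \<omega>\<bar>" "v \<noteq> 0" unfolding good_def by blast+
      then show ?thesis by (simp add: F_def \<theta> abs_mult le_divide_eq)
    qed
    show "dbdd ?N D e (F 1)" by (rule dbdd_chain[where F=F and k=1]) (use bF dF in auto)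
    have "dbdd ?N D e (\<lambda>\<theta> u. ?b (u + 0) * ?b (u + fst \<theta>))"
      by (intro dbdd_mult; rule dbdd_bump[where R=\<rho>2]) (auto simp: D_def e_def dist_norm norm_minus_commute)
    then show "dbdd ?N D e q" by (simp add: q_def case_prod_beta')
    show "q \<theta> u = 0" if D: "(\<theta>, u) \<in> D" and nK: "u \<notin> K \<theta>" for \<theta> u
    proof -
      obtain v \<omega> i where \<theta>: "\<theta> = (v, \<omega>, i)" by (cases \<theta>)
      have "u \<notin> cball u0 \<rho> \<or> u + v \<notin> cball u0 \<rho>" using D nK sh(2) by (auto simp: \<theta> K_def D_def)
      then have "?b u = 0 \<or> ?b (u + v) = 0"
        using bump_eq_0[of "?N + 1" \<rho> u u0] bump_eq_0[of "?N + 1" \<rho> "u + v" u0] \<rho> by auto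
      then show ?thesis by (auto simp: q_def \<theta>)
    qed
  qed (use c cF in auto)
  then obtain C where C: "\<And>\<theta> \<Lambda>. 0 < \<Lambda> \<Longrightarrow> cmod (\<integral>u. indicator {u. (\<theta>, u) \<in> D} u *\<^sub>R (of_real (q \<theta> u) * cis (\<Lambda> * F 0 \<theta> u)) \<partial>lborel) \<le> C / \<Lambda> ^ ?N"
    by blast
  define C0 where "C0 = (\<rho>\<^sup>2) ^ (?N + 1) * (\<rho>\<^sup>2) ^ (?N + 1) * measure lborel (cball u0 \<rho>)"
  \<comment> \<open>Dominates both the trivial bound \<open>C0\<close> and the constant of the
    decay, as one constant has to serve for all v.\<close>
  define C1 where "C1 = max C0 \<bar>C\<bar>"
  have C1: "0 \<le> C1" "C0 \<le> C1" "C \<le> C1" by (auto simp: C1_def)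
  define \<kappa> where "\<kappa> = (\<integral>x. 1 / (1 + (x::real)\<^sup>2) \<partial>lborel)"
  have k0: "0 \<le> \<kappa>" unfolding \<kappa>_def by (intro Bochner_Integration.integral_nonneg) simp
  show ?thesis
  proof (intro exI[of _ "C1 * 2 ^ CARD('m) * \<kappa> ^ CARD('m)"] conjI ballI allI impI)
    show "0 \<le> C1 * 2 ^ CARD('m) * \<kappa> ^ CARD('m)" using C1 k0 by simp
    fix \<omega> :: "real^'n" and \<Lambda> :: real
    assume \<omega>: "\<omega> \<in> W" and L: "0 < \<Lambda>"
    define A where "A u = of_real (?b u) * cis (\<Lambda> * (\<phi> u \<bullet> \<omega>))" for u
    have "continuous_on (cball u0 \<rho>) \<phi>"
      by (rule continuous_on_subset[OF smooth_on_continuous[OF sm, of "[]", simplified]]) (use inV \<rho> in auto)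
    then have A: "integrable lborel A" unfolding A_def using \<rho>
      by (intro bump_cis_integrable continuous_intros) auto
    let ?g = "\<lambda>v::real^'m. C1 * 2 ^ CARD('m) * (\<Prod>b\<in>Basis. 1 / (1 + (\<Lambda> * (v \<bullet> b))\<^sup>2))"
    have "(cmod (\<integral>u. A u \<partial>lborel))\<^sup>2 \<le> (\<integral>v. ?g v \<partial>lborel)"
    proof (rule integral_square_le[OF A])
      show "integrable lborel ?g" by (intro integrable_mult_right integral_prod_1_plus_square L)
      fix v :: "real^'m"
      have AA: "A (u + v) * cnj (A u) = of_real (?b u * ?b (u + v)) * cis (\<Lambda> * (\<phi> (u + v) \<bullet> \<omega>) - \<Lambda> * (\<phi> u \<bullet> \<omega>))" for u
        by (simp add: A_def cis_cnj cis_divide[symmetric] divide_inverse mult_ac)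
      have "cmod (\<integral>u. A (u + v) * cnj (A u) \<partial>lborel) \<le> C1 * 2 ^ DIM(real^'m) * (\<Prod>b\<in>Basis. 1 / (1 + (\<Lambda> * (v \<bullet> b))\<^sup>2))"
      proof (rule le_prod_1_plus_square[OF L C1(1)])
        show "cmod (\<integral>u. A (u + v) * cnj (A u) \<partial>lborel) \<le> C1"
          unfolding AA by (rule order_trans[OF bump_phase_integral_le]) (use \<rho> C1(2) in \<open>auto simp: C0_def\<close>)
        assume v: "v \<noteq> 0"
        obtain i where "\<forall>\<omega> u. \<omega> \<in> W \<longrightarrow> u \<in> cball u0 \<rho>2 \<longrightarrow> u + v \<in> cball u0 \<rho>2 \<longrightarrow>
            c * norm v \<le> \<bar>(partial i \<phi> (u + v) - partial i \<phi> u) \<bullet> \<omega>\<bar>" using ph[of v] by blast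
        then have g: "good v \<omega> i" using v \<omega> by (simp add: good_def)
        have "A (u + v) * cnj (A u) = indicator {u. ((v, \<omega>, i), u) \<in> D} u *\<^sub>R (of_real (q (v, \<omega>, i) u) * cis ((\<Lambda> * norm v) * F 0 (v, \<omega>, i) u))" for u
        proof (cases "u \<in> ball u0 \<rho>2 \<and> u + v \<in> ball u0 \<rho>2")
          case True
          have "\<Lambda> * (\<phi> (u + v) \<bullet> \<omega>) - \<Lambda> * (\<phi> u \<bullet> \<omega>) = (\<Lambda> * norm v) * F 0 (v, \<omega>, i) u"
            using v by (simp add: F_def inner_diff_left field_simps)
          moreover have "u \<in> {u. ((v, \<omega>, i), u) \<in> D}" using True g by (simp add: D_def)
          ultimately show ?thesis unfolding AA by (simp add: q_def)
        next
          case False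
          then have "?b u = 0 \<or> ?b (u + v) = 0"
            using bump_eq_0[of "?N + 1" \<rho> u u0] bump_eq_0[of "?N + 1" \<rho> "u + v" u0] \<rho> by auto
          moreover have "u \<notin> {u. ((v, \<omega>, i), u) \<in> D}" using False by (auto simp: D_def)
          ultimately show ?thesis unfolding AA by auto
        qed
        then have "cmod (\<integral>u. A (u + v) * cnj (A u) \<partial>lborel) \<le> C / (\<Lambda> * norm v) ^ ?N"
          using C[of "\<Lambda> * norm v" "(v, \<omega>, i)"] L v by simp
        also have "\<dots> \<le> C1 / (\<Lambda> * norm v) ^ ?N" using C1(3) L by (intro divide_right_mono) auto
        finally show "cmod (\<integral>u. A (u + v) * cnj (A u) \<partial>lborel) \<le> C1 / (\<Lambda> * norm v) ^ (2 * DIM(real^'m))" by simp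
      qed simp
      then show "cmod (\<integral>u. A (u + v) * cnj (A u) \<partial>lborel) \<le> ?g v" by simp
    qed
    also have "\<dots> = C1 * 2 ^ CARD('m) * (\<kappa> / \<Lambda>) ^ DIM(real^'m)"
      unfolding \<kappa>_def integral_prod_1_plus_square(2)[OF L, symmetric] by simp
    also have "\<dots> = C1 * 2 ^ CARD('m) * \<kappa> ^ CARD('m) / \<Lambda> ^ CARD('m)" by (simp add: power_divide)
    finally show "(cmod (\<integral>u. of_real (?b u) * cis (\<Lambda> * (\<phi> u \<bullet> \<omega>)) \<partial>lborel))\<^sup>2 \<le> C1 * 2 ^ CARD('m) * \<kappa> ^ CARD('m) / \<Lambda> ^ CARD('m)"
      by (simp add: A_def)
  qed
qed

text \<open>To first order the gradient difference in the normal direction is the second fundamental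
  form applied to v, and invertibility makes some component at least a multiple of |v|. The
  component depends on v only, and the same one works for all nearby \<open>\<omega>\<close> and all
  u.\<close>

lemma hessian_phase:
  fixes \<phi> :: "real^'m::finite \<Rightarrow> real^'n::finite"
  assumes sm: "smooth_on V \<phi>" and V: "open V" "u0 \<in> V" and N0: "norm N0 = 1"
    and det: "det (\<chi> i j. partial i (partial j \<phi>) u0 \<bullet> N0) \<noteq> 0"
  obtains \<rho> \<delta> c where "0 < \<rho>" "0 < \<delta>" "0 < c" "cball u0 \<rho> \<subseteq> V"
    "\<And>v. \<exists>i. \<forall>\<omega> u. norm (\<omega> - N0) < \<delta> \<longrightarrow> u \<in> cball u0 \<rho> \<longrightarrow> u + v \<in> cball u0 \<rho> \<longrightarrow>
      c * norm v \<le> \<bar>(partial i \<phi> (u + v) - partial i \<phi> u) \<bullet> \<omega>\<bar>"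
proof -
  let ?m = "real CARD('m)"
  have m0: "0 < ?m" by simp
  \<comment> \<open>Differentiating \<open>partial i \<phi>\<close> along v produces
    \<open>partial j (partial i \<phi>)\<close>, so the matrix that acts on v is the transpose of
    the one in the hypothesis.\<close>
  define A where "A = (\<chi> i j. partial j (partial i \<phi>) u0 \<bullet> N0)"
  have "A = transpose (\<chi> i j. partial i (partial j \<phi>) u0 \<bullet> N0)" by (simp add: A_def transpose_def)
  then have "det A \<noteq> 0" using det by (simp add: det_transpose)
  then have "invertible A" by (simp add: invertible_det_nz)
  then have "inj ((*v) A)" by (rule inj_matrix_vector_mult)
  then obtain B where B: "0 < B" "\<And>v. B * norm v \<le> norm (A *v v)"
    using linear_inj_bounded_below_pos[of "(*v) A"] matrix_vector_mul_linear by (auto simp: mult.commute)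
  have Av: "(A *v v) $ i = (\<Sum>j\<in>UNIV. v $ j *\<^sub>R partial j (partial i \<phi>) u0) \<bullet> N0" for v i
    by (simp add: A_def matrix_vector_mult_def inner_sum_left mult.commute)
  define c1 where "c1 = B / ?m"
  have c1: "0 < c1" using B by (simp add: c1_def)
  have ex: "\<exists>i. c1 * norm v \<le> \<bar>(A *v v) $ i\<bar>" for v
  proof (rule ccontr)
    assume "\<nexists>i. c1 * norm v \<le> \<bar>(A *v v) $ i\<bar>"
    then have lt: "\<bar>(A *v v) $ i\<bar> < c1 * norm v" for i by (meson not_le)
    have "B * norm v \<le> (\<Sum>i\<in>UNIV. \<bar>(A *v v) $ i\<bar>)" using B(2)[of v] norm_le_l1_cart[of "A *v v"] by linarith
    also have "\<dots> < (\<Sum>i\<in>(UNIV::'m set). c1 * norm v)" using lt by (intro sum_strict_mono) auto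
    also have "\<dots> = B * norm v" by (simp add: c1_def)
    finally show False by simp
  qed
  obtain \<rho>1 where \<rho>1: "0 < \<rho>1" "cball u0 \<rho>1 \<subseteq> V" using V open_contains_cball by blast
  have "\<forall>i. \<exists>L. \<forall>u\<in>cball u0 \<rho>1. \<forall>w\<in>cball u0 \<rho>1. norm (foldr partial [i] \<phi> u - foldr partial [i] \<phi> w) \<le> L * norm (u - w)"
    using smooth_on_lipschitz[OF sm V(1) \<rho>1(2)] by blast
  then obtain L where L: "\<And>i u w. u \<in> cball u0 \<rho>1 \<Longrightarrow> w \<in> cball u0 \<rho>1 \<Longrightarrow> norm (foldr partial [i] \<phi> u - foldr partial [i] \<phi> w) \<le> L i * norm (u - w)" by metis
  define l where "l = (\<Sum>i\<in>UNIV. \<bar>L i\<bar>)"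
  have l0: "0 \<le> l" unfolding l_def by (intro sum_nonneg) auto
  have lip: "norm (partial i \<phi> u - partial i \<phi> w) \<le> l * norm (u - w)" if "u \<in> cball u0 \<rho>1" "w \<in> cball u0 \<rho>1" for i u w
  proof -
    have "L i \<le> l" unfolding l_def using member_le_sum[of i UNIV "\<lambda>i. \<bar>L i\<bar>"] by simp
    then have "L i * norm (u - w) \<le> l * norm (u - w)" by (intro mult_right_mono) auto
    then show ?thesis using L[OF that, of i] by simp
  qed
  \<comment> \<open>\<open>\<epsilon>\<close> bounds the variation of the second derivatives over
    the ball, \<open>\<delta>\<close> the deviation of \<open>\<omega>\<close> from the normal. Each
    error costs a quarter of \<open>c1\<close>, which leaves half.\<close>
  define \<epsilon> where "\<epsilon> = c1 / (4 * ?m)"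
  have \<epsilon>: "0 < \<epsilon>" using c1 by (simp add: \<epsilon>_def)
  define \<delta> where "\<delta> = c1 / (4 * (l + 1))"
  have \<delta>: "0 < \<delta>" "l * \<delta> \<le> c1 / 4"
  proof -
    show "0 < \<delta>" using c1 l0 by (simp add: \<delta>_def)
    then have "l * \<delta> \<le> (l + 1) * \<delta>" by simp
    also have "\<dots> = c1 / 4" using l0 by (simp add: \<delta>_def field_simps)
    finally show "l * \<delta> \<le> c1 / 4" .
  qed
  have "\<forall>\<^sub>F u in nhds u0. \<forall>i j. dist (partial j (partial i \<phi>) u) (partial j (partial i \<phi>) u0) < \<epsilon>"
  proof (intro eventually_all_finite)
    fix i j
    have "continuous_on V (partial j (partial i \<phi>))" using smooth_on_continuous[OF sm, of "[j, i]"] by simp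
    then have "isCont (partial j (partial i \<phi>)) u0" using V continuous_on_eq_continuous_at by blast
    then have "(partial j (partial i \<phi>) \<longlongrightarrow> partial j (partial i \<phi>) u0) (nhds u0)"
      by (simp add: continuous_at tendsto_at_iff_tendsto_nhds)
    then show "\<forall>\<^sub>F u in nhds u0. dist (partial j (partial i \<phi>) u) (partial j (partial i \<phi>) u0) < \<epsilon>"
      using \<epsilon> tendstoD by blast
  qed
  then obtain \<rho>3 where \<rho>3: "0 < \<rho>3" "\<And>u i j. dist u u0 < \<rho>3 \<Longrightarrow> dist (partial j (partial i \<phi>) u) (partial j (partial i \<phi>) u0) < \<epsilon>"
    unfolding eventually_nhds_metric by blast
  define \<rho> where "\<rho> = min \<rho>1 (\<rho>3 / 2)"
  have \<rho>: "0 < \<rho>" "\<rho> \<le> \<rho>1" "\<rho> < \<rho>3" using \<rho>1 \<rho>3 by (auto simp: \<rho>_def)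
  have sub: "cball u0 \<rho> \<subseteq> cball u0 \<rho>1" using \<rho> by auto
  show thesis
  proof (rule that[of \<rho> \<delta> "c1 / 2"])
    show "cball u0 \<rho> \<subseteq> V" using sub \<rho>1 by blast
    fix v :: "real^'m"
    obtain i where i: "c1 * norm v \<le> \<bar>(A *v v) $ i\<bar>" using ex by blast
    show "\<exists>i. \<forall>\<omega> u. norm (\<omega> - N0) < \<delta> \<longrightarrow> u \<in> cball u0 \<rho> \<longrightarrow> u + v \<in> cball u0 \<rho> \<longrightarrow>
      c1 / 2 * norm v \<le> \<bar>(partial i \<phi> (u + v) - partial i \<phi> u) \<bullet> \<omega>\<bar>"
    proof (intro exI[of _ i] allI impI)
      fix \<omega> :: "real^'n" and u
      assume \<omega>: "norm (\<omega> - N0) < \<delta>" and u: "u \<in> cball u0 \<rho>" "u + v \<in> cball u0 \<rho>"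
      let ?D = "partial i \<phi> (u + v) - partial i \<phi> u"
      let ?L = "\<Sum>j\<in>UNIV. v $ j *\<^sub>R partial j (partial i \<phi>) u0"
      have "\<bar>?D \<bullet> (\<omega> - N0)\<bar> \<le> norm ?D * norm (\<omega> - N0)" by (rule Cauchy_Schwarz_ineq2)
      also have "\<dots> \<le> (l * norm v) * \<delta>"
        using lip[OF subsetD[OF sub u(2)] subsetD[OF sub u(1)], of i] \<omega> l0 by (intro mult_mono) auto
      also have "\<dots> \<le> c1 / 4 * norm v" using mult_right_mono[OF \<delta>(2) norm_ge_zero[of v]] by (simp add: mult_ac)
      finally have 1: "\<bar>?D \<bullet> (\<omega> - N0)\<bar> \<le> c1 / 4 * norm v" .
      have "norm (?D - (\<Sum>j\<in>UNIV. (u + v - u) $ j *\<^sub>R partial j (partial i \<phi>) u0)) \<le> ?m * \<epsilon> * norm (u + v - u)"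
      proof (rule partials_close_bound[OF convex_cball _ _ u(2,1)])
        show "partial i \<phi> differentiable (at x)" if "x \<in> cball u0 \<rho>" for x
          using smooth_on_differentiable[OF sm V(1), of x "[i]"] that sub \<rho>1(2) by (simp add: subset_iff)
        show "norm (partial j (partial i \<phi>) x - partial j (partial i \<phi>) u0) \<le> \<epsilon>" if "x \<in> cball u0 \<rho>" for x j
          using \<rho>3(2)[of x j i] that \<rho> by (simp add: dist_norm norm_minus_commute)
      qed
      then have "norm (?D - ?L) \<le> c1 / 4 * norm v" by (simp add: \<epsilon>_def)
      moreover have "\<bar>(?D - ?L) \<bullet> N0\<bar> \<le> norm (?D - ?L) * norm N0" by (rule Cauchy_Schwarz_ineq2)
      ultimately have 2: "\<bar>(?D - ?L) \<bullet> N0\<bar> \<le> c1 / 4 * norm v" using N0 by simp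
      have "?D \<bullet> \<omega> = (A *v v) $ i + (?D - ?L) \<bullet> N0 + ?D \<bullet> (\<omega> - N0)"
        unfolding Av by (simp add: inner_diff_left inner_diff_right)
      then show "c1 / 2 * norm v \<le> \<bar>?D \<bullet> \<omega>\<bar>" using 1 2 i by argo
    qed
  qed (use \<rho> \<delta> c1 in auto)
qed

text \<open>Tangent vectors and \<open>N\<close> together span the space by a dimension count, so
  \<open>w\<close> minus its component along \<open>N\<close> is orthogonal to everything, itself
  included.\<close>

lemma unit_normal_unique:
  fixes a :: "'m::finite \<Rightarrow> real^'n::finite"
  assumes card: "CARD('n) = CARD('m) + 1" and inj: "inj (\<lambda>v::real^'m. \<Sum>i\<in>UNIV. v $ i *\<^sub>R a i)"
    and N: "norm N = 1" "\<And>i. N \<bullet> a i = 0" and w: "norm w = 1" "\<And>i. w \<bullet> a i = 0"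
  shows "w = N \<or> w = - N"
proof -
  define T where "T = (\<lambda>(v::real^'m, t::real). (\<Sum>i\<in>UNIV. v $ i *\<^sub>R a i) + t *\<^sub>R N)"
  have NL: "N \<bullet> (\<Sum>i\<in>UNIV. v $ i *\<^sub>R a i) = 0" for v :: "real^'m" using N(2) by (simp add: inner_sum_right)
  have NN: "N \<bullet> N = 1" using N(1) by (simp add: dot_square_norm)
  have lin: "linear T"
    by (rule linearI) (auto simp: T_def scaleR_add_left sum.distrib scaleR_sum_right scaleR_add_right)
  have "inj T"
    unfolding linear_injective_0[OF lin]
  proof (intro allI impI)
    fix p assume p: "T p = 0"
    obtain v t where vt: "p = (v, t)" by (cases p)
    have "N \<bullet> T p = t" by (simp add: T_def vt inner_add_right NL NN)
    then have t: "t = 0" using p by simp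
    then have "(\<Sum>i\<in>UNIV. v $ i *\<^sub>R a i) = (\<Sum>i\<in>UNIV. (0::real^'m) $ i *\<^sub>R a i)" using p by (simp add: T_def vt)
    then have "v = 0" using injD[OF inj, of v 0] by simp
    then show "p = 0" using t vt by (simp add: zero_prod_def)
  qed
  then have "dim (T ` UNIV) = dim (UNIV :: ((real^'m) \<times> real) set)"
    by (intro dim_image_eq lin) (auto intro: inj_on_subset)
  then have "dim (range T) = DIM(real^'n)" using card by simp
  then have "span (range T) = UNIV" using dim_eq_full by blast
  then have "range T = UNIV" using span_eq_iff[of "range T"] subspace_UNIV linear_subspace_image[OF lin] by metis
  then obtain p where p: "T p = w - (w \<bullet> N) *\<^sub>R N" by (metis surjD)
  define z where "z = w - (w \<bullet> N) *\<^sub>R N"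
  have "z \<bullet> N = 0" using NN by (simp add: z_def inner_diff_left)
  moreover have "z \<bullet> a i = 0" for i using w(2) N(2) by (simp add: z_def inner_diff_left)
  ultimately have "z \<bullet> T p = 0" by (cases p) (simp add: T_def inner_add_right inner_sum_right)
  then have "z = 0" using p by (simp add: z_def)
  define t where "t = w \<bullet> N"
  have w': "w = t *\<^sub>R N" using \<open>z = 0\<close> by (simp add: z_def t_def)
  then have "norm w = \<bar>t\<bar> * norm N" by simp
  then have "t = 1 \<or> t = - 1" using w(1) N(1) by auto
  then show ?thesis using w' by auto
qed

text \<open>Lets directions near the opposite normal be treated through those near the
  normal.\<close>

lemma bump_integral_cnj:
  "(\<integral>u. of_real (b u) * cis (L * (\<phi> u \<bullet> (- \<omega>))) \<partial>lborel) = cnj (\<integral>u. of_real (b u) * cis (L * (\<phi> u \<bullet> \<omega>)) \<partial>lborel)"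
proof -
  have "of_real (b u) * cis (L * (\<phi> u \<bullet> (- \<omega>))) = cnj (of_real (b u) * cis (L * (\<phi> u \<bullet> \<omega>)))" for u
    by (simp add: cis_cnj)
  then show ?thesis by (simp only: Bochner_Integration.integral_cnj)
qed

text \<open>The unit sphere of directions is covered by neighbourhoods of the two normals, where the
  curvature acts, and a compact remainder, where some tangential derivative is bounded below. The
  upper limit \<open>r\<close> on the radius later keeps the ball inside the half space of the
  chart.\<close>

lemma chart_oscillatory_decay:
  fixes \<phi> :: "real^'m::finite \<Rightarrow> real^'n::finite"
  assumes sm: "smooth_on V \<phi>" and V: "open V" "u0 \<in> V" and inj: "inj (frechet_derivative \<phi> (at u0))"
    and card: "CARD('n) = CARD('m) + 1" and N0: "norm N0 = 1" "\<And>i. N0 \<bullet> partial i \<phi> u0 = 0"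
    and det: "det (\<chi> i j. partial i (partial j \<phi>) u0 \<bullet> N0) \<noteq> 0" and r: "0 < r"
  obtains \<rho> C where "0 < \<rho>" "\<rho> \<le> r" "cball u0 \<rho> \<subseteq> V" "0 \<le> C"
    "\<And>\<omega> L. norm \<omega> = 1 \<Longrightarrow> 0 < L \<Longrightarrow>
      cmod (\<integral>u. of_real (bump u0 \<rho> (2 * CARD('m) + 1) u) * cis (L * (\<phi> u \<bullet> \<omega>)) \<partial>lborel) \<le> C * L powr (- (real CARD('m) / 2))"
proof -
  let ?m = "CARD('m)"
  obtain \<rho>a \<delta> c where pos: "0 < \<rho>a" "0 < \<delta>" "0 < c" and suba: "cball u0 \<rho>a \<subseteq> V"
    and ph: "\<And>v. \<exists>i. \<forall>\<omega> u. norm (\<omega> - N0) < \<delta> \<longrightarrow> u \<in> cball u0 \<rho>a \<longrightarrow> u + v \<in> cball u0 \<rho>a \<longrightarrow>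
      c * norm v \<le> \<bar>(partial i \<phi> (u + v) - partial i \<phi> u) \<bullet> \<omega>\<bar>"
    by (rule hessian_phase[OF sm V N0(1) det]) blast
  have d: "\<phi> differentiable (at u0)" using smooth_on_differentiable[OF sm V, of "[]"] by simp
  have inj': "inj (\<lambda>v::real^'m. \<Sum>i\<in>UNIV. v $ i *\<^sub>R partial i \<phi> u0)"
    using inj frechet_derivative_at[OF has_derivative_partial[OF d]] by simp
  define Wc where "Wc = sphere (0::real^'n) 1 - ball N0 \<delta> - ball (- N0) \<delta>"
  have "compact Wc" unfolding Wc_def by (intro compact_diff compact_sphere open_ball)
  \<comment> \<open>A minimum over the compact remainder: a unit vector on which all tangential
    pairings vanish would be one of the two normals, which have been cut out. If nothing remains,
    any constant does.\<close>
  obtain c2 where c2: "0 < c2" "\<And>\<omega>. \<omega> \<in> Wc \<Longrightarrow> \<exists>i. c2 \<le> \<bar>partial i \<phi> u0 \<bullet> \<omega>\<bar>"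
  proof (cases "Wc = {}")
    case True then show thesis using that[of 1] by simp
  next
    case False
    define f where "f \<omega> = (\<Sum>i\<in>UNIV. \<bar>partial i \<phi> u0 \<bullet> \<omega>\<bar>)" for \<omega>
    have "continuous_on Wc f" unfolding f_def by (intro continuous_intros)
    then obtain \<omega>0 where \<omega>0: "\<omega>0 \<in> Wc" "\<And>\<omega>. \<omega> \<in> Wc \<Longrightarrow> f \<omega>0 \<le> f \<omega>"
      using continuous_attains_inf[OF \<open>compact Wc\<close> False] by blast
    have "f \<omega>0 \<noteq> 0"
    proof
      assume "f \<omega>0 = 0"
      then have "\<omega>0 \<bullet> partial i \<phi> u0 = 0" for i
        unfolding f_def by (subst (asm) sum_nonneg_eq_0_iff) (auto simp: inner_commute)
      then have "\<omega>0 = N0 \<or> \<omega>0 = - N0"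
        using \<omega>0(1) by (intro unit_normal_unique[OF card inj' N0]) (auto simp: Wc_def)
      then show False using \<omega>0(1) pos by (auto simp: Wc_def)
    qed
    moreover have "0 \<le> f \<omega>0" unfolding f_def by (intro sum_nonneg) auto
    ultimately have f0: "0 < f \<omega>0" by simp
    show thesis
    proof (rule that[of "f \<omega>0 / ?m"])
      show "0 < f \<omega>0 / ?m" using f0 by simp
      fix \<omega> assume \<omega>: "\<omega> \<in> Wc"
      show "\<exists>i. f \<omega>0 / ?m \<le> \<bar>partial i \<phi> u0 \<bullet> \<omega>\<bar>"
      proof (rule ccontr)
        assume "\<nexists>i. f \<omega>0 / ?m \<le> \<bar>partial i \<phi> u0 \<bullet> \<omega>\<bar>"
        then have lt: "\<bar>partial i \<phi> u0 \<bullet> \<omega>\<bar> < f \<omega>0 / ?m" for i by (meson not_le)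
        have "f \<omega> < (\<Sum>i\<in>(UNIV::'m set). f \<omega>0 / ?m)" unfolding f_def[of \<omega>] using lt by (intro sum_strict_mono) auto
        then show False using \<omega>0(2)[OF \<omega>] by simp
      qed
    qed
  qed
  \<comment> \<open>Half of the lower bound at \<open>u0\<close> survives on a small ball,
    simultaneously for all unit vectors.\<close>
  have "\<forall>\<^sub>F u in nhds u0. \<forall>i. dist (partial i \<phi> u) (partial i \<phi> u0) < c2 / 2"
  proof (intro eventually_all_finite)
    fix i
    have "continuous_on V (partial i \<phi>)" using smooth_on_continuous[OF sm, of "[i]"] by simp
    then have "isCont (partial i \<phi>) u0" using V continuous_on_eq_continuous_at by blast
    then have "(partial i \<phi> \<longlongrightarrow> partial i \<phi> u0) (nhds u0)" by (simp add: continuous_at tendsto_at_iff_tendsto_nhds)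
    then show "\<forall>\<^sub>F u in nhds u0. dist (partial i \<phi> u) (partial i \<phi> u0) < c2 / 2"
      using c2(1) tendstoD half_gt_zero by blast
  qed
  then obtain \<rho>b where \<rho>b: "0 < \<rho>b" "\<And>u i. dist u u0 < \<rho>b \<Longrightarrow> dist (partial i \<phi> u) (partial i \<phi> u0) < c2 / 2"
    unfolding eventually_nhds_metric by blast
  define \<rho>2 where "\<rho>2 = min \<rho>a (min \<rho>b r)"
  have \<rho>2: "0 < \<rho>2" "\<rho>2 \<le> \<rho>a" "\<rho>2 \<le> \<rho>b" "\<rho>2 \<le> r" using pos \<rho>b r by (auto simp: \<rho>2_def)
  define \<rho> where "\<rho> = \<rho>2 / 2"
  have \<rho>: "0 < \<rho>" "\<rho> < \<rho>2" using \<rho>2 by (auto simp: \<rho>_def)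
  have sub2: "cball u0 \<rho>2 \<subseteq> cball u0 \<rho>a" using \<rho>2 by auto
  then have subV: "cball u0 \<rho>2 \<subseteq> V" using suba by blast
  define J where "J \<omega> L = (\<integral>u. of_real (bump u0 \<rho> (2 * ?m + 1) u) * cis (L * (\<phi> u \<bullet> \<omega>)) \<partial>lborel)" for \<omega> L
  define W where "W = {\<omega>. norm \<omega> = 1 \<and> norm (\<omega> - N0) < \<delta>}"
  have "\<exists>C\<ge>0. \<forall>\<omega>\<in>W. \<forall>\<Lambda>>0. (cmod (\<integral>u. of_real (bump u0 \<rho> (2 * ?m + 1) u) * cis (\<Lambda> * (\<phi> u \<bullet> \<omega>)) \<partial>lborel))\<^sup>2 \<le> C / \<Lambda> ^ ?m"
  proof (rule stationary_decay[OF sm V(1) subV \<rho> pos(3)])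
    fix v
    obtain i where i: "\<forall>\<omega> u. norm (\<omega> - N0) < \<delta> \<longrightarrow> u \<in> cball u0 \<rho>a \<longrightarrow> u + v \<in> cball u0 \<rho>a \<longrightarrow>
      c * norm v \<le> \<bar>(partial i \<phi> (u + v) - partial i \<phi> u) \<bullet> \<omega>\<bar>" using ph by blast
    show "\<exists>i. \<forall>\<omega> u. \<omega> \<in> W \<longrightarrow> u \<in> cball u0 \<rho>2 \<longrightarrow> u + v \<in> cball u0 \<rho>2 \<longrightarrow>
      c * norm v \<le> \<bar>(partial i \<phi> (u + v) - partial i \<phi> u) \<bullet> \<omega>\<bar>"
    proof (intro exI[of _ i] allI impI)
      fix \<omega> u assume "\<omega> \<in> W" "u \<in> cball u0 \<rho>2" "u + v \<in> cball u0 \<rho>2"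
      then show "c * norm v \<le> \<bar>(partial i \<phi> (u + v) - partial i \<phi> u) \<bullet> \<omega>\<bar>"
        using i sub2 unfolding W_def by blast
    qed
  qed (simp add: W_def)
  then obtain C1 where C1: "0 \<le> C1" "\<And>\<omega> L. \<omega> \<in> W \<Longrightarrow> 0 < L \<Longrightarrow> (cmod (J \<omega> L))\<^sup>2 \<le> C1 / L ^ ?m"
    unfolding J_def by blast
  have "\<exists>C. \<forall>\<omega> \<Lambda>. norm \<omega> = 1 \<longrightarrow> (\<exists>i. \<forall>u\<in>ball u0 \<rho>2. c2 / 2 \<le> \<bar>partial i \<phi> u \<bullet> \<omega>\<bar>) \<longrightarrow> 0 < \<Lambda> \<longrightarrow>
    cmod (\<integral>u. of_real (bump u0 \<rho> (2 * ?m + 1) u) * cis (\<Lambda> * (\<phi> u \<bullet> \<omega>)) \<partial>lborel) \<le> C / \<Lambda> ^ (2 * ?m)"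
    by (rule nonstationary_decay[OF sm V(1) subV \<rho>, unfolded Suc_eq_plus1]) (use c2 in simp)
  then obtain C2 where C2: "\<And>\<omega> L. norm \<omega> = 1 \<Longrightarrow> \<exists>i. \<forall>u\<in>ball u0 \<rho>2. c2 / 2 \<le> \<bar>partial i \<phi> u \<bullet> \<omega>\<bar> \<Longrightarrow> 0 < L \<Longrightarrow>
    cmod (J \<omega> L) \<le> C2 / L ^ (2 * ?m)"
    unfolding J_def by blast
  define C0 where "C0 = (\<rho>\<^sup>2) ^ (2 * ?m + 1) * measure lborel (cball u0 \<rho>)"
  have J0: "cmod (J \<omega> L) \<le> C0" for \<omega> L
    unfolding J_def C0_def
  proof (rule integral_bounded_on_ball)
    show "norm (of_real (bump u0 \<rho> (2 * ?m + 1) u) * cis (L * (\<phi> u \<bullet> \<omega>))) \<le> (\<rho>\<^sup>2) ^ (2 * ?m + 1)" for u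
      using bump_le[of u0 \<rho> "2 * ?m + 1" u] bump_nonneg[of u0 \<rho> "2 * ?m + 1" u] by (simp add: norm_mult)
    show "of_real (bump u0 \<rho> (2 * ?m + 1) u) * cis (L * (\<phi> u \<bullet> \<omega>)) = 0" if "u \<notin> cball u0 \<rho>" for u
      using that \<rho> bump_eq_0[of "2 * ?m + 1" \<rho> u u0] by auto
  qed
  have C00: "0 \<le> C0" by (simp add: C0_def)
  define C where "C = sqrt C1 + \<bar>C2\<bar> + C0"
  have stat: "cmod (J \<omega> L) \<le> C * L powr (- (real ?m / 2))" if "\<omega> \<in> W" "0 < L" for \<omega> L
  proof -
    have "cmod (J \<omega> L) \<le> sqrt (C1 / L ^ ?m)" using C1(2)[OF that] by (rule real_le_rsqrt)
    also have "\<dots> = sqrt C1 * L powr (- (real ?m / 2))"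
    proof -
      have "sqrt (L ^ ?m) = (L powr real ?m) powr (1 / 2)" using that(2) by (simp add: powr_half_sqrt powr_realpow)
      also have "\<dots> = L powr (real ?m / 2)" by (simp add: powr_powr)
      finally have "sqrt (L ^ ?m) = L powr (real ?m / 2)" .
      then show ?thesis by (simp only: real_sqrt_divide powr_minus_divide times_divide_eq_right mult_1_right)
    qed
    also have "\<dots> \<le> C * L powr (- (real ?m / 2))" using C00 by (intro mult_right_mono) (auto simp: C_def)
    finally show ?thesis .
  qed
  show thesis
  proof (rule that[of \<rho> C])
    show "0 \<le> C" using C1 C00 by (simp add: C_def)
    show "\<rho> \<le> r" "0 < \<rho>" using \<rho> \<rho>2 by auto
    show "cball u0 \<rho> \<subseteq> V" by (rule order_trans[OF subset_cball[OF less_imp_le[OF \<rho>(2)]] subV])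
    fix \<omega> :: "real^'n" and L :: real
    assume \<omega>: "norm \<omega> = 1" and L: "0 < L"
    have "cmod (J \<omega> L) \<le> C * L powr (- (real ?m / 2))"
    proof (cases "\<omega> \<in> Wc")
      case False
      then have "dist N0 \<omega> < \<delta> \<or> dist (- N0) \<omega> < \<delta>" using \<omega> by (simp add: Wc_def)
      moreover have "dist N0 \<omega> = norm (\<omega> - N0)" by (simp add: dist_norm norm_minus_commute)
      moreover have "dist (- N0) \<omega> = norm (- \<omega> - N0)" by (simp add: dist_norm minus_diff_commute[of N0 \<omega>])
      ultimately consider "\<omega> \<in> W" | "- \<omega> \<in> W" using \<omega> by (auto simp: W_def)
      then show ?thesis
      proof cases
        case 2
        have "J \<omega> L = cnj (J (- \<omega>) L)" unfolding J_def using bump_integral_cnj[of _ L \<phi> "- \<omega>"] by simp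
        then show ?thesis using stat[OF 2 L] by simp
      qed (use stat L in blast)
    next
      case True
      obtain i where i: "c2 \<le> \<bar>partial i \<phi> u0 \<bullet> \<omega>\<bar>" using c2(2)[OF True] by blast
      have "\<exists>i. \<forall>u\<in>ball u0 \<rho>2. c2 / 2 \<le> \<bar>partial i \<phi> u \<bullet> \<omega>\<bar>"
      proof (intro exI[of _ i] ballI)
        fix u assume "u \<in> ball u0 \<rho>2"
        then have "norm (partial i \<phi> u - partial i \<phi> u0) < c2 / 2"
          using \<rho>b(2)[of u i] \<rho>2 by (simp add: dist_norm norm_minus_commute)
        moreover have "\<bar>(partial i \<phi> u - partial i \<phi> u0) \<bullet> \<omega>\<bar> \<le> norm (partial i \<phi> u - partial i \<phi> u0) * norm \<omega>"
          by (rule Cauchy_Schwarz_ineq2)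
        ultimately have "\<bar>partial i \<phi> u \<bullet> \<omega> - partial i \<phi> u0 \<bullet> \<omega>\<bar> \<le> c2 / 2" using \<omega> by (simp add: inner_diff_left)
        then show "c2 / 2 \<le> \<bar>partial i \<phi> u \<bullet> \<omega>\<bar>" using i by linarith
      qed
      note 1 = C2[OF \<omega> this L]
      show ?thesis
      \<comment> \<open>For large \<open>L\<close> the stronger decay of order 2m is weakened to
        m/2; for small \<open>L\<close> the target exceeds the constant, so the trivial bound
        suffices.\<close>
      proof (cases "1 \<le> L")
        case True
        have "C2 / L ^ (2 * ?m) \<le> \<bar>C2\<bar> * L powr (- (real ?m / 2))"
        proof -
          have "L powr (real ?m / 2) \<le> L powr real (2 * ?m)" using True by (intro powr_mono) auto
          then have "L powr (real ?m / 2) \<le> L ^ (2 * ?m)" using L by (simp only: powr_realpow)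
          then have "\<bar>C2\<bar> / L ^ (2 * ?m) \<le> \<bar>C2\<bar> / L powr (real ?m / 2)" using L by (intro divide_left_mono) auto
          moreover have "C2 / L ^ (2 * ?m) \<le> \<bar>C2\<bar> / L ^ (2 * ?m)" using L by (intro divide_right_mono) auto
          ultimately have "C2 / L ^ (2 * ?m) \<le> \<bar>C2\<bar> / L powr (real ?m / 2)" by linarith
          then show ?thesis by (simp only: powr_minus_divide times_divide_eq_right mult_1_right)
        qed
        also have "\<dots> \<le> C * L powr (- (real ?m / 2))" using C1 C00 by (intro mult_right_mono) (auto simp: C_def)
        finally show ?thesis using 1 by linarith
      next
        case False
        have "L powr (real ?m / 2) \<le> 1" using False L by (intro powr_le1) auto
        moreover have "0 < L powr (real ?m / 2)" using L by (simp only: powr_gt_zero)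
        ultimately have "1 \<le> L powr (- (real ?m / 2))" by (simp only: powr_minus_divide le_divide_eq_1_pos)
        then have "C0 * 1 \<le> C * L powr (- (real ?m / 2))" using C1 C00 by (intro mult_mono) (auto simp: C_def)
        then show ?thesis using J0[of \<omega> L] by linarith
      qed
    qed
    then show "cmod (\<integral>u. of_real (bump u0 \<rho> (2 * ?m + 1) u) * cis (L * (\<phi> u \<bullet> \<omega>)) \<partial>lborel) \<le> C * L powr (- (real ?m / 2))"
      by (simp add: J_def)
  qed
qed

section \<open>A measure on the cone with optimal decay\<close>

text \<open>Here the phase is linear, with |t| as the large parameter and the sign of t as the
  parameter of the family.\<close>

lemma bump_fourier_decay:
  "\<exists>C. \<forall>t::real. t \<noteq> 0 \<longrightarrow> cmod (\<integral>h. of_real (bump c \<rho> (Suc N) h) * cis (t * h) \<partial>lborel) \<le> C / \<bar>t\<bar> ^ N"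
  if \<rho>: "0 < \<rho>" for c \<rho> :: real
proof -
  define D where "D = {(\<sigma>::real, h::real). \<bar>\<sigma>\<bar> = 1 \<and> h \<in> ball c (2 * \<rho>)}"
  define F :: "nat \<Rightarrow> real \<Rightarrow> real \<Rightarrow> real" where "F k \<sigma> h = (if k = 0 then \<sigma> else 0)" for k \<sigma> h
  have slice: "{h. (\<sigma>, h) \<in> D} = (if \<bar>\<sigma>\<bar> = 1 then ball c (2 * \<rho>) else {})" for \<sigma> by (auto simp: D_def)
  have "\<exists>C. \<forall>\<sigma> \<Lambda>. 0 < \<Lambda> \<longrightarrow> cmod (\<integral>h. indicator {h. (\<sigma>, h) \<in> D} h *\<^sub>R (of_real (bump c \<rho> (Suc N) (h + 0)) * cis (\<Lambda> * (\<sigma> * h))) \<partial>lborel) \<le> C / \<Lambda> ^ N"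
  proof (rule nonstationary_phase[where e="\<lambda>_. 1" and ?\<Phi>1.0="F 0" and c=1 and R="2 * \<rho>" and K="\<lambda>\<sigma>. if \<bar>\<sigma>\<bar> = 1 then cball c \<rho> else {}"])
    show "has_dir_deriv (\<lambda>h. \<sigma> * h) (F 0 \<sigma> h) h 1" for \<sigma> h
      unfolding has_dir_deriv_def has_real_derivative_iff_has_vector_derivative[symmetric]
      by (auto simp: F_def intro!: derivative_eq_intros)
    show "dbdd N D (\<lambda>_. 1) (F 0)"
    proof (rule dbdd_chain)
      show "bdd_cont_on D (F k)" for k
        unfolding bdd_cont_on_def F_def by (auto simp: D_def intro!: exI[of _ 1])
      show "has_dir_deriv (F k \<sigma>) (F (Suc k) \<sigma> h) h 1" for k \<sigma> h
        unfolding F_def[abs_def] by (simp add: has_dir_deriv_const)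
    qed
    show "dbdd N D (\<lambda>_. 1) (\<lambda>\<sigma> h. bump c \<rho> (Suc N) (h + 0))"
      by (rule dbdd_bump[where R="2 * \<rho>"]) (auto simp: D_def dist_norm norm_minus_commute)
    show "bump c \<rho> (Suc N) (h + 0) = 0" if "(\<sigma>, h) \<in> D" "h \<notin> (if \<bar>\<sigma>\<bar> = 1 then cball c \<rho> else {})" for \<sigma> h
      using that \<rho> by (auto simp: D_def simp del: cball_eq_atLeastAtMost intro!: bump_eq_0)
    show "(if \<bar>\<sigma>\<bar> = 1 then cball c \<rho> else {}) \<subseteq> {h. (\<sigma>, h) \<in> D}" for \<sigma>
      unfolding slice using \<rho> by (auto simp: dist_real_def)
    show "open {h. (\<sigma>, h) \<in> D}" for \<sigma> unfolding slice by simp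
    show "h \<in> cball c (2 * \<rho>)" if "(\<sigma>, h) \<in> D" for \<sigma> h using that by (auto simp: D_def)
  qed (auto simp: D_def F_def intro!: continuous_intros)
  then obtain C where C: "\<And>\<sigma> \<Lambda>. 0 < \<Lambda> \<Longrightarrow> cmod (\<integral>h. indicator {h. (\<sigma>, h) \<in> D} h *\<^sub>R (of_real (bump c \<rho> (Suc N) (h + 0)) * cis (\<Lambda> * (\<sigma> * h))) \<partial>lborel) \<le> C / \<Lambda> ^ N"
    by blast
  show ?thesis
  proof (intro exI allI impI)
    fix t :: real assume t: "t \<noteq> 0"
    have "of_real (bump c \<rho> (Suc N) h) * cis (t * h) = indicator {h. (sgn t, h) \<in> D} h *\<^sub>R (of_real (bump c \<rho> (Suc N) (h + 0)) * cis (\<bar>t\<bar> * (sgn t * h)))" for h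
    proof (cases "h \<in> ball c (2 * \<rho>)")
      case True
      have e: "\<bar>t\<bar> * (sgn t * h) = t * h" by (metis abs_mult_sgn mult.assoc)
      show ?thesis unfolding slice e using t True by (simp add: abs_sgn_eq)
    next
      case False
      then have "bump c \<rho> (Suc N) h = 0" using \<rho> by (intro bump_eq_0) auto
      then show ?thesis by simp
    qed
    then show "cmod (\<integral>h. of_real (bump c \<rho> (Suc N) h) * cis (t * h) \<partial>lborel) \<le> C / \<bar>t\<bar> ^ N"
      using C[of "\<bar>t\<bar>" "sgn t"] t by simp
  qed
qed

section \<open>Integrals of bumps\<close>

lemma bump_integrable:
  fixes c :: "'a::euclidean_space"
  assumes "0 < \<rho>" "1 \<le> k"
  shows "integrable lborel (bump c \<rho> k)"
proof -
  have "integrable lborel (\<lambda>u. indicator (cball c \<rho>) u *\<^sub>R bump c \<rho> k u)"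
    by (intro borel_integrable_compact bump_continuous compact_cball)
  also have "(\<lambda>u. indicator (cball c \<rho>) u *\<^sub>R bump c \<rho> k u) = bump c \<rho> k"
  proof
    fix u show "indicator (cball c \<rho>) u *\<^sub>R bump c \<rho> k u = bump c \<rho> k u"
      using bump_eq_0[OF assms(2), of \<rho> u c] assms(1) by (cases "u \<in> cball c \<rho>") auto
  qed
  finally show ?thesis .
qed

lemma bump_borel [measurable]: "(bump c \<rho> k :: 'a::euclidean_space \<Rightarrow> real) \<in> borel_measurable borel"
  by (rule borel_measurable_continuous_onI[OF bump_continuous])

lemma bump_pos:
  assumes "u \<in> ball c \<rho>"
  shows "0 < bump c \<rho> k u"
proof -
  have "(norm (u - c))\<^sup>2 < \<rho>\<^sup>2"
    using assms by (intro power_strict_mono) (auto simp: dist_norm norm_minus_commute)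
  then show ?thesis unfolding bump_def by (intro zero_less_power) (simp add: less_max_iff_disj)
qed

lemma bump_integral_pos:
  fixes c :: "'a::euclidean_space"
  assumes "0 < \<rho>" "1 \<le> k"
  shows "0 < (\<integral>u. bump c \<rho> k u \<partial>lborel)"
proof -
  have "(\<integral>u. bump c \<rho> k u \<partial>lborel) \<noteq> 0"
  proof
    assume "(\<integral>u. bump c \<rho> k u \<partial>lborel) = 0"
    then have "AE u in lborel. bump c \<rho> k u = 0"
      by (simp add: integral_nonneg_eq_0_iff_AE[OF bump_integrable[OF assms]] bump_nonneg)
    then have "AE u in lborel. u \<notin> ball c \<rho>" by eventually_elim (metis bump_pos less_irrefl)
    then have "emeasure lborel (ball c \<rho>) = 0"
      by (subst (asm) AE_iff_measurable[OF _ refl]) (auto simp: ball_def)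
    then show False using content_ball_pos[OF assms(1), of c] by (simp add: measure_def)
  qed
  moreover have "0 \<le> (\<integral>u. bump c \<rho> k u \<partial>lborel)" by (intro Bochner_Integration.integral_nonneg bump_nonneg)
  ultimately show ?thesis by simp
qed

text \<open>The order of integration depends on the frequency. If its surface component dominates,
  the u-integral decays for every fixed h; if its last component dominates, the h-integral decays
  for every fixed u, since the phase is linear in h.\<close>

lemma cone_measure_exists:
  fixes \<phi> :: "real^'m::finite \<Rightarrow> real^'n::finite"
  assumes \<rho>: "0 < \<rho>" and cont: "continuous_on (cball u0 \<rho>) \<phi>" and img: "\<phi> ` cball u0 \<rho> \<subseteq> S" and C: "0 \<le> C"
    and decay: "\<And>\<omega> L. norm \<omega> = 1 \<Longrightarrow> 0 < L \<Longrightarrow>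
      cmod (\<integral>u. of_real (bump u0 \<rho> (2 * CARD('m) + 1) u) * cis (L * (\<phi> u \<bullet> \<omega>)) \<partial>lborel) \<le> C * L powr (- (real CARD('m) / 2))"
  shows "\<exists>\<mu>\<in>measures_on (cone_over S). \<exists>B. \<forall>\<xi>. norm \<xi> powr (real CARD('m) / 2) * cmod (fourier_transform \<mu> \<xi>) \<le> B"
proof -
  let ?m = "CARD('m)"
  let ?k = "2 * ?m + 1"
  define a where "a = (bump u0 \<rho> ?k :: real^'m \<Rightarrow> real)"
  \<comment> \<open>Supported in [1,2], hence away from the apex, where the frequency h times the
    surface component would degenerate.\<close>
  define \<eta> where "\<eta> = (bump (3/2) (1/2) ?k :: real \<Rightarrow> real)"
  \<comment> \<open>\<open>\<phi>\<close> is controlled on the ball only; cutting it off gives a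
    Borel map on the whole space and changes nothing where the density is nonzero.\<close>
  define \<phi>' where "\<phi>' u = indicator (cball u0 \<rho>) u *\<^sub>R \<phi> u" for u
  have [measurable]: "a \<in> borel_measurable borel" "\<eta> \<in> borel_measurable borel" by (simp_all add: a_def \<eta>_def)
  have [measurable]: "\<phi>' \<in> borel_measurable borel"
    unfolding \<phi>'_def[abs_def] by (rule borel_measurable_continuous_on_indicator[OF _ cont]) simp
  have a0: "0 \<le> a u" "u \<notin> cball u0 \<rho> \<Longrightarrow> a u = 0" for u
    using \<rho> by (auto simp: a_def bump_nonneg intro!: bump_eq_0)
  have \<eta>0: "0 \<le> \<eta> h" "h \<notin> {1..2} \<Longrightarrow> \<eta> h = 0" for h
    by (auto simp: \<eta>_def bump_nonneg dist_real_def intro!: bump_eq_0)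
  have ai: "integrable lborel a" and \<eta>i: "integrable lborel \<eta>"
    unfolding a_def \<eta>_def using \<rho> by (auto intro!: bump_integrable)
  have apos: "0 < (\<integral>u. a u \<partial>lborel)" and \<eta>pos: "0 < (\<integral>h. \<eta> h \<partial>lborel)"
    unfolding a_def \<eta>_def using \<rho> by (auto intro!: bump_integral_pos)
  define P where "P = (lborel :: (real^'m) measure) \<Otimes>\<^sub>M (lborel :: real measure)"
  have [measurable_cong]: "sets P = sets (borel \<Otimes>\<^sub>M borel)" unfolding P_def by (intro sets_pair_measure_cong) auto
  define f where "f = (\<lambda>(u, h). a u * \<eta> h)"
  define T where "T = (\<lambda>(u, h::real). (h *\<^sub>R \<phi>' u, h))"
  have f0: "0 \<le> f p" for p using a0 \<eta>0 by (auto simp: f_def split: prod.split)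
  have f_meas [measurable]: "f \<in> borel_measurable P" unfolding f_def by measurable
  have T_meas [measurable]: "T \<in> measurable P borel"
    unfolding T_def borel_prod[symmetric] by measurable
  have fi: "integrable P f"
    unfolding f_def P_def using ai \<eta>i a0 \<eta>0
    by (intro lborel_pair.integrable_pair_dominated[where g=a and h=\<eta>]) (auto simp: abs_mult)
  define \<mu> where "\<mu> = distr (density P f) borel T"
  have sets: "sets \<mu> = sets borel" by (simp add: \<mu>_def)
  have tot: "emeasure \<mu> (space \<mu>) = ennreal (\<integral>p. f p \<partial>P)"
  proof -
    have "emeasure \<mu> (space \<mu>) = emeasure (density P f) (space (density P f))"
      unfolding \<mu>_def by (subst emeasure_distr) auto
    also have "\<dots> = (\<integral>\<^sup>+p. f p \<partial>P)" by (subst emeasure_density) (auto intro!: nn_integral_cong)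
    also have "\<dots> = ennreal (\<integral>p. f p \<partial>P)" by (rule nn_integral_eq_integral[OF fi]) (simp add: f0)
    finally show ?thesis .
  qed
  have "(\<integral>p. f p \<partial>P) = (\<integral>u. (\<integral>h. a u * \<eta> h \<partial>lborel) \<partial>lborel)"
    unfolding P_def f_def by (rule lborel_pair.integral_fst[symmetric]) (use fi in \<open>simp add: P_def f_def\<close>)
  also have "\<dots> = (\<integral>u. a u \<partial>lborel) * (\<integral>h. \<eta> h \<partial>lborel)" by simp
  finally have fpos: "0 < (\<integral>p. f p \<partial>P)" using apos \<eta>pos by simp
  have fin: "finite_measure \<mu>" by (rule finite_measureI) (simp add: tot)
  \<comment> \<open>A compact, hence closed, piece of the cone that carries all the mass: closedness
    is what makes it contain the support.\<close>
  define Kc where "Kc = (\<lambda>(u, h). (h *\<^sub>R \<phi> u, h)) ` (cball u0 \<rho> \<times> {1..2::real})"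
  have "compact Kc" unfolding Kc_def
  proof (rule compact_continuous_image)
    show "compact (cball u0 \<rho> \<times> {1..2::real})" by (intro compact_Times) auto
    have "continuous_on (cball u0 \<rho> \<times> {1..2::real}) (\<lambda>p. \<phi> (fst p))"
      by (rule continuous_on_compose2[OF cont]) (auto intro!: continuous_intros)
    then show "continuous_on (cball u0 \<rho> \<times> {1..2::real}) (\<lambda>(u, h). (h *\<^sub>R \<phi> u, h))"
      unfolding case_prod_beta' by (intro continuous_intros)
  qed
  then have Kcl: "closed Kc" by (rule compact_imp_closed)
  have KcS: "Kc \<subseteq> cone_over S" using img unfolding Kc_def cone_over_def by auto
  have fT: "T p \<in> Kc" if "f p \<noteq> 0" for p
  proof -
    obtain u h where p: "p = (u, h)" by (cases p)
    have "u \<in> cball u0 \<rho>" "h \<in> {1..2}" using that a0(2)[of u] \<eta>0(2)[of h] by (auto simp: f_def p)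
    then show ?thesis unfolding Kc_def T_def p by (auto simp: \<phi>'_def intro!: image_eqI[of _ _ "(u, h)"])
  qed
  have null: "emeasure \<mu> (- Kc) = 0"
  proof -
    have [measurable]: "- Kc \<in> sets borel" using Kcl by auto
    have "emeasure \<mu> (- Kc) = emeasure (density P f) (T -` (- Kc) \<inter> space (density P f))"
      unfolding \<mu>_def by (subst emeasure_distr) auto
    also have "\<dots> = (\<integral>\<^sup>+p. ennreal (f p) * indicator (T -` (- Kc) \<inter> space P) p \<partial>P)"
      by (subst emeasure_density) (auto intro!: measurable_sets[OF T_meas])
    also have "\<dots> = (\<integral>\<^sup>+p. 0 \<partial>P)"
    proof (rule nn_integral_cong)
      fix p
      show "ennreal (f p) * indicator (T -` (- Kc) \<inter> space P) p = 0"
        using fT[of p] by (cases "f p = 0") (simp_all add: indicator_def)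
    qed
    finally show ?thesis by simp
  qed
  have supp: "msupport \<mu> \<subseteq> cone_over S"
  proof -
    have "msupport \<mu> \<subseteq> Kc"
    proof
      fix x assume x: "x \<in> msupport \<mu>"
      show "x \<in> Kc"
      proof (rule ccontr)
        assume "x \<notin> Kc"
        then have "0 < emeasure \<mu> (- Kc)" using x Kcl unfolding msupport_def by (auto simp: open_Compl)
        then show False using null by simp
      qed
    qed
    then show ?thesis using KcS by blast
  qed
  have mem: "\<mu> \<in> measures_on (cone_over S)"
    unfolding measures_on_def using sets fin supp tot fpos by (simp add: ennreal_eq_0_iff)
  define g where "g \<xi> u h = of_real (a u * \<eta> h) * cis (- 2 * pi * (h * (\<phi>' u \<bullet> fst \<xi> + snd \<xi>)))" for \<xi> :: "(real^'n) \<times> real" and u h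
  have gi: "integrable (lborel \<Otimes>\<^sub>M lborel) (case_prod (g \<xi>))" for \<xi>
  proof (rule lborel_pair.integrable_pair_dominated[where g=a and h=\<eta>])
    have "case_prod (g \<xi>) \<in> borel_measurable P" unfolding g_def by measurable
    then show "case_prod (g \<xi>) \<in> borel_measurable (lborel \<Otimes>\<^sub>M lborel)" by (simp add: P_def)
  qed (use ai \<eta>i a0 \<eta>0 in \<open>auto simp: g_def norm_mult\<close>)
  have ft: "fourier_transform \<mu> \<xi> = (\<integral>p. case_prod (g \<xi>) p \<partial>P)" for \<xi>
  proof -
    have "fourier_transform \<mu> \<xi> = (\<integral>p. cis (- 2 * pi * (T p \<bullet> \<xi>)) \<partial>density P f)"
      unfolding fourier_transform_def \<mu>_def by (subst integral_distr) auto
    also have "\<dots> = (\<integral>p. f p *\<^sub>R cis (- 2 * pi * (T p \<bullet> \<xi>)) \<partial>P)"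
      by (subst integral_density) (auto simp: f0)
    also have "\<dots> = (\<integral>p. case_prod (g \<xi>) p \<partial>P)"
    proof (rule Bochner_Integration.integral_cong[OF refl])
      fix p :: "(real^'m) \<times> real"
      obtain u h where p: "p = (u, h)" by (cases p)
      have "T p \<bullet> \<xi> = h * (\<phi>' u \<bullet> fst \<xi> + snd \<xi>)" by (simp add: p T_def inner_prod_def algebra_simps)
      then show "f p *\<^sub>R cis (- 2 * pi * (T p \<bullet> \<xi>)) = case_prod (g \<xi>) p"
        by (simp add: p f_def g_def scaleR_conv_of_real)
    qed
    finally show ?thesis .
  qed
  have ft1: "fourier_transform \<mu> \<xi> = (\<integral>u. (\<integral>h. g \<xi> u h \<partial>lborel) \<partial>lborel)" for \<xi>
    unfolding ft P_def using lborel_pair.integral_fst[OF gi[of \<xi>]] by simp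
  have ft2: "fourier_transform \<mu> \<xi> = (\<integral>h. (\<integral>u. g \<xi> u h \<partial>lborel) \<partial>lborel)" for \<xi>
    unfolding ft P_def using lborel_pair.integral_snd[OF gi[of \<xi>]] by simp
  have "bounded (\<phi> ` cball u0 \<rho>)" by (intro compact_imp_bounded compact_continuous_image cont compact_cball)
  then obtain K0 where K0: "0 < K0" "\<And>u. u \<in> cball u0 \<rho> \<Longrightarrow> norm (\<phi> u) \<le> K0" unfolding bounded_pos by blast
  define K where "K = K0 + 1"
  have K: "1 \<le> K" "\<And>u. u \<in> cball u0 \<rho> \<Longrightarrow> norm (\<phi> u) \<le> K" using K0 by (fastforce simp: K_def)+
  obtain C3 where C3: "\<And>t::real. t \<noteq> 0 \<Longrightarrow> cmod (\<integral>h. of_real (\<eta> h) * cis (t * h) \<partial>lborel) \<le> C3 / \<bar>t\<bar> ^ (2 * ?m)"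
    using bump_fourier_decay[of "1/2" "3/2" "2 * ?m"] unfolding \<eta>_def by auto
  let ?s = "real ?m / 2"
  let ?A = "\<integral>u. a u \<partial>lborel" and ?E = "\<integral>h. \<eta> h \<partial>lborel"
  define BA where "BA = ((1 + 2 * K) powr ?s) * (C * ?E)"
  have caseA: "norm \<xi> powr ?s * cmod (fourier_transform \<mu> \<xi>) \<le> BA"
    if le: "\<bar>snd \<xi>\<bar> \<le> 2 * K * norm (fst \<xi>)" and nz: "fst \<xi> \<noteq> 0" for \<xi>
  proof -
    let ?z = "norm (fst \<xi>)"
    define \<omega> where "\<omega> = - (fst \<xi> /\<^sub>R ?z)"
    have \<omega>: "norm \<omega> = 1" using nz by (simp add: \<omega>_def)
    have zw: "fst \<xi> = - (?z *\<^sub>R \<omega>)" using nz by (simp add: \<omega>_def)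
    have inner: "cmod (\<integral>u. g \<xi> u h \<partial>lborel) \<le> \<eta> h * (C * ?z powr (- ?s))" for h
    proof (cases "h \<in> {1..2}")
      case True
      let ?L = "2 * pi * h * ?z"
      \<comment> \<open>As h is at least 1, the effective frequency \<open>?L\<close> is at least
        that of the surface component, and the decay in \<open>?L\<close> can be replaced by decay
        in \<open>?z\<close>.\<close>
      have "?z \<le> ?L" using True pi_gt3 mult_right_mono[of 1 "2 * pi * h" ?z] mult_mono[of 1 "2 * pi" 1 h] by simp
      have L: "0 < ?L" using True nz by simp
      have "g \<xi> u h = (of_real (\<eta> h) * cis (- 2 * pi * h * snd \<xi>)) * (of_real (a u) * cis (?L * (\<phi> u \<bullet> \<omega>)))" for u
      proof (cases "u \<in> cball u0 \<rho>")
        case True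
        have "\<phi> u \<bullet> fst \<xi> = - (?z * (\<phi> u \<bullet> \<omega>))" by (subst zw) simp
        then have "- 2 * pi * (h * (\<phi>' u \<bullet> fst \<xi> + snd \<xi>)) = (- 2 * pi * h * snd \<xi>) + ?L * (\<phi> u \<bullet> \<omega>)"
          using True by (simp add: \<phi>'_def algebra_simps)
        then have "cis (- 2 * pi * (h * (\<phi>' u \<bullet> fst \<xi> + snd \<xi>))) = cis (- 2 * pi * h * snd \<xi>) * cis (?L * (\<phi> u \<bullet> \<omega>))"
          by (simp only: cis_mult)
        then show ?thesis unfolding g_def by (simp only: of_real_mult mult_ac)
      qed (simp add: g_def a0)
      then have "(\<integral>u. g \<xi> u h \<partial>lborel) = (of_real (\<eta> h) * cis (- 2 * pi * h * snd \<xi>)) * (\<integral>u. of_real (a u) * cis (?L * (\<phi> u \<bullet> \<omega>)) \<partial>lborel)"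
        by (simp only: integral_mult_right_zero)
      then have "cmod (\<integral>u. g \<xi> u h \<partial>lborel) = \<eta> h * cmod (\<integral>u. of_real (a u) * cis (?L * (\<phi> u \<bullet> \<omega>)) \<partial>lborel)"
        using \<eta>0(1)[of h] by (simp only: norm_mult norm_cis norm_of_real abs_of_nonneg mult_1_right)
      also have "\<dots> \<le> \<eta> h * (C * ?L powr (- ?s))"
        unfolding a_def by (intro mult_left_mono decay \<omega> L \<eta>0)
      also have "\<dots> \<le> \<eta> h * (C * ?z powr (- ?s))"
        using \<open>?z \<le> ?L\<close> nz C by (intro mult_left_mono \<eta>0 powr_mono2') auto
      finally show ?thesis .
    qed (use \<eta>0(2)[of h] in \<open>simp add: g_def\<close>)
    have "cmod (fourier_transform \<mu> \<xi>) \<le> (\<integral>h. \<eta> h * (C * ?z powr (- ?s)) \<partial>lborel)"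
      unfolding ft2 by (rule norm_integral_le[OF _ inner]) (use \<eta>i in simp)
    then have b: "cmod (fourier_transform \<mu> \<xi>) \<le> ?E * (C * ?z powr (- ?s))" by simp
    have "norm \<xi> \<le> ?z + \<bar>snd \<xi>\<bar>" using norm_Pair_le[of "fst \<xi>" "snd \<xi>"] by simp
    also have "\<dots> \<le> (1 + 2 * K) * ?z" using le by (simp add: algebra_simps)
    finally have "norm \<xi> powr ?s \<le> ((1 + 2 * K) * ?z) powr ?s" by (intro powr_mono2) auto
    also have "\<dots> = (1 + 2 * K) powr ?s * ?z powr ?s" using K by (simp add: powr_mult)
    finally have "norm \<xi> powr ?s * cmod (fourier_transform \<mu> \<xi>) \<le> ((1 + 2 * K) powr ?s * ?z powr ?s) * (?E * (C * ?z powr (- ?s)))"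
      using b \<eta>pos C by (intro mult_mono) auto
    also have "\<dots> = BA * (?z powr ?s * ?z powr (- ?s))" by (simp add: BA_def mult_ac)
    also have "?z powr ?s * ?z powr (- ?s) = 1" using nz by (simp flip: powr_add)
    finally show ?thesis by simp
  qed
  have caseB: "norm \<xi> powr ?s * cmod (fourier_transform \<mu> \<xi>) \<le> ?A * \<bar>C3\<bar>"
    if gt: "2 * K * norm (fst \<xi>) < \<bar>snd \<xi>\<bar>" and big: "1 \<le> norm \<xi>" for \<xi>
  proof -
    let ?z = "norm (fst \<xi>)"
    have "2 * ?z \<le> 2 * K * ?z" using K(1) mult_right_mono[of 1 K ?z] by simp
    then have "norm \<xi> \<le> 2 * \<bar>snd \<xi>\<bar>" using gt norm_Pair_le[of "fst \<xi>" "snd \<xi>"] norm_ge_zero[of "fst \<xi>"] by simp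
    have inner: "cmod (\<integral>h. g \<xi> u h \<partial>lborel) \<le> a u * (\<bar>C3\<bar> * norm \<xi> powr (- ?s))" for u
    proof (cases "u \<in> cball u0 \<rho>")
      case True
      let ?t = "- 2 * pi * (\<phi> u \<bullet> fst \<xi> + snd \<xi>)"
      have "\<bar>\<phi> u \<bullet> fst \<xi>\<bar> \<le> norm (\<phi> u) * ?z" by (rule Cauchy_Schwarz_ineq2)
      also have "\<dots> \<le> K * ?z" using K(2)[OF True] by (intro mult_right_mono) auto
      \<comment> \<open>The surface term is at most half of the last component, so they cannot
        cancel. With 2 pi at least 4, the frequency of the h-integral is then at least the norm of
        \<open>\<xi>\<close>.\<close>
      finally have "\<bar>snd \<xi>\<bar> / 2 \<le> \<bar>\<phi> u \<bullet> fst \<xi> + snd \<xi>\<bar>" using gt by linarith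
      then have "norm \<xi> / 4 \<le> \<bar>\<phi> u \<bullet> fst \<xi> + snd \<xi>\<bar>" using \<open>norm \<xi> \<le> 2 * \<bar>snd \<xi>\<bar>\<close> by linarith
      then have "4 * (norm \<xi> / 4) \<le> (2 * pi) * \<bar>\<phi> u \<bullet> fst \<xi> + snd \<xi>\<bar>"
        using pi_gt3 by (intro mult_mono) auto
      then have t: "norm \<xi> \<le> \<bar>?t\<bar>" by (simp add: abs_mult)
      then have tp: "0 < \<bar>?t\<bar>" using big by linarith
      then have tnz: "?t \<noteq> 0" by (simp only: zero_less_abs_iff not_False_eq_True)
      have "g \<xi> u h = of_real (a u) * (of_real (\<eta> h) * cis (?t * h))" for h
        using True by (simp add: g_def \<phi>'_def mult_ac)
      then have "(\<integral>h. g \<xi> u h \<partial>lborel) = of_real (a u) * (\<integral>h. of_real (\<eta> h) * cis (?t * h) \<partial>lborel)"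
        by (simp only: integral_mult_right_zero)
      then have "cmod (\<integral>h. g \<xi> u h \<partial>lborel) = a u * cmod (\<integral>h. of_real (\<eta> h) * cis (?t * h) \<partial>lborel)"
        using a0(1)[of u] by (simp only: norm_mult norm_of_real abs_of_nonneg)
      also have "\<dots> \<le> a u * (C3 / \<bar>?t\<bar> ^ (2 * ?m))" by (intro mult_left_mono C3[OF tnz] a0)
      also have "\<dots> \<le> a u * (\<bar>C3\<bar> * norm \<xi> powr (- ?s))"
      proof (rule mult_left_mono[OF _ a0(1)])
        have "C3 / \<bar>?t\<bar> ^ (2 * ?m) \<le> \<bar>C3\<bar> / \<bar>?t\<bar> ^ (2 * ?m)" by (intro divide_right_mono) auto
        also have "\<dots> \<le> \<bar>C3\<bar> / norm \<xi> ^ (2 * ?m)"           by (intro divide_left_mono power_mono mult_pos_pos zero_less_power) (use t tp big in linarith)+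
        also have "\<dots> \<le> \<bar>C3\<bar> / norm \<xi> powr ?s"
        proof -
          have "norm \<xi> powr ?s \<le> norm \<xi> powr real (2 * ?m)" using big by (intro powr_mono) auto
          then have "norm \<xi> powr ?s \<le> norm \<xi> ^ (2 * ?m)" using big by (subst (asm) powr_realpow) auto
          moreover have "\<xi> \<noteq> 0" using big by auto
          ultimately show ?thesis by (intro divide_left_mono mult_pos_pos zero_less_power) auto
        qed
        finally show "C3 / \<bar>?t\<bar> ^ (2 * ?m) \<le> \<bar>C3\<bar> * norm \<xi> powr (- ?s)" by (simp only: powr_minus_divide times_divide_eq_right mult_1_right)
      qed
      finally show ?thesis .
    qed (use a0(2)[of u] in \<open>simp add: g_def\<close>)
    have "cmod (fourier_transform \<mu> \<xi>) \<le> (\<integral>u. a u * (\<bar>C3\<bar> * norm \<xi> powr (- ?s)) \<partial>lborel)"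
      unfolding ft1 by (rule norm_integral_le[OF _ inner]) (use ai in simp)
    then have "norm \<xi> powr ?s * cmod (fourier_transform \<mu> \<xi>) \<le> norm \<xi> powr ?s * (?A * (\<bar>C3\<bar> * norm \<xi> powr (- ?s)))"
      by (intro mult_left_mono) auto
    also have "\<dots> = ?A * \<bar>C3\<bar> * (norm \<xi> powr ?s * norm \<xi> powr (- ?s))" by (simp add: mult_ac)
    also have "norm \<xi> powr ?s * norm \<xi> powr (- ?s) = 1"
    proof -
      have "\<xi> \<noteq> 0" using big by auto
      then show ?thesis by (simp flip: powr_add)
    qed
    finally show ?thesis by simp
  qed
  define Mt where "Mt = measure \<mu> (space \<mu>)"
  have Mt: "cmod (fourier_transform \<mu> \<xi>) \<le> Mt" for \<xi>
  proof -
    interpret finite_measure \<mu> by (rule fin)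
    have "cmod (fourier_transform \<mu> \<xi>) \<le> (\<integral>y. 1 \<partial>\<mu>)" unfolding fourier_transform_def
      by (intro norm_integral_le) auto
    then show ?thesis by (simp add: Mt_def)
  qed
  have "norm \<xi> powr ?s * cmod (fourier_transform \<mu> \<xi>) \<le> max Mt (max BA (?A * \<bar>C3\<bar>))" for \<xi>
  proof (cases "1 \<le> norm \<xi>")
    case True
    show ?thesis
    proof (cases "\<bar>snd \<xi>\<bar> \<le> 2 * K * norm (fst \<xi>)")
      case le: True
      have "fst \<xi> \<noteq> 0"
      proof
        assume "fst \<xi> = 0"
        then have "\<xi> = 0" using le by (simp add: prod_eq_iff)
        then show False using True by simp
      qed
      then show ?thesis using caseA[OF le] by linarith
    next
      case False
      then show ?thesis using caseB[of \<xi>] True by linarith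
    qed
  next
    case False
    then have "norm \<xi> powr ?s \<le> 1" by (intro powr_le1) auto
    then have "norm \<xi> powr ?s * cmod (fourier_transform \<mu> \<xi>) \<le> 1 * Mt" using Mt[of \<xi>] by (intro mult_mono) auto
    then show ?thesis by linarith
  qed
  then show ?thesis using mem by blast
qed

section \<open>The two bounds combined\<close>

theorem mainTheorem1:
  fixes S :: "(real^'n) set"
  assumes dim: "CARD('n) = CARD('m) + 1"
    and mfd: "smooth_submanifold_bdry TYPE('m) S"
    and ne: "S \<noteq> {}"
    and curv: "\<forall>p\<in>manifold_interior TYPE('m) S. \<forall>U V (\<phi>::real^'m \<Rightarrow> real^'n) k u.
                 hs_chart S U V \<phi> k \<and> u \<in> V \<and> 0 < u $ k \<and> \<phi> u = p
                 \<longrightarrow> gauss_curvature \<phi> u \<noteq> 0"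
  shows "fourier_dim (cone_over S) = real CARD('n) - 1"
proof -
  obtain p where "p \<in> S" using ne by blast
  then obtain U V and \<phi> :: "real^'m \<Rightarrow> real^'n" and k where pU: "p \<in> U" and ch: "hs_chart S U V \<phi> k"
    using mfd unfolding smooth_submanifold_bdry_def by blast
  then obtain \<psi> where V: "open V" and sm: "smooth_on V \<phi>"
    and inj: "\<And>u. u \<in> V \<Longrightarrow> inj (frechet_derivative \<phi> (at u))"
    and hom: "homeomorphism (V \<inter> half_space k) (S \<inter> U) \<phi> \<psi>"
    unfolding hs_chart_def by blast
  have img: "\<phi> ` (V \<inter> half_space k) = S \<inter> U" using hom by (simp add: homeomorphism_def)
  have up: "\<psi> p \<in> V" "0 \<le> \<psi> p $ k"
    using hom \<open>p \<in> S\<close> pU by (auto simp: homeomorphism_def half_space_def)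
  obtain r0 where r0: "0 < r0" "ball (\<psi> p) r0 \<subseteq> V" using V up(1) open_contains_ball by blast
  \<comment> \<open>The chosen point may lie on the boundary; moving its parameter into the half
    space gives an interior point in the same chart, where the curvature hypothesis applies.\<close>
  define u0 where "u0 = \<psi> p + (r0 / 2) *\<^sub>R axis k 1"
  have "dist (\<psi> p) u0 < r0" using r0 by (simp add: u0_def dist_norm)
  then have u0V: "u0 \<in> V" using r0 by auto
  have u0k: "0 < u0 $ k" using up(2) r0 by (simp add: u0_def)
  have "u0 \<in> V \<inter> half_space k" using u0V u0k by (simp add: half_space_def)
  then have "\<phi> u0 \<in> S" using img by blast
  then have "\<phi> u0 \<in> manifold_interior TYPE('m) S"
    unfolding manifold_interior_def using ch u0V u0k by blast
  then have gc: "gauss_curvature \<phi> u0 \<noteq> 0" using curv ch u0V u0k by blast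
  define N0 where "N0 = unit_normal \<phi> u0"
  have "CARD('m) < CARD('n)" using dim by simp
  then have "\<exists>N. norm N = 1 \<and> (\<forall>i. N \<bullet> partial i \<phi> u0 = 0)"
    by (rule normal_exists[where a="\<lambda>i. partial i \<phi> u0"]) blast
  then have "norm N0 = 1 \<and> (\<forall>i. N0 \<bullet> partial i \<phi> u0 = 0)"
    unfolding N0_def unit_normal_def by (rule someI_ex)
  then have N0: "norm N0 = 1" "\<And>i. N0 \<bullet> partial i \<phi> u0 = 0" by auto
  have det: "det (\<chi> i j. partial i (partial j \<phi>) u0 \<bullet> N0) \<noteq> 0"
    using gc unfolding gauss_curvature_def N0_def by auto
  \<comment> \<open>The radius is limited by the height of \<open>u0\<close> above the boundary
    hyperplane, so the ball of parameters is mapped into \<open>S\<close>.\<close>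
  obtain \<rho> C where \<rho>: "0 < \<rho>" "\<rho> \<le> u0 $ k" "cball u0 \<rho> \<subseteq> V" and C: "0 \<le> C"
    and decay: "\<And>\<omega> L. norm \<omega> = 1 \<Longrightarrow> 0 < L \<Longrightarrow>
      cmod (\<integral>u. of_real (bump u0 \<rho> (2 * CARD('m) + 1) u) * cis (L * (\<phi> u \<bullet> \<omega>)) \<partial>lborel) \<le> C * L powr (- (real CARD('m) / 2))"
    by (rule chart_oscillatory_decay[OF sm V u0V inj[OF u0V] dim N0 det u0k]) blast
  have half: "cball u0 \<rho> \<subseteq> half_space k"
  proof
    fix u assume "u \<in> cball u0 \<rho>"
    then have "\<bar>(u - u0) $ k\<bar> \<le> \<rho>" using component_le_norm_cart[of "u - u0" k] by (simp add: dist_norm norm_minus_commute)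
    then show "u \<in> half_space k" using \<rho>(2) by (simp add: half_space_def)
  qed
  have "\<phi> ` cball u0 \<rho> \<subseteq> S" using half \<rho>(3) img by blast
  moreover have "continuous_on (cball u0 \<rho>) \<phi>"
    using continuous_on_subset[OF smooth_on_continuous[OF sm, of "[]"] \<rho>(3)] by simp
  ultimately obtain \<mu> B where "\<mu> \<in> measures_on (cone_over S)"
    "\<And>\<xi>. norm \<xi> powr (real CARD('m) / 2) * cmod (fourier_transform \<mu> \<xi>) \<le> B"
    using cone_measure_exists[OF \<rho>(1) _ _ C decay] by blast
  then have mem: "real CARD('m) \<in> {s. 0 \<le> s \<and> s \<le> real DIM((real^'n) \<times> real) \<and>
      (\<exists>\<mu>\<in>measures_on (cone_over S). \<exists>B. \<forall>\<xi>. norm \<xi> powr (s / 2) * cmod (fourier_transform \<mu> \<xi>) \<le> B)}"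
    using dim by auto
  have "fourier_dim (cone_over S) = real CARD('m)"
    unfolding fourier_dim_def
  \<comment> \<open>The supremum is attained: the exponent m itself is admissible by the measure
    just built, and no admissible exponent exceeds it.\<close>
  proof (rule cSup_eq_maximum[OF mem])
    fix s assume "s \<in> {s. 0 \<le> s \<and> s \<le> real DIM((real^'n) \<times> real) \<and>
      (\<exists>\<mu>\<in>measures_on (cone_over S). \<exists>B. \<forall>\<xi>. norm \<xi> powr (s / 2) * cmod (fourier_transform \<mu> \<xi>) \<le> B)}"
    then show "s \<le> real CARD('m)" using cone_decay_le[OF dim mfd] by blast
  qed
  then show ?thesis using dim by simp
qed

end
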